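(* Let $n=3$, let $v_\infty\in\mathbb{R}^{4,1}$ be non-zero and $t\in\mathbb{R}$. Suppose $\Lambda$ is a CMC surface in $S_{v_\infty}$. Suppose $\alpha_t,L^{\alpha_t}$ are constrained Willmore (real) Bäcklund transformation parameters to $\Lambda$, corresponding to the multiplier $q_\infty^t$, such that $p_\infty^t(\alpha_t)\perp L^{\alpha_t}$. Then the constrained Willmore Bäcklund transform of $\Lambda$ of parameters $\alpha_t,L^{\alpha_t}$ is still a CMC surface in $S_{v_\infty}$, provided that it immerses.
   Context: $\mathbb{R}^{4,1}$ has metric $(\,,\,)$ of signature $(4,1)$, extended complex bilinearly to $\mathbb{C}^{5}$; $\mathcal{L}$ is the set of non-zero null vectors of $\mathbb{R}^{4,1}$; $M$ is an oriented surface; $d$ is the trivial flat connection on $M\times\mathbb{R}^{4,1}$ and on $\underline{\mathbb{C}}^5=M\times\mathbb{C}^5$. The theory is local: restriction to a suitable non-empty open subset of $M$ is always understood. $\wedge^{2}\mathbb{R}^{4,1}\cong o(\mathbb{R}^{4,1})$ by $(v_1\wedge v_2)(w)=(w,v_1)v_2-(w,v_2)v_1$; $[\mu\wedge\eta](X,Y)=[\mu_X,\eta_Y]-[\mu_Y,\eta_X]$; $d^\nabla$ is the exterior derivative on endomorphism-valued forms. A surface is a null line subbundle $\Lambda\subset M\times\mathbb{R}^{4,1}$ defining an immersion $M\to\mathbb{P}(\mathcal{L})\cong S^3$ (standing assumption: not contained in any $2$-sphere of $S^3$). $M$ carries the conformal structure of the metrics $g_\sigma(X,Y)=(d_X\sigma,d_Y\sigma)$,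 $\sigma\in\Gamma(\Lambda)$ never-zero; $(1,0)$/$(0,1)$-parts and $*$ (with $*\omega=-\omega\circ J$) refer to it. For a holomorphic chart $z$, $\Lambda^{1,0}=\langle\sigma,\sigma_z\rangle$, $\Lambda^{0,1}=\langle\sigma,\sigma_{\bar z}\rangle$, $\Lambda^{(1)}=\Lambda^{1,0}+\Lambda^{0,1}$, and the central sphere congruence is (complexified) $S=\langle\sigma,\sigma_z,\sigma_{\bar z},\sigma_{z\bar z}\rangle$. $\mathcal{D}:=\pi_S\circ d\circ\pi_S+\pi_{S^\perp}\circ d\circ\pi_{S^\perp}$, $\mathcal{N}:=d-\mathcal{D}$. A real $q\in\Omega^1(\Lambda\wedge\Lambda^{(1)})$ is a multiplier if $d^{\mathcal{D}}q=0$ and $d^{\mathcal{D}}*\mathcal{N}=2[q\wedge*\mathcal{N}]$. Set $d^{\lambda,q}_S:=\mathcal{D}+\lambda^{-1}\mathcal{N}^{1,0}+\lambda\mathcal{N}^{0,1}+(\lambda^{-2}-1)q^{1,0}+(\lambda^2-1)q^{0,1}$. For non-zero $v_\infty\in\mathbb{R}^{4,1}$, $S_{v_\infty}=\{v\in\mathcal{L}:(v,v_\infty)=-1\}$, $\sigma_\infty:=-\sigma/(\sigma,v_\infty)$, and $v_\infty^T,v_\infty^\perp$ are the orthogonal projections of $v_\infty$ onto $S$ and $S^\perp$. The mean curvature of $\Lambda$ in $S_{v_\infty}$ is $H_\infty:=(v_\infty^\perp,v_\infty^\perp)^{1/2}$; $\Lambda$ is CMC in $S_{v_\infty}$ if this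 is constant. $N$ is the real unit section of $S^\perp$ with $v_\infty^\perp=H_\infty N$ (if $H_\infty=0$, one of the two choices of sign is fixed). For $\Lambda$ CMC in $S_{v_\infty}$: $\eta_\infty:=\frac12\sigma_\infty\wedge dN$, $q_\infty:=H_\infty\eta_\infty$, $q_\infty^t:=q_\infty+t*\eta_\infty$ ($t\in\mathbb{R}$; these are multipliers to $\Lambda$), and $p_\infty^t(\lambda):=\lambda^{-1}\frac12(H_\infty-it)N+v_\infty^T+\lambda\frac12(H_\infty+it)N$. Bäcklund transformation. Let $\rho=\pi_S-\pi_{S^\perp}$. For $a\in\mathbb{C}\backslash\{-1,0,1\}$ and a null line subbundle $L\subset\underline{\mathbb{C}}^{5}$ with $\rho L\cap L^\perp=\{0\}$, let $\pi_L,\pi_{\rho L},\pi_\perp$ be the projections for $\underline{\mathbb{C}}^{5}=L\oplus\rho L\oplus(L\oplus\rho L)^\perp$ and $$p_{a,L}(\lambda)=\tfrac{a-\lambda}{a+\lambda}\pi_L+\pi_\perp+\tfrac{a+\lambda}{a-\lambda}\pi_{\rho L},\qquad q_{a,L}(\lambda)=\tfrac{\lambda-a}{\lambda+a}\pi_L+\pi_\perp+\tfrac{\lambda+a}{\lambda-a}\pi_{\rho L},$$ extended by $p_{a,L}(\infty)=-\pi_L+\pi_\perp-\pi_{\rho L}$, $q_{a,L}(\infty)=I$. Real Bäcklund transformation parameters to $\Lambda$ for a multiplier $q$ are $\alpha\in\mathbb{C}\backslash(S^1\cup\{0\})$ and a $d^{\alpha,q}_S$-parallel null line subbundle $L^\alpha$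 with, locally, $\rho L^\alpha\cap(L^\alpha)^\perp=\{0\}$ and $\rho\tilde L^\alpha\cap(\tilde L^\alpha)^\perp=\{0\}$, where $\tilde L^\alpha:=q_{\overline\alpha^{-1},\overline{L^\alpha}}(\alpha)L^\alpha$. With $r^*:=p_{\alpha,\tilde L^\alpha}\,q_{\overline\alpha^{-1},\overline{L^\alpha}}$, the Bäcklund transform is $\Lambda^*:=r^*(1)^{-1}\big(r^*(\infty)\Lambda^{1,0}\cap r^*(0)\Lambda^{0,1}\big)$, a real null line bundle; it immerses if it defines an immersion of $M$ into $\mathbb{P}(\mathcal{L})$. *)

theory Defs
  imports "HOL-Analysis.Analysis"
begin

section \<open>The light cone of signature (4,1), real and complexified\<close>

text \<open>Coordinates of \<^typ>\<open>real^5\<close> are indexed \<open>1, 2, 3, 4, 5\<close>; the fifth is the timelike one. The form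
  is polymorphic, so that on \<^typ>\<open>complex^5\<close> it is the complex bilinear (not the Hermitian) extension.\<close>

definition mink :: "'a::comm_ring_1^5 \<Rightarrow> 'a^5 \<Rightarrow> 'a" where
  "mink v w = v$1 * w$1 + v$2 * w$2 + v$3 * w$3 + v$4 * w$4 - v$5 * w$5"

definition cplx :: "real^5 \<Rightarrow> complex^5" where
  "cplx v = (\<chi> i. complex_of_real (v$i))"

definition conjv :: "complex^5 \<Rightarrow> complex^5" where
  "conjv v = (\<chi> i. cnj (v$i))"

definition orth :: "('a::comm_ring_1^5) set \<Rightarrow> ('a^5) set" where
  "orth S = {v. \<forall>w\<in>S. mink v w = 0}"

definition vsum :: "('a::comm_ring_1^5) set \<Rightarrow> ('a^5) set \<Rightarrow> ('a^5) set" where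
  "vsum A B = {a + b | a b. a \<in> A \<and> b \<in> B}"

text \<open>Projection onto \<open>A\<close> along \<open>B\<close>; only used when the ambient space is the direct sum of the two.\<close>

definition proj_along :: "('a::comm_ring_1^5) set \<Rightarrow> ('a^5) set \<Rightarrow> 'a^5 \<Rightarrow> 'a^5" where
  "proj_along A B v = (THE a. a \<in> A \<and> v - a \<in> B)"

definition wedge :: "complex^5 \<Rightarrow> complex^5 \<Rightarrow> complex^5 \<Rightarrow> complex^5" where
  "wedge v1 v2 w = mink w v1 *s v2 - mink w v2 *s v1"

definition null_line :: "('a::field^5) set \<Rightarrow> bool" where
  "null_line l \<longleftrightarrow> (\<exists>s. s \<noteq> 0 \<and> mink s s = 0 \<and> l = vec.span {s})"


section \<open>Oriented smooth surfaces\<close>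

definition d_x :: "(complex \<Rightarrow> 'b::real_normed_vector) \<Rightarrow> complex \<Rightarrow> 'b" where
  "d_x f w = frechet_derivative f (at w) 1"

definition d_y :: "(complex \<Rightarrow> 'b::real_normed_vector) \<Rightarrow> complex \<Rightarrow> 'b" where
  "d_y f w = frechet_derivative f (at w) \<i>"

primrec Ck_on :: "nat \<Rightarrow> complex set \<Rightarrow> (complex \<Rightarrow> 'b::real_normed_vector) \<Rightarrow> bool" where
  "Ck_on 0 U f \<longleftrightarrow> continuous_on U f"
| "Ck_on (Suc k) U f \<longleftrightarrow> f differentiable_on U \<and> Ck_on k U (d_x f) \<and> Ck_on k U (d_y f)"

definition smooth_on :: "complex set \<Rightarrow> (complex \<Rightarrow> 'b::real_normed_vector) \<Rightarrow> bool" where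
  "smooth_on U f \<longleftrightarrow> (\<forall>k. Ck_on k U f)"

text \<open>A chart is a domain with a map to the plane. A surface is given by an oriented smooth atlas \<open>M\<close>;
  its underlying set \<open>pts M\<close> is an open subset of the ambient topological space.\<close>

type_synonym 'm chart = "'m set \<times> ('m \<Rightarrow> complex)"

definition pts :: "'m chart set \<Rightarrow> 'm set" where
  "pts M = (\<Union>c\<in>M. fst c)"

definition in_coord :: "'m chart \<Rightarrow> ('m \<Rightarrow> 'b) \<Rightarrow> complex \<Rightarrow> 'b" where
  "in_coord c f = f \<circ> inv_into (fst c) (snd c)"

definition is_chart :: "'m::topological_space chart \<Rightarrow> bool" where
  "is_chart c \<longleftrightarrow> open (fst c) \<and> open (snd c ` fst c) \<and>
     homeomorphism (fst c) (snd c ` fst c) (snd c) (inv_into (fst c) (snd c))"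

text \<open>The transition map from \<open>c\<close> to \<open>c'\<close> is smooth with positive Jacobian determinant;
  \<open>Im (cnj p * q)\<close> is the determinant with columns \<open>p\<close>, \<open>q\<close>.\<close>

definition compatible :: "'m chart \<Rightarrow> 'm chart \<Rightarrow> bool" where
  "compatible c c' \<longleftrightarrow>
     (let U = snd c ` (fst c \<inter> fst c'); \<tau> = in_coord c (snd c')
      in smooth_on U \<tau> \<and> (\<forall>w\<in>U. Im (cnj (d_x \<tau> w) * d_y \<tau> w) > 0))"

definition oriented_surface :: "'m::{t2_space, second_countable_topology} chart set \<Rightarrow> bool" where
  "oriented_surface M \<longleftrightarrow> (\<forall>c\<in>M. is_chart c) \<and> (\<forall>c\<in>M. \<forall>c'\<in>M. compatible c c')"

definition oriented_chart :: "'m::topological_space chart set \<Rightarrow> 'm chart \<Rightarrow> bool" where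
  "oriented_chart M c \<longleftrightarrow>
     is_chart c \<and> fst c \<subseteq> pts M \<and> (\<forall>c'\<in>M. compatible c c' \<and> compatible c' c)"

definition smooth_map :: "'m chart set \<Rightarrow> 'm set \<Rightarrow> ('m \<Rightarrow> 'b::real_normed_vector) \<Rightarrow> bool" where
  "smooth_map M W f \<longleftrightarrow> (\<forall>c\<in>M. smooth_on (snd c ` (fst c \<inter> W)) (in_coord c f))"

definition section_on ::
    "'m::topological_space chart set \<Rightarrow> ('m \<Rightarrow> 'b::real_normed_vector set) \<Rightarrow> 'm set \<Rightarrow> ('m \<Rightarrow> 'b) \<Rightarrow> bool" where
  "section_on M E W \<sigma> \<longleftrightarrow> open W \<and> W \<subseteq> pts M \<and> smooth_map M W \<sigma> \<and> (\<forall>x\<in>W. \<sigma> x \<in> E x)"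

definition lift_on ::
    "'m::topological_space chart set \<Rightarrow> ('m \<Rightarrow> 'b::real_normed_vector set) \<Rightarrow> 'm set \<Rightarrow> ('m \<Rightarrow> 'b) \<Rightarrow> bool" where
  "lift_on M E W \<sigma> \<longleftrightarrow> section_on M E W \<sigma> \<and> (\<forall>x\<in>W. \<sigma> x \<noteq> 0)"

definition null_line_bundle ::
    "'m::topological_space chart set \<Rightarrow> ('m \<Rightarrow> ('a::{field, real_normed_vector}^5) set) \<Rightarrow> bool" where
  "null_line_bundle M E \<longleftrightarrow>
     (\<forall>x\<in>pts M. null_line (E x)) \<and> (\<forall>x\<in>pts M. \<exists>W \<sigma>. x \<in> W \<and> lift_on M E W \<sigma>)"


section \<open>Surfaces in the conformal 3-sphere\<close>

text \<open>The differential of the induced map into the projectivised light cone is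
  \<open>X \<mapsto> d_X \<sigma> mod \<Lambda>\<close>, for any lift \<open>\<sigma>\<close>.\<close>

definition immersed_surface ::
    "'m::topological_space chart set \<Rightarrow> ('m \<Rightarrow> (real^5) set) \<Rightarrow> bool" where
  "immersed_surface M \<Lambda> \<longleftrightarrow> null_line_bundle M \<Lambda> \<and>
     (\<forall>W \<sigma>. lift_on M \<Lambda> W \<sigma> \<longrightarrow> (\<forall>c\<in>M. \<forall>x \<in> W \<inter> fst c. \<forall>a b.
        a *\<^sub>R d_x (in_coord c \<sigma>) (snd c x) + b *\<^sub>R d_y (in_coord c \<sigma>) (snd c x) \<in> \<Lambda> x
          \<longrightarrow> a = 0 \<and> b = 0))"

text \<open>The 2-spheres of the 3-sphere are the sections of the light cone by \<open>n\<^sup>\<bottom>\<close>, \<open>n\<close> spacelike.\<close>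

definition in_some_2_sphere :: "'m chart set \<Rightarrow> ('m \<Rightarrow> (real^5) set) \<Rightarrow> bool" where
  "in_some_2_sphere M \<Lambda> \<longleftrightarrow> (\<exists>n. mink n n > 0 \<and> (\<forall>x\<in>pts M. \<Lambda> x \<subseteq> orth {n}))"

text \<open>Holomorphic charts of the conformal structure induced by \<open>\<Lambda>\<close>: oriented charts that are
  conformal for the metrics \<open>g\<^sub>\<sigma>(X,Y) = (d_X \<sigma>, d_Y \<sigma>)\<close>.\<close>

definition hol_chart ::
    "'m::topological_space chart set \<Rightarrow> ('m \<Rightarrow> (real^5) set) \<Rightarrow> 'm chart \<Rightarrow> bool" where
  "hol_chart M \<Lambda> c \<longleftrightarrow> oriented_chart M c \<and>
     (\<forall>W \<sigma>. lift_on M \<Lambda> W \<sigma> \<longrightarrow> (\<forall>x \<in> W \<inter> fst c.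
        (let sx = d_x (in_coord c \<sigma>) (snd c x); sy = d_y (in_coord c \<sigma>) (snd c x)
         in mink sx sx = mink sy sy \<and> mink sx sy = 0)))"

text \<open>By the existence of isothermal coordinates this holds for every immersed surface; that theorem
  is not in the library.\<close>

definition has_hol_charts ::
    "'m::topological_space chart set \<Rightarrow> ('m \<Rightarrow> (real^5) set) \<Rightarrow> bool" where
  "has_hol_charts M \<Lambda> \<longleftrightarrow> (\<forall>x\<in>pts M. \<exists>c. hol_chart M \<Lambda> c \<and> x \<in> fst c)"

definition dz :: "'m chart \<Rightarrow> ('m \<Rightarrow> complex^5) \<Rightarrow> 'm \<Rightarrow> complex^5" where
  "dz c f x = (1/2) *s (d_x (in_coord c f) (snd c x) - \<i> *s d_y (in_coord c f) (snd c x))"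

definition dzbar :: "'m chart \<Rightarrow> ('m \<Rightarrow> complex^5) \<Rightarrow> 'm \<Rightarrow> complex^5" where
  "dzbar c f x = (1/2) *s (d_x (in_coord c f) (snd c x) + \<i> *s d_y (in_coord c f) (snd c x))"

definition chart_lift_at ::
    "'m::topological_space chart set \<Rightarrow> ('m \<Rightarrow> (real^5) set) \<Rightarrow> 'm \<Rightarrow> 'm chart \<Rightarrow> ('m \<Rightarrow> complex^5) \<Rightarrow> bool" where
  "chart_lift_at M \<Lambda> x c s \<longleftrightarrow> hol_chart M \<Lambda> c \<and> x \<in> fst c \<and>
     (\<exists>W \<sigma>. x \<in> W \<and> lift_on M \<Lambda> W \<sigma> \<and> s = cplx \<circ> \<sigma>)"

definition cplx_bundle :: "('m \<Rightarrow> (real^5) set) \<Rightarrow> 'm \<Rightarrow> (complex^5) set" where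
  "cplx_bundle E x = vec.span (cplx ` E x)"

definition real_points :: "('m \<Rightarrow> (complex^5) set) \<Rightarrow> 'm \<Rightarrow> (real^5) set" where
  "real_points E x = {v. cplx v \<in> E x}"

text \<open>The spans below do not depend on the holomorphic chart and on the lift, so the unions are over
  copies of one and the same subspace.\<close>

definition Lam10 ::
    "'m::topological_space chart set \<Rightarrow> ('m \<Rightarrow> (real^5) set) \<Rightarrow> 'm \<Rightarrow> (complex^5) set" where
  "Lam10 M \<Lambda> x = \<Union>{vec.span {s x, dz c s x} | c s. chart_lift_at M \<Lambda> x c s}"

definition Lam01 ::
    "'m::topological_space chart set \<Rightarrow> ('m \<Rightarrow> (real^5) set) \<Rightarrow> 'm \<Rightarrow> (complex^5) set" where
  "Lam01 M \<Lambda> x = \<Union>{vec.span {s x, dzbar c s x} | c s. chart_lift_at M \<Lambda> x c s}"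

definition Lam1 ::
    "'m::topological_space chart set \<Rightarrow> ('m \<Rightarrow> (real^5) set) \<Rightarrow> 'm \<Rightarrow> (complex^5) set" where
  "Lam1 M \<Lambda> x = vsum (Lam10 M \<Lambda> x) (Lam01 M \<Lambda> x)"

definition central_sphere ::
    "'m::topological_space chart set \<Rightarrow> ('m \<Rightarrow> (real^5) set) \<Rightarrow> 'm \<Rightarrow> (complex^5) set" where
  "central_sphere M \<Lambda> x =
     \<Union>{vec.span {s x, dz c s x, dzbar c s x, dz c (dzbar c s) x} | c s. chart_lift_at M \<Lambda> x c s}"

definition pi_S ::
    "'m::topological_space chart set \<Rightarrow> ('m \<Rightarrow> (real^5) set) \<Rightarrow> 'm \<Rightarrow> complex^5 \<Rightarrow> complex^5" where
  "pi_S M \<Lambda> x = proj_along (central_sphere M \<Lambda> x) (orth (central_sphere M \<Lambda> x))"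

definition pi_Sperp ::
    "'m::topological_space chart set \<Rightarrow> ('m \<Rightarrow> (real^5) set) \<Rightarrow> 'm \<Rightarrow> complex^5 \<Rightarrow> complex^5" where
  "pi_Sperp M \<Lambda> x = proj_along (orth (central_sphere M \<Lambda> x)) (central_sphere M \<Lambda> x)"

definition rho ::
    "'m::topological_space chart set \<Rightarrow> ('m \<Rightarrow> (real^5) set) \<Rightarrow> 'm \<Rightarrow> complex^5 \<Rightarrow> complex^5" where
  "rho M \<Lambda> x v = pi_S M \<Lambda> x v - pi_Sperp M \<Lambda> x v"


section \<open>The connections and multipliers\<close>

definition D_z ::
    "'m::topological_space chart set \<Rightarrow> ('m \<Rightarrow> (real^5) set) \<Rightarrow> 'm chart \<Rightarrow> ('m \<Rightarrow> complex^5) \<Rightarrow> 'm \<Rightarrow> complex^5" where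
  "D_z M \<Lambda> c \<psi> x = pi_S M \<Lambda> x (dz c (\<lambda>y. pi_S M \<Lambda> y (\<psi> y)) x)
                   + pi_Sperp M \<Lambda> x (dz c (\<lambda>y. pi_Sperp M \<Lambda> y (\<psi> y)) x)"

definition D_zbar ::
    "'m::topological_space chart set \<Rightarrow> ('m \<Rightarrow> (real^5) set) \<Rightarrow> 'm chart \<Rightarrow> ('m \<Rightarrow> complex^5) \<Rightarrow> 'm \<Rightarrow> complex^5" where
  "D_zbar M \<Lambda> c \<psi> x = pi_S M \<Lambda> x (dzbar c (\<lambda>y. pi_S M \<Lambda> y (\<psi> y)) x)
                      + pi_Sperp M \<Lambda> x (dzbar c (\<lambda>y. pi_Sperp M \<Lambda> y (\<psi> y)) x)"

text \<open>An endomorphism-valued 1-form \<open>\<omega>\<close> is given by its coefficients in holomorphic charts: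
  \<open>\<omega> c x = (\<omega>(\<partial>z), \<omega>(\<partial>zbar))\<close> at \<open>x\<close>, for the coordinate \<open>z\<close> of \<open>c\<close>. The two
  entries are thus the coefficients of the (1,0)- and (0,1)-parts of \<open>\<omega>\<close>.\<close>

type_synonym 'm endo_form =
  "'m chart \<Rightarrow> 'm \<Rightarrow> (complex^5 \<Rightarrow> complex^5) \<times> (complex^5 \<Rightarrow> complex^5)"

text \<open>\<open>d - D\<close> is tensorial, so its value on a vector is computed from the constant section.\<close>

definition N_form ::
    "'m::topological_space chart set \<Rightarrow> ('m \<Rightarrow> (real^5) set) \<Rightarrow> 'm endo_form" where
  "N_form M \<Lambda> c x = (\<lambda>v. dz c (\<lambda>_. v) x - D_z M \<Lambda> c (\<lambda>_. v) x,
                      \<lambda>v. dzbar c (\<lambda>_. v) x - D_zbar M \<Lambda> c (\<lambda>_. v) x)"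

text \<open>\<open>*\<omega> = - \<omega> \<circ> J\<close> with \<open>J \<partial>z = \<i> \<partial>z\<close>.\<close>

definition hodge :: "'m endo_form \<Rightarrow> 'm endo_form" where
  "hodge \<omega> c x = (\<lambda>v. (-\<i>) *s fst (\<omega> c x) v, \<lambda>v. \<i> *s snd (\<omega> c x) v)"

text \<open>The 2-forms \<open>d\<^sup>D\<omega>\<close> and \<open>[\<mu> \<and> \<eta>]\<close> evaluated on \<open>(\<partial>z, \<partial>zbar)\<close>.\<close>

definition ext_D ::
    "'m::topological_space chart set \<Rightarrow> ('m \<Rightarrow> (real^5) set) \<Rightarrow> 'm endo_form \<Rightarrow>
     'm chart \<Rightarrow> 'm \<Rightarrow> complex^5 \<Rightarrow> complex^5" where
  "ext_D M \<Lambda> \<omega> c x v =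
     (D_z M \<Lambda> c (\<lambda>y. snd (\<omega> c y) v) x - snd (\<omega> c x) (D_z M \<Lambda> c (\<lambda>_. v) x))
   - (D_zbar M \<Lambda> c (\<lambda>y. fst (\<omega> c y) v) x - fst (\<omega> c x) (D_zbar M \<Lambda> c (\<lambda>_. v) x))"

definition wedge_bracket ::
    "'m endo_form \<Rightarrow> 'm endo_form \<Rightarrow> 'm chart \<Rightarrow> 'm \<Rightarrow> complex^5 \<Rightarrow> complex^5" where
  "wedge_bracket \<mu> \<eta> c x v =
     (fst (\<mu> c x) (snd (\<eta> c x) v) - snd (\<eta> c x) (fst (\<mu> c x) v))
   - (snd (\<mu> c x) (fst (\<eta> c x) v) - fst (\<eta> c x) (snd (\<mu> c x) v))"

text \<open>Smoothness and the transformation law under a (holomorphic) change of coordinate.\<close>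

definition is_one_form ::
    "'m::topological_space chart set \<Rightarrow> ('m \<Rightarrow> (real^5) set) \<Rightarrow> 'm endo_form \<Rightarrow> bool" where
  "is_one_form M \<Lambda> \<omega> \<longleftrightarrow>
     (\<forall>c v. hol_chart M \<Lambda> c \<longrightarrow>
        smooth_on (snd c ` fst c) (in_coord c (\<lambda>x. fst (\<omega> c x) v)) \<and>
        smooth_on (snd c ` fst c) (in_coord c (\<lambda>x. snd (\<omega> c x) v))) \<and>
     (\<forall>c c' v. hol_chart M \<Lambda> c \<longrightarrow> hol_chart M \<Lambda> c' \<longrightarrow> (\<forall>x \<in> fst c \<inter> fst c'.
        (let \<tau>' = deriv (in_coord c (snd c')) (snd c x)
         in fst (\<omega> c x) v = \<tau>' *s fst (\<omega> c' x) v \<and>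
            snd (\<omega> c x) v = cnj \<tau>' *s snd (\<omega> c' x) v)))"

text \<open>As \<open>\<Lambda>\<close> is a line, every element of \<open>\<Lambda> \<and> \<Lambda>\<^sup>(\<^sup>1\<^sup>)\<close> is decomposable.\<close>

definition multiplier ::
    "'m::topological_space chart set \<Rightarrow> ('m \<Rightarrow> (real^5) set) \<Rightarrow> 'm endo_form \<Rightarrow> bool" where
  "multiplier M \<Lambda> q \<longleftrightarrow> is_one_form M \<Lambda> q \<and>
     (\<forall>c. hol_chart M \<Lambda> c \<longrightarrow> (\<forall>x \<in> fst c.
        (\<forall>v. snd (q c x) v = conjv (fst (q c x) (conjv v))) \<and>
        {fst (q c x), snd (q c x)}
          \<subseteq> {wedge s w | s w. s \<in> cplx_bundle \<Lambda> x \<and> w \<in> Lam1 M \<Lambda> x} \<and>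
        (\<forall>v. ext_D M \<Lambda> q c x v = 0) \<and>
        (\<forall>v. ext_D M \<Lambda> (hodge (N_form M \<Lambda>)) c x v
              = 2 *s wedge_bracket q (hodge (N_form M \<Lambda>)) c x v)))"

text \<open>The \<open>\<partial>z\<close>- and \<open>\<partial>zbar\<close>-derivatives of a section for the connection \<open>d\<^sup>\<zeta>\<^sup>,\<^sup>q\<close> associated to
  the central sphere congruence.\<close>

definition dlq_z ::
    "'m::topological_space chart set \<Rightarrow> ('m \<Rightarrow> (real^5) set) \<Rightarrow> 'm endo_form \<Rightarrow> complex \<Rightarrow>
     'm chart \<Rightarrow> ('m \<Rightarrow> complex^5) \<Rightarrow> 'm \<Rightarrow> complex^5" where
  "dlq_z M \<Lambda> q \<zeta> c \<psi> x = D_z M \<Lambda> c \<psi> x + inverse \<zeta> *s fst (N_form M \<Lambda> c x) (\<psi> x)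
                           + ((inverse \<zeta>)\<^sup>2 - 1) *s fst (q c x) (\<psi> x)"

definition dlq_zbar ::
    "'m::topological_space chart set \<Rightarrow> ('m \<Rightarrow> (real^5) set) \<Rightarrow> 'm endo_form \<Rightarrow> complex \<Rightarrow>
     'm chart \<Rightarrow> ('m \<Rightarrow> complex^5) \<Rightarrow> 'm \<Rightarrow> complex^5" where
  "dlq_zbar M \<Lambda> q \<zeta> c \<psi> x = D_zbar M \<Lambda> c \<psi> x + \<zeta> *s snd (N_form M \<Lambda> c x) (\<psi> x)
                              + (\<zeta>\<^sup>2 - 1) *s snd (q c x) (\<psi> x)"

definition dlq_parallel ::
    "'m::topological_space chart set \<Rightarrow> ('m \<Rightarrow> (real^5) set) \<Rightarrow> 'm endo_form \<Rightarrow> complex \<Rightarrow>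
     ('m \<Rightarrow> (complex^5) set) \<Rightarrow> bool" where
  "dlq_parallel M \<Lambda> q \<zeta> L \<longleftrightarrow>
     (\<forall>W \<psi>. section_on M L W \<psi> \<longrightarrow> (\<forall>c. hol_chart M \<Lambda> c \<longrightarrow> (\<forall>x \<in> W \<inter> fst c.
        dlq_z M \<Lambda> q \<zeta> c \<psi> x \<in> L x \<and> dlq_zbar M \<Lambda> q \<zeta> c \<psi> x \<in> L x)))"


section \<open>Constant mean curvature in space forms\<close>

definition space_form :: "real^5 \<Rightarrow> (real^5) set" where
  "space_form v = {u. u \<noteq> 0 \<and> mink u u = 0 \<and> mink u v = -1}"

definition real_central_sphere ::
    "'m::topological_space chart set \<Rightarrow> ('m \<Rightarrow> (real^5) set) \<Rightarrow> 'm \<Rightarrow> (real^5) set" where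
  "real_central_sphere M \<Lambda> = real_points (central_sphere M \<Lambda>)"

definition vT ::
    "'m::topological_space chart set \<Rightarrow> ('m \<Rightarrow> (real^5) set) \<Rightarrow> real^5 \<Rightarrow> 'm \<Rightarrow> real^5" where
  "vT M \<Lambda> v x = proj_along (real_central_sphere M \<Lambda> x) (orth (real_central_sphere M \<Lambda> x)) v"

definition vperp ::
    "'m::topological_space chart set \<Rightarrow> ('m \<Rightarrow> (real^5) set) \<Rightarrow> real^5 \<Rightarrow> 'm \<Rightarrow> real^5" where
  "vperp M \<Lambda> v x = proj_along (orth (real_central_sphere M \<Lambda> x)) (real_central_sphere M \<Lambda> x) v"

definition mean_curvature ::
    "'m::topological_space chart set \<Rightarrow> ('m \<Rightarrow> (real^5) set) \<Rightarrow> real^5 \<Rightarrow> 'm \<Rightarrow> real" where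
  "mean_curvature M \<Lambda> v x = sqrt (mink (vperp M \<Lambda> v x) (vperp M \<Lambda> v x))"

definition cmc_surface ::
    "'m::topological_space chart set \<Rightarrow> ('m \<Rightarrow> (real^5) set) \<Rightarrow> real^5 \<Rightarrow> bool" where
  "cmc_surface M \<Lambda> v \<longleftrightarrow> immersed_surface M \<Lambda> \<and> has_hol_charts M \<Lambda> \<and>
     (\<exists>H. \<forall>x\<in>pts M. mean_curvature M \<Lambda> v x = H)"

text \<open>\<open>\<sigma>\<^sub>\<infinity>\<close>; it does not depend on the choice of \<open>s\<close> and takes values in \<open>space_form v\<close>.\<close>

definition sigma_inf :: "('m \<Rightarrow> (real^5) set) \<Rightarrow> real^5 \<Rightarrow> 'm \<Rightarrow> real^5" where
  "sigma_inf \<Lambda> v x = (let s = (SOME s. s \<in> \<Lambda> x \<and> s \<noteq> 0) in (- 1 / mink s v) *\<^sub>R s)"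

text \<open>When the mean curvature vanishes, both choices of sign of \<open>N\<close> qualify.\<close>

definition unit_normal ::
    "'m::topological_space chart set \<Rightarrow> ('m \<Rightarrow> (real^5) set) \<Rightarrow> real^5 \<Rightarrow> ('m \<Rightarrow> real^5) \<Rightarrow> bool" where
  "unit_normal M \<Lambda> v N \<longleftrightarrow> smooth_map M (pts M) N \<and>
     (\<forall>x\<in>pts M. N x \<in> orth (real_central_sphere M \<Lambda> x) \<and> mink (N x) (N x) = 1 \<and>
        vperp M \<Lambda> v x = mean_curvature M \<Lambda> v x *\<^sub>R N x)"

definition eta_inf ::
    "('m \<Rightarrow> (real^5) set) \<Rightarrow> real^5 \<Rightarrow> ('m \<Rightarrow> real^5) \<Rightarrow> 'm endo_form" where
  "eta_inf \<Lambda> v N c x =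
     (\<lambda>u. (1/2) *s wedge (cplx (sigma_inf \<Lambda> v x)) (dz c (cplx \<circ> N) x) u,
      \<lambda>u. (1/2) *s wedge (cplx (sigma_inf \<Lambda> v x)) (dzbar c (cplx \<circ> N) x) u)"

definition q_inf ::
    "'m::topological_space chart set \<Rightarrow> ('m \<Rightarrow> (real^5) set) \<Rightarrow> real^5 \<Rightarrow> ('m \<Rightarrow> real^5) \<Rightarrow> real \<Rightarrow> 'm endo_form" where
  "q_inf M \<Lambda> v N t c x =
     (let H = complex_of_real (mean_curvature M \<Lambda> v x); \<eta> = eta_inf \<Lambda> v N
      in (\<lambda>u. H *s fst (\<eta> c x) u + of_real t *s fst (hodge \<eta> c x) u,
          \<lambda>u. H *s snd (\<eta> c x) u + of_real t *s snd (hodge \<eta> c x) u))"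

definition p_inf ::
    "'m::topological_space chart set \<Rightarrow> ('m \<Rightarrow> (real^5) set) \<Rightarrow> real^5 \<Rightarrow> ('m \<Rightarrow> real^5) \<Rightarrow> real \<Rightarrow>
     complex \<Rightarrow> 'm \<Rightarrow> complex^5" where
  "p_inf M \<Lambda> v N t \<zeta> x =
     (let H = complex_of_real (mean_curvature M \<Lambda> v x)
      in (inverse \<zeta> * (1/2) * (H - \<i> * of_real t)) *s cplx (N x) + cplx (vT M \<Lambda> v x)
         + (\<zeta> * (1/2) * (H + \<i> * of_real t)) *s cplx (N x))"


section \<open>The Baecklund transformation\<close>

text \<open>In the following pointwise definitions, \<open>R\<close> is the reflection \<open>\<rho>\<close> at a point and \<open>L\<close> a null
  line with \<open>\<rho>L \<inter> L\<^sup>\<bottom> = 0\<close>.\<close>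

definition admissible :: "(complex^5 \<Rightarrow> complex^5) \<Rightarrow> (complex^5) set \<Rightarrow> bool" where
  "admissible R L \<longleftrightarrow> R ` L \<inter> orth L = {0}"

definition pi_L :: "(complex^5 \<Rightarrow> complex^5) \<Rightarrow> (complex^5) set \<Rightarrow> complex^5 \<Rightarrow> complex^5" where
  "pi_L R L = proj_along L (vsum (R ` L) (orth (vsum L (R ` L))))"

definition pi_RL :: "(complex^5 \<Rightarrow> complex^5) \<Rightarrow> (complex^5) set \<Rightarrow> complex^5 \<Rightarrow> complex^5" where
  "pi_RL R L = proj_along (R ` L) (vsum L (orth (vsum L (R ` L))))"

definition pi_rest :: "(complex^5 \<Rightarrow> complex^5) \<Rightarrow> (complex^5) set \<Rightarrow> complex^5 \<Rightarrow> complex^5" where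
  "pi_rest R L = proj_along (orth (vsum L (R ` L))) (vsum L (R ` L))"

definition p_gauge ::
    "(complex^5 \<Rightarrow> complex^5) \<Rightarrow> complex \<Rightarrow> (complex^5) set \<Rightarrow> complex \<Rightarrow> complex^5 \<Rightarrow> complex^5" where
  "p_gauge R a L \<zeta> v = ((a - \<zeta>) / (a + \<zeta>)) *s pi_L R L v + pi_rest R L v
                         + ((a + \<zeta>) / (a - \<zeta>)) *s pi_RL R L v"

definition q_gauge ::
    "(complex^5 \<Rightarrow> complex^5) \<Rightarrow> complex \<Rightarrow> (complex^5) set \<Rightarrow> complex \<Rightarrow> complex^5 \<Rightarrow> complex^5" where
  "q_gauge R a L \<zeta> v = ((\<zeta> - a) / (\<zeta> + a)) *s pi_L R L v + pi_rest R L v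
                         + ((\<zeta> + a) / (\<zeta> - a)) *s pi_RL R L v"

definition p_gauge_infinity ::
    "(complex^5 \<Rightarrow> complex^5) \<Rightarrow> (complex^5) set \<Rightarrow> complex^5 \<Rightarrow> complex^5" where
  "p_gauge_infinity R L v = - pi_L R L v + pi_rest R L v - pi_RL R L v"

definition q_gauge_infinity ::
    "(complex^5 \<Rightarrow> complex^5) \<Rightarrow> (complex^5) set \<Rightarrow> complex^5 \<Rightarrow> complex^5" where
  "q_gauge_infinity R L v = v"

definition L_tilde ::
    "(complex^5 \<Rightarrow> complex^5) \<Rightarrow> complex \<Rightarrow> (complex^5) set \<Rightarrow> (complex^5) set" where
  "L_tilde R \<alpha> L = q_gauge R (inverse (cnj \<alpha>)) (conjv ` L) \<alpha> ` L"

definition r_star ::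
    "(complex^5 \<Rightarrow> complex^5) \<Rightarrow> complex \<Rightarrow> (complex^5) set \<Rightarrow> complex \<Rightarrow> complex^5 \<Rightarrow> complex^5" where
  "r_star R \<alpha> L \<zeta> = p_gauge R \<alpha> (L_tilde R \<alpha> L) \<zeta> \<circ> q_gauge R (inverse (cnj \<alpha>)) (conjv ` L) \<zeta>"

definition r_star_infinity ::
    "(complex^5 \<Rightarrow> complex^5) \<Rightarrow> complex \<Rightarrow> (complex^5) set \<Rightarrow> complex^5 \<Rightarrow> complex^5" where
  "r_star_infinity R \<alpha> L = p_gauge_infinity R (L_tilde R \<alpha> L) \<circ> q_gauge_infinity R (conjv ` L)"

definition baecklund_parameters ::
    "'m::topological_space chart set \<Rightarrow> ('m \<Rightarrow> (real^5) set) \<Rightarrow> 'm endo_form \<Rightarrow> complex \<Rightarrow>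
     ('m \<Rightarrow> (complex^5) set) \<Rightarrow> bool" where
  "baecklund_parameters M \<Lambda> q \<alpha> L \<longleftrightarrow>
     multiplier M \<Lambda> q \<and> \<alpha> \<noteq> 0 \<and> norm \<alpha> \<noteq> 1 \<and>
     null_line_bundle M L \<and> dlq_parallel M \<Lambda> q \<alpha> L \<and>
     (\<forall>x\<in>pts M. admissible (rho M \<Lambda> x) (L x) \<and>
        admissible (rho M \<Lambda> x) (L_tilde (rho M \<Lambda> x) \<alpha> (L x)))"

definition baecklund_transform ::
    "'m::topological_space chart set \<Rightarrow> ('m \<Rightarrow> (real^5) set) \<Rightarrow> complex \<Rightarrow>
     ('m \<Rightarrow> (complex^5) set) \<Rightarrow> 'm \<Rightarrow> (complex^5) set" where
  "baecklund_transform M \<Lambda> \<alpha> L x =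
     inv (r_star (rho M \<Lambda> x) \<alpha> (L x) 1) `
       (r_star_infinity (rho M \<Lambda> x) \<alpha> (L x) ` Lam10 M \<Lambda> x
        \<inter> r_star (rho M \<Lambda> x) \<alpha> (L x) 0 ` Lam01 M \<Lambda> x)"

end

theory Submission
  imports Defs
begin

text \<open>
  Let \<open>n\<close> be the unit normal, so that the central sphere congruence is the orthogonal complement of \<open>n\<close>. A
  null line \<open>L\<close> with \<open>\<rho> L \<inter> L\<^sup>\<bottom> = 0\<close> is spanned by \<open>u + n\<close> with \<open>u\<close> in the central sphere and \<open>(u, u) = -1\<close>, and the
  dressing maps are hyperbolic rotations in the plane of \<open>u\<close> and \<open>n\<close>. If \<open>L\<close> is parallel at the pole of such a
  rotation, then the rotation carries the family \<open>d\<^sup>\<lambda>\<^sup>,\<^sup>q\<close> into a family of the same shape, with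
  \<open>\<Lambda>\<^sup>1\<^sup>,\<^sup>0\<close> or \<open>\<Lambda>\<^sup>0\<^sup>,\<^sup>1\<close> replaced by its reflection. Two such steps show that \<open>T = r\<^sup>*(1)\<close> carries the
  derivatives of a lift of the transform into the two reflected null planes, hence the transform is conformal
  to \<open>\<Lambda>\<close> and its central sphere congruence has unit normal \<open>m = T\<^sup>-\<^sup>1 n\<close>. Since \<open>p(\<alpha>)\<close> is orthogonal to \<open>L\<close>, the
  section \<open>r\<^sup>*(\<lambda>) p(\<lambda>)\<close> is still a Laurent polynomial, and its outer coefficients are those of \<open>p\<close> with the sign
  reversed, because \<open>r\<^sup>*(0) n = r\<^sup>*(\<infinity>) n = - n\<close>. At \<open>\<lambda> = 1\<close> this reads
  \<open>(v_inf, m) = (T v_inf, n) = - H\<close>: the mean curvature is preserved.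
\<close>

subsection \<open>The complexified Minkowski form\<close>

text \<open>A single dressing with pole at \<open>\<alpha>\<close> would in general lead out of the
  real surfaces. The family of connections is compatible with conjugation: conjugating it amounts to
  replacing \<lambda> by the reciprocal of its conjugate. Hence the conjugate of \<open>L\<close> is
  parallel at \<open>inverse (cnj \<alpha>)\<close>, and this is the pole of the second dressing.
  The coefficient of dz is polynomial in 1/\<lambda> and that of dzbar in \<lambda>. Under \<lambda>
  -> 1/\<lambda> the maps \<open>p_gauge\<close> and \<open>q_gauge\<close> change roles, so each
  step is one type of gauge for d/dz and the other type for d/dzbar; both times it reflects the same
  one of the two null planes and leaves the other alone. At \<lambda> = 1 the family is
  \<open>d\<close> itself, so its gauged version at 1 is the conjugate of \<open>d\<close> by
  \<open>T\<close>. This turns the abstract coefficients into derivatives of an actual section. The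
  normal \<open>m\<close> arises as a complex vector; that it is real is read off at the end from
  the conjugation-invariant frame of the transform and the Lorentz signature.\<close>

lemma mink_commute: "mink v w = mink w (v::'a::comm_ring_1^5)"
  by (simp add: mink_def mult.commute)

lemma mink_simps:
  fixes u v w :: "'a::comm_ring_1^5"
  shows "mink (u + v) w = mink u w + mink v w" "mink w (u + v) = mink w u + mink w v"
    "mink (u - v) w = mink u w - mink v w" "mink w (u - v) = mink w u - mink w v"
    "mink (k *s v) w = k * mink v w" "mink w (k *s v) = k * mink w v"
    "mink (- v) w = - mink v w" "mink w (- v) = - mink w v" "mink 0 w = 0" "mink w 0 = 0"
  by (simp_all add: mink_def algebra_simps)

lemma exhaust_5: "x = 1 \<or> x = 2 \<or> x = 3 \<or> x = 4 \<or> x = 5" for x :: 5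
proof (induct x)
  case (of_int z)
  then have "z = 0 \<or> z = 1 \<or> z = 2 \<or> z = 3 \<or> z = 4" by fastforce
  then show ?case by auto
qed

lemma mink_nondegenerate:
  assumes "\<And>w. mink v w = 0"
  shows "v = (0::'a::field^5)"
proof -
  have "v $ i = 0" for i
  proof -
    have "mink v (axis i 1) = (if i = 5 then - v $ i else v $ i)"
      using exhaust_5[of i] by (auto simp: mink_def axis_def)
    then show ?thesis
      using assms[of "axis i 1"] by (auto split: if_splits)
  qed
  then show ?thesis
    by (simp add: vec_eq_iff)
qed

section \<open>Skew endomorphisms and hyperbolic rotations\<close>

definition skew_map :: "(complex^5 \<Rightarrow> complex^5) \<Rightarrow> bool" where
  "skew_map A \<longleftrightarrow> (\<forall>v w. A (v + w) = A v + A w) \<and> (\<forall>k v. A (k *s v) = k *s A v) \<and>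
     (\<forall>v w. mink (A v) w = - mink v (A w))"

text \<open>For a hyperbolic pair this is u -> c u + s n, n -> s u + c n, and the identity on the
  complement of the plane. It is affine in \<open>c\<close> and \<open>s\<close>, which are free
  here; \<open>c\<^sup>2 - s\<^sup>2 = 1\<close> enters only where an isometry is wanted.\<close>

definition rot :: "complex \<Rightarrow> complex \<Rightarrow> complex^5 \<Rightarrow> complex^5 \<Rightarrow> complex^5 \<Rightarrow> complex^5" where
  "rot c s u n v = v + mink v u *s ((1 - c) *s u - s *s n) + mink v n *s (s *s u + (c - 1) *s n)"

definition hyp_pair :: "complex^5 \<Rightarrow> complex^5 \<Rightarrow> bool" where
  "hyp_pair u n \<longleftrightarrow> mink u u = -1 \<and> mink n n = 1 \<and> mink u n = 0"

lemma rot_add: "rot c s u n (v + w) = rot c s u n v + rot c s u n w"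
  unfolding rot_def mink_simps by (simp add: vec_eq_iff algebra_simps)

lemma rot_scale: "rot c s u n (k *s v) = k *s rot c s u n v"
  unfolding rot_def mink_simps by (simp add: vec_eq_iff algebra_simps)

lemma rot_isometry:
  assumes "hyp_pair u n" "c\<^sup>2 - s\<^sup>2 = 1"
  shows "mink (rot c s u n v) (rot c s u n w) = mink v w"
proof -
  have *: "mink u u = -1" "mink n n = 1" "mink u n = 0" "mink n u = 0" "mink u w = mink w u" "mink n w = mink w n"
     using assms(1) by (auto simp: hyp_pair_def mink_commute)
  show ?thesis
    unfolding rot_def mink_simps * using assms(2) by algebra
qed

lemma rot_rot:
  assumes "hyp_pair u n"
  shows "rot c s u n (rot c' s' u n v) = rot (c * c' + s * s') (c * s' + s * c') u n v"
proof -
  have *: "mink u u = -1" "mink n n = 1" "mink u n = 0" "mink n u = 0"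
     using assms(1) by (auto simp: hyp_pair_def mink_commute)
  show ?thesis
    unfolding rot_def mink_simps * by (simp add: vec_eq_iff algebra_simps)
qed

text \<open>Everything is linear in \<open>c\<close> and \<open>s\<close>; the witness \<open>e\<close> stands for their common denominator, which
  keeps the identity polynomial.\<close>

lemma gauge_identity:
  fixes m m0 :: complex
  assumes "hyp_pair u n" and A: "skew_map A" "A n = 0" and nu: "mink nu n = 0"
    and du: "du = m0 *s (nu + mink nu u *s u) - (m0\<^sup>2) *s A u"
    and cs: "\<exists>e. e * (m0\<^sup>2 - m\<^sup>2) = 1 \<and> c = (m0\<^sup>2 + m\<^sup>2) * e \<and> s = - 2 * m0 * m * e"
  defines "R \<equiv> rot (-1) 0 u n"
  defines "nu' \<equiv> R ((2 * m0) *s A u - nu)"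
  shows "mink f du *s ((1 - c) *s u - s *s n) + (mink f u * (1 - c) + mink f n * s) *s du
    + m *s (mink (rot c s u n f) nu' *s n - mink (rot c s u n f) n *s nu') + m\<^sup>2 *s R (A (R (rot c s u n f)))
    = rot c s u n (m *s (mink f nu *s n - mink f n *s nu) + m\<^sup>2 *s A f)"
proof -
  have *: "mink u u = -1" "mink n n = 1" "mink u n = 0" "mink n u = 0" "mink n nu = 0" "mink u nu = mink nu u"
     using assms(1) nu by (auto simp: hyp_pair_def mink_commute)
  have A1: "A (v + w) = A v + A w" "A (k *s v) = k *s A v" "mink (A v) w = - mink v (A w)" for v w k
    using A(1) unfolding skew_map_def by blast+
  have A2: "A (v - w) = A v - A w" for v w
    using A1(1)[of v "(-1) *s w"] A1(2)[of "-1" w] by (simp add: vec_eq_iff)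
  have Au: "mink u (A u) = 0" "mink (A u) u = 0" "mink n (A u) = 0" "mink (A u) n = 0"
    using A1(3)[of u u] A1(3)[of u n] by (auto simp: mink_commute[of u "A u"] mink_commute[of n "A u"] A(2) mink_simps)
  have B: "mink (A f) u = - mink f (A u)" "mink (A f) n = 0"
    using A1(3) A(2) by (auto simp: mink_simps)
  obtain e where ed: "e * (m0\<^sup>2 - m\<^sup>2) = 1" and e: "c = (m0\<^sup>2 + m\<^sup>2) * e" "s = - 2 * m0 * m * e"
    using cs by blast
  show ?thesis
    unfolding du R_def nu'_def rot_def mink_simps A1(1,2) A2 A(2) Au nu * B
    apply (simp only: vec_eq_iff vector_add_component vector_minus_component vector_smult_component zero_index
      mult_zero_left mult_zero_right add_0_left add_0_right diff_0_right diff_0 mult_1_right)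
    unfolding e
    \<comment> \<open>With all inner products expanded, each coordinate is a polynomial identity
      modulo the single relation \<open>ed\<close>.\<close>
    apply (intro allI)
    using ed by algebra
qed

subsection \<open>Gauge transformations of a family of connections\<close>

text \<open>Eigenvalue \<open>\<kappa>\<close> on u + n and \<open>inverse \<kappa>\<close> on u -
  n. So gauges with the same pair compose by multiplying their parameters, and both kinds of
  dressing map are instances.\<close>

definition gauge :: "complex \<Rightarrow> complex^5 \<Rightarrow> complex^5 \<Rightarrow> complex^5 \<Rightarrow> complex^5" where
  "gauge \<kappa> = rot ((\<kappa> + inverse \<kappa>) / 2) ((\<kappa> - inverse \<kappa>) / 2)"

lemma gauge_coeffs: "((\<kappa> + inverse \<kappa>) / 2)\<^sup>2 - ((\<kappa> - inverse \<kappa>) / 2)\<^sup>2 = (1::complex)" if "\<kappa> \<noteq> 0"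
  using that by (simp add: power2_eq_square field_simps)

lemma gauge_isometry:
  assumes "hyp_pair u n" "\<kappa> \<noteq> 0"
  shows "mink (gauge \<kappa> u n v) (gauge \<kappa> u n w) = mink v w"
  unfolding gauge_def by (rule rot_isometry[OF assms(1) gauge_coeffs[OF assms(2)]])

lemma gauge_one: "gauge 1 u n v = v"
  by (simp add: gauge_def rot_def vec_eq_iff)

lemma gauge_gauge:
  assumes "hyp_pair u n" "\<kappa> \<noteq> 0" "\<kappa>' \<noteq> 0"
  shows "gauge \<kappa> u n (gauge \<kappa>' u n v) = gauge (\<kappa> * \<kappa>') u n v"
  unfolding gauge_def rot_rot[OF assms(1)] using assms(2,3)
  by (intro arg_cong2[where f = "\<lambda>c s. rot c s u n v"]) (simp_all add: field_simps)

lemma gauge_add: "gauge \<kappa> u n (v + w) = gauge \<kappa> u n v + gauge \<kappa> u n w"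
  by (simp add: gauge_def rot_add)

lemma gauge_scale: "gauge \<kappa> u n (k *s v) = k *s gauge \<kappa> u n v"
  by (simp add: gauge_def rot_scale)

lemma gauge_minus_one: "gauge (-1) = rot (-1) 0"
  by (simp add: gauge_def)

lemma gauge_minus_one_isometry:
  "hyp_pair u n \<Longrightarrow> mink (gauge (-1) u n v) (gauge (-1) u n w) = mink v w"
  by (rule gauge_isometry) auto

lemma gauge_minus_one_invol: "hyp_pair u n \<Longrightarrow> gauge (-1) u n (gauge (-1) u n v) = v"
  by (simp add: gauge_gauge gauge_one)

lemma gauge_minus_one_normal: "hyp_pair u n \<Longrightarrow> gauge (-1) u n n = - n"
  by (simp add: gauge_minus_one rot_def vec_eq_iff hyp_pair_def mink_commute[of n u])

text \<open>An isometric involution is self-adjoint.\<close>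

lemma gauge_minus_one_swap:
  "hyp_pair u n \<Longrightarrow> mink (gauge (-1) u n v) w = mink v (gauge (-1) u n w)"
  using gauge_minus_one_isometry[of u n v "gauge (-1) u n w"] by (simp add: gauge_minus_one_invol)

text \<open>Both \<open>\<partial>/\<partial>z\<close> and \<open>\<partial>/\<partial>zbar\<close> at \<open>x\<close> are instances, so that each gauge computation
  is made once. \<open>DS\<close> and \<open>DV\<close> are the scalar and vector functions differentiable at \<open>x\<close>.\<close>

locale derivation_at =
  fixes x :: 'm and W :: "'m set"
    and DS :: "('m \<Rightarrow> complex) \<Rightarrow> bool" and DV :: "('m \<Rightarrow> complex^5) \<Rightarrow> bool"
    and ds :: "('m \<Rightarrow> complex) \<Rightarrow> complex"
  assumes x_in_W: "x \<in> W"
    and DS_const: "DS (\<lambda>_. k)"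
    and DV_add: "DV f \<Longrightarrow> DV g \<Longrightarrow> DV (\<lambda>y. f y + g y)"
    and DV_scale: "DS h \<Longrightarrow> DV f \<Longrightarrow> DV (\<lambda>y. h y *s f y)"
    and DS_mink: "DV f \<Longrightarrow> DV g \<Longrightarrow> DS (\<lambda>y. mink (f y) (g y))"
    and ds_const: "ds (\<lambda>_. k) = 0"
    and ds_cong: "(\<And>y. y \<in> W \<Longrightarrow> h y = h' y) \<Longrightarrow> ds h = ds h'"
begin

lemma DV_cscale: "DV f \<Longrightarrow> DV (\<lambda>y. k *s f y)"
  by (intro DV_scale DS_const)

lemma DV_diff:
  assumes "DV f" "DV g"
  shows "DV (\<lambda>y. f y - g y)"
proof -
  have "(\<lambda>y. f y - g y) = (\<lambda>y. f y + (-1) *s g y)"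
    by (simp add: vec_eq_iff)
  then show ?thesis
    using DV_add[OF assms(1) DV_cscale[OF assms(2), of "-1"]] by simp
qed

text \<open>Only the derivative at \<open>x\<close> in one direction is recorded. The locality
  clause does the work of germs: sections that agree on \<open>W\<close> have the same
  derivative.\<close>

definition metric_conn :: "(('m \<Rightarrow> complex^5) \<Rightarrow> complex^5) \<Rightarrow> bool" where
  "metric_conn D \<longleftrightarrow> (\<forall>f g. (\<forall>y\<in>W. f y = g y) \<longrightarrow> D f = D g) \<and>
     (\<forall>f g. DV f \<longrightarrow> DV g \<longrightarrow> D (\<lambda>y. f y + g y) = D f + D g) \<and>
     (\<forall>h f. DS h \<longrightarrow> DV f \<longrightarrow> D (\<lambda>y. h y *s f y) = ds h *s f x + h x *s D f) \<and>
     (\<forall>f g. DV f \<longrightarrow> DV g \<longrightarrow> ds (\<lambda>y. mink (f y) (g y)) = mink (D f) (g x) + mink (f x) (D g))"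

lemma DV_rot: "DV u \<Longrightarrow> DV n \<Longrightarrow> DV f \<Longrightarrow> DV (\<lambda>y. rot c s (u y) (n y) (f y))"
  unfolding rot_def by (intro DV_add DV_diff DV_scale DV_cscale DS_mink)

lemma DV_gauge: "DV u \<Longrightarrow> DV n \<Longrightarrow> DV f \<Longrightarrow> DV (\<lambda>y. gauge \<kappa> (u y) (n y) (f y))"
  unfolding gauge_def by (rule DV_rot)

text \<open>The coefficients are constant and \<open>n\<close> is parallel, so besides the rotated
  \<open>D f\<close> only terms with \<open>D u\<close> survive.\<close>

lemma metric_conn_rot:
  assumes D: "metric_conn D" and DV: "DV u" "DV n" "DV f" and n: "D n = 0"
  shows "D (\<lambda>y. rot c s (u y) (n y) (f y)) = rot c s (u x) (n x) (D f)
    + (mink (f x) (D u) *s ((1 - c) *s u x - s *s n x)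
       + (mink (f x) (u x) * (1 - c) + mink (f x) (n x) * s) *s D u)"
proof -
  have add: "DV f \<Longrightarrow> DV g \<Longrightarrow> D (\<lambda>y. f y + g y) = D f + D g" for f g
    using D unfolding metric_conn_def by blast
  have scale: "DS h \<Longrightarrow> DV f \<Longrightarrow> D (\<lambda>y. h y *s f y) = ds h *s f x + h x *s D f" for h f
    using D unfolding metric_conn_def by blast
  have met: "DV f \<Longrightarrow> DV g \<Longrightarrow> ds (\<lambda>y. mink (f y) (g y)) = mink (D f) (g x) + mink (f x) (D g)" for f g
    using D unfolding metric_conn_def by blast
  have cscale: "DV f \<Longrightarrow> D (\<lambda>y. k *s f y) = k *s D f" for k f
    using scale[of "\<lambda>_. k" f] by (simp add: DS_const ds_const)
  have eq: "(\<lambda>y. rot c s (u y) (n y) (f y)) = (\<lambda>y. f y + mink (f y) (u y) *s ((1 - c) *s u y + (- s) *s n y)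
       + mink (f y) (n y) *s (s *s u y + (c - 1) *s n y))"
    by (simp add: rot_def)
  have "D (\<lambda>y. rot c s (u y) (n y) (f y)) = D f +
     ((mink (D f) (u x) + mink (f x) (D u)) *s ((1 - c) *s u x + (- s) *s n x) + mink (f x) (u x) *s ((1 - c) *s D u))
     + (mink (D f) (n x) *s (s *s u x + (c - 1) *s n x) + mink (f x) (n x) *s (s *s D u))"
    unfolding eq
    by (simp only: add scale cscale met n DV DV_add DV_scale DV_cscale DS_mink vector_smult_rzero add_0_right mink_simps)
  also have "\<dots> = rot c s (u x) (n x) (D f)
    + (mink (f x) (D u) *s ((1 - c) *s u x - s *s n x)
       + (mink (f x) (u x) * (1 - c) + mink (f x) (n x) * s) *s D u)"
    unfolding rot_def by (simp add: vec_eq_iff algebra_simps)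
  finally show ?thesis .
qed

end

locale normal_bundle = derivation_at +
  fixes n :: "'a \<Rightarrow> complex^5"
  assumes DV_n: "DV n"
begin

text \<open>One direction of the family of connections at \<open>x\<close>: \<open>D + m \<nu> \<and> n + m\<^sup>2 A\<close>, where \<open>m = 1/\<lambda>\<close> for \<open>\<partial>/\<partial>z\<close>
  and \<open>m = \<lambda>\<close> for \<open>\<partial>/\<partial>zbar\<close>, \<open>D\<close> is the paper's \<open>\<D> - q\<close>, \<open>\<nu> \<and> n\<close> is \<open>\<N>\<close> and \<open>A\<close> is \<open>q\<close>. The bundle \<open>E\<close> is
  \<open>\<Lambda>\<^sup>1\<^sup>,\<^sup>0\<close> in the first case and \<open>\<Lambda>\<^sup>0\<^sup>,\<^sup>1\<close> in the second, and \<open>F\<close> is the fibre at \<open>x\<close> of the other one. Being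
  maximal isotropic, \<open>E\<close> is \<open>D\<close>-stable as soon as \<open>D\<close> of its sections is orthogonal to \<open>E\<close>.\<close>

definition gauge_data where
  "gauge_data D \<nu> A E F \<longleftrightarrow> metric_conn D \<and> D n = 0 \<and> mink \<nu> (n x) = 0 \<and> skew_map A \<and> A (n x) = 0 \<and>
     (\<forall>f g. DV f \<longrightarrow> (\<forall>y\<in>W. f y \<in> E y) \<longrightarrow> g \<in> E x \<longrightarrow> mink (D f) g = 0) \<and>
     (\<forall>e\<in>F. A e = 0 \<and> mink \<nu> e = 0)"

definition nabla where
  "nabla D \<nu> A m f = D f + m *s (mink (f x) \<nu> *s n x - mink (f x) (n x) *s \<nu>) + m\<^sup>2 *s A (f x)"

lemma gauge_dataD:
  assumes "gauge_data D \<nu> A E F"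
  shows "metric_conn D" "D n = 0" "mink \<nu> (n x) = 0" "A (v + w) = A v + A w" "A (k *s v) = k *s A v"
    "mink (A v) w = - mink v (A w)" "A (n x) = 0"
    "DV f \<Longrightarrow> (\<And>y. y \<in> W \<Longrightarrow> f y \<in> E y) \<Longrightarrow> g \<in> E x \<Longrightarrow> mink (D f) g = 0"
    "e \<in> F \<Longrightarrow> A e = 0" "e \<in> F \<Longrightarrow> mink \<nu> e = 0"
  using assms unfolding gauge_data_def skew_map_def by blast+

definition parallel_normal where
  "parallel_normal D \<nu> A m u \<longleftrightarrow> DV u \<and> (\<forall>y\<in>W. hyp_pair (u y) (n y)) \<and>
     (\<exists>k. nabla D \<nu> A m (\<lambda>y. u y + n y) = k *s (u x + n x))"

text \<open>\<open>D u\<close> and \<open>A u\<close> are both orthogonal to \<open>n\<close>, so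
  pairing the equation of parallelism with \<open>n\<close> determines the factor \<open>k\<close>;
  what remains is an equation for \<open>D u\<close>.\<close>

lemma parallel_normal_deriv:
  assumes g: "gauge_data D \<nu> A E F" and p: "parallel_normal D \<nu> A m0 u"
  shows "D u = m0 *s (\<nu> + mink \<nu> (u x) *s u x) - m0\<^sup>2 *s A (u x)"
proof -
  have hp: "hyp_pair (u x) (n x)" and u: "DV u"
    using p x_in_W by (auto simp: parallel_normal_def)
  have D: "metric_conn D" and Dn: "D n = 0" and nu: "mink \<nu> (n x) = 0" and A: "skew_map A" "A (n x) = 0"
    using g by (auto simp: gauge_data_def)
  obtain k where k: "nabla D \<nu> A m0 (\<lambda>y. u y + n y) = k *s (u x + n x)"
    using p by (auto simp: parallel_normal_def)
  have Dun: "D (\<lambda>y. u y + n y) = D u"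
    using D u DV_n Dn unfolding metric_conn_def by simp
  have "ds (\<lambda>y. mink (u y) (n y)) = ds (\<lambda>_. 0)"
    by (rule ds_cong) (use p in \<open>auto simp: parallel_normal_def hyp_pair_def\<close>)
  then have Dn0: "mink (D u) (n x) = 0"
    using D u DV_n Dn unfolding metric_conn_def by (simp add: ds_const mink_simps)
  have An: "mink (A (u x)) (n x) = 0" "A (u x + n x) = A (u x)"
    using A unfolding skew_map_def by (auto simp: mink_simps)
  have k': "D u + m0 *s ((mink (u x) \<nu> + mink (n x) \<nu>) *s n x - (mink (u x) (n x) + mink (n x) (n x)) *s \<nu>)
     + m0\<^sup>2 *s A (u x) = k *s (u x + n x)"
    using k unfolding nabla_def Dun An(2) mink_simps .
  have hp': "mink (u x) (n x) = 0" "mink (n x) (n x) = 1" "mink (n x) \<nu> = 0" "mink (u x) \<nu> = mink \<nu> (u x)"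
    using hp nu by (auto simp: hyp_pair_def mink_commute)
  have kv: "k = m0 * mink \<nu> (u x)"
    using arg_cong[OF k', of "\<lambda>v. mink v (n x)"] by (simp add: mink_simps Dn0 An(1) hp' nu)
  show ?thesis
    using k' unfolding hp' kv by (simp add: vec_eq_iff algebra_simps eq_diff_eq)
qed

text \<open>The coefficients \<open>\<nu>'\<close> and \<open>A'\<close> are those of the expansion of the gauged family at \<open>m = \<infinity>\<close>; that
  \<open>u + n\<close> is parallel at \<open>m0\<close> is what removes the poles at \<open>m = \<plusminus> m0\<close>.\<close>

lemma gauge_type_II:
  assumes g: "gauge_data D \<nu> A E F" and p: "parallel_normal D \<nu> A m0 u" and m0: "m0 \<noteq> 0"
  defines "R \<equiv> gauge (-1) (u x) (n x)"
  defines "\<nu>' \<equiv> R ((2 * m0) *s A (u x) - \<nu>)" and "A' \<equiv> \<lambda>v. R (A (R v))"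
  shows "gauge_data D \<nu>' A' E (R ` F)"
    and "\<And>m f. m\<^sup>2 \<noteq> m0\<^sup>2 \<Longrightarrow> DV f \<Longrightarrow>
      nabla D \<nu>' A' m (\<lambda>y. gauge ((m0 - m) / (m0 + m)) (u y) (n y) (f y))
      = gauge ((m0 - m) / (m0 + m)) (u x) (n x) (nabla D \<nu> A m f)"
proof -
  have hp: "hyp_pair (u x) (n x)" and u: "DV u"
    using p x_in_W by (auto simp: parallel_normal_def)
  have D: "metric_conn D" and Dn: "D n = 0" and nu: "mink \<nu> (n x) = 0" and A: "skew_map A" "A (n x) = 0"
    using g by (auto simp: gauge_data_def)
  note A1 = gauge_dataD(4-6)[OF g]
  have A0: "A 0 = 0" "A (- v) = - A v" for v
    using A1(2)[of 0 0] A1(2)[of "-1" v] by auto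
  have Rn: "R (n x) = - n x"
    unfolding R_def using hp by (rule gauge_minus_one_normal)
  have Rlin: "R (v + w) = R v + R w" "R (k *s v) = k *s R v" "R (- v) = - R v" "R 0 = 0" for v w k
    unfolding R_def using gauge_scale[of "-1" _ _ "-1" v] gauge_scale[of "-1" _ _ 0 0]
    by (simp_all add: gauge_add gauge_scale)
  have Rswap: "mink (R v) w = mink v (R w)" for v w
    unfolding R_def using hp by (rule gauge_minus_one_swap)
  have RR: "R (R v) = v" for v
    unfolding R_def using hp by (rule gauge_minus_one_invol)
  have An: "mink (A v) (n x) = 0" for v
    using A1(3) A(2) by (simp add: mink_simps)
  have "skew_map A'"
    unfolding skew_map_def A'_def by (simp add: A1 Rlin Rswap)
  moreover have "mink \<nu>' (n x) = 0"
    unfolding \<nu>'_def Rswap Rn by (simp add: mink_simps An nu)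
  moreover have "A' (n x) = 0"
    unfolding A'_def Rn by (simp add: A0 A(2) Rlin)
  moreover have "A' e = 0 \<and> mink \<nu>' e = 0" if eF: "e \<in> R ` F" for e
  proof -
    obtain e' where e: "e = R e'" "e' \<in> F"
      using eF by blast
    then have "A e' = 0" "mink \<nu> e' = 0"
      using g by (auto simp: gauge_data_def)
    then show ?thesis
      unfolding A'_def \<nu>'_def e(1) RR Rswap by (simp add: Rlin mink_simps A1(3))
  qed
  \<comment> \<open>\<open>D\<close> is unchanged because the gauge is the identity at
    \<open>m = 0\<close>, where the family reduces to \<open>D\<close>.\<close>
  ultimately show "gauge_data D \<nu>' A' E (R ` F)"
    using g unfolding gauge_data_def by blast
  fix m f assume m: "m\<^sup>2 \<noteq> m0\<^sup>2" and f: "DV f"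
  have ne: "m0 - m \<noteq> 0" "m0 + m \<noteq> 0"
    using m by (auto simp: power2_eq_square add_eq_0_iff)
  have ne2: "m0 * 2 + m * 2 \<noteq> 0"
    using ne(2) by (metis distrib_right mult_eq_0_iff zero_neq_numeral)
  define \<kappa> where "\<kappa> = (m0 - m) / (m0 + m)"
  define c s where "c = (\<kappa> + inverse \<kappa>) / 2" and "s = (\<kappa> - inverse \<kappa>) / 2"
  have "inverse ((m0 - m) * (m0 + m)) * (m0\<^sup>2 - m\<^sup>2) = 1"
    using ne by (simp add: power2_eq_square square_diff_square_factored mult.commute del: inverse_mult_distrib)
  moreover have "c = (m0\<^sup>2 + m\<^sup>2) * inverse ((m0 - m) * (m0 + m))" "s = - 2 * m0 * m * inverse ((m0 - m) * (m0 + m))"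
    using ne ne2 unfolding c_def s_def \<kappa>_def
    by (simp_all add: divide_simps) (simp_all add: algebra_simps power2_eq_square)
  ultimately have cs: "\<exists>e. e * (m0\<^sup>2 - m\<^sup>2) = 1 \<and> c = (m0\<^sup>2 + m\<^sup>2) * e \<and> s = - 2 * m0 * m * e"
    by blast
  have gr: "gauge \<kappa> = rot c s"
    by (simp add: gauge_def c_def s_def)
  have "nabla D \<nu>' A' m (\<lambda>y. rot c s (u y) (n y) (f y)) = rot c s (u x) (n x) (nabla D \<nu> A m f)"
    unfolding nabla_def metric_conn_rot[OF D u DV_n f Dn]
    using gauge_identity[OF hp A nu parallel_normal_deriv[OF g p] cs, of "f x"]
    unfolding A'_def \<nu>'_def R_def gauge_minus_one
    by (simp add: gr[symmetric] gauge_add add.assoc)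
  then show "nabla D \<nu>' A' m (\<lambda>y. gauge ((m0 - m) / (m0 + m)) (u y) (n y) (f y))
      = gauge ((m0 - m) / (m0 + m)) (u x) (n x) (nabla D \<nu> A m f)"
    unfolding \<kappa>_def[symmetric] gr .
qed

text \<open>The negative of the previous gauge is its composition with the reflection \<open>gauge (-1)\<close>, which does
  not depend on \<open>m\<close>; the reflection now falls on \<open>E\<close> instead of \<open>F\<close>.\<close>

lemma gauge_type_I:
  assumes g: "gauge_data D \<nu> A E F" and p: "parallel_normal D \<nu> A m0 u" and m0: "m0 \<noteq> 0"
  shows "\<exists>D' \<nu>' A'. gauge_data D' \<nu>' A' (\<lambda>y. gauge (-1) (u y) (n y) ` E y) F \<and> 
    (\<forall>m f. m\<^sup>2 \<noteq> m0\<^sup>2 \<longrightarrow> DV f \<longrightarrow>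
      nabla D' \<nu>' A' m (\<lambda>y. gauge ((m - m0) / (m + m0)) (u y) (n y) (f y))
      = gauge ((m - m0) / (m + m0)) (u x) (n x) (nabla D \<nu> A m f))"
proof -
  define R where "R = (\<lambda>y. gauge (-1) (u y) (n y))"
  have hpy: "hyp_pair (u y) (n y)" if "y \<in> W" for y
    using p that by (auto simp: parallel_normal_def)
  have u: "DV u"
    using p by (auto simp: parallel_normal_def)
  define \<nu>1 A1 where "\<nu>1 = R x ((2 * m0) *s A (u x) - \<nu>)" and "A1 = (\<lambda>v. R x (A (R x v)))"
  have II: "gauge_data D \<nu>1 A1 E (R x ` F)"
    "\<And>m f. m\<^sup>2 \<noteq> m0\<^sup>2 \<Longrightarrow> DV f \<Longrightarrow>
      nabla D \<nu>1 A1 m (\<lambda>y. gauge ((m0 - m) / (m0 + m)) (u y) (n y) (f y))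
      = gauge ((m0 - m) / (m0 + m)) (u x) (n x) (nabla D \<nu> A m f)"
    unfolding \<nu>1_def A1_def R_def by (rule gauge_type_II[OF g p m0]; assumption)+
  have Rlin: "R y (v + w) = R y v + R y w" "R y (k *s v) = k *s R y v" "R y (- v) = - R y v" "R y 0 = 0" for v w k y
    unfolding R_def using gauge_scale[of "-1" _ _ "-1" v] gauge_scale[of "-1" _ _ 0 0]
    by (simp_all add: gauge_add gauge_scale)
  have Rdiff: "R y (v - w) = R y v - R y w" for y v w
    using Rlin(1)[of y v "- w"] by (simp add: Rlin)
  have Rn: "R y (n y) = - n y" if "y \<in> W" for y
    unfolding R_def using hpy[OF that] by (rule gauge_minus_one_normal)
  have Rswap: "mink (R y v) w = mink v (R y w)" if "y \<in> W" for v w y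
    unfolding R_def using hpy[OF that] by (rule gauge_minus_one_swap)
  have RR: "R y (R y v) = v" if "y \<in> W" for v y
    unfolding R_def using hpy[OF that] by (rule gauge_minus_one_invol)
  have DVR: "DV (\<lambda>y. R y (f y))" if "DV f" for f
    unfolding R_def using u DV_n that by (rule DV_gauge)
  \<comment> \<open>Now the gauge parameter at \<open>m = 0\<close> is -1, so the constant term of
    the family is conjugated by the reflection.\<close>
  define D' where "D' = (\<lambda>f. R x (D (\<lambda>y. R y (f y))))"
  note D = gauge_dataD(1)[OF g] and Dn = gauge_dataD(2)[OF g]
  have \<nu>1n: "mink \<nu>1 (n x) = 0"
    using II(1) by (simp add: gauge_data_def)
  note Rx = Rn[OF x_in_W] Rswap[OF x_in_W] RR[OF x_in_W]
  have "metric_conn D'"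
    unfolding metric_conn_def
  proof (intro conjI allI impI)
    fix f g :: "'a \<Rightarrow> complex^5" and h
    {
      assume "\<forall>y\<in>W. f y = g y"
      then have "D (\<lambda>y. R y (f y)) = D (\<lambda>y. R y (g y))"
        using D unfolding metric_conn_def by simp
      then show "D' f = D' g"
        by (simp add: D'_def)
    }
    assume f: "DV f"
    {
      assume g: "DV g"
      show "D' (\<lambda>y. f y + g y) = D' f + D' g"
        unfolding D'_def Rlin using D DVR[OF f] DVR[OF g] by (simp add: metric_conn_def Rlin)
      have "ds (\<lambda>y. mink (f y) (g y)) = ds (\<lambda>y. mink (R y (f y)) (R y (g y)))"
        by (rule ds_cong) (simp add: Rswap RR)
      then show "ds (\<lambda>y. mink (f y) (g y)) = mink (D' f) (g x) + mink (f x) (D' g)"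
        using D DVR[OF f] DVR[OF g] by (simp add: metric_conn_def D'_def Rx)
    }
    assume h: "DS h"
    show "D' (\<lambda>y. h y *s f y) = ds h *s f x + h x *s D' f"
      unfolding D'_def Rlin using D DVR[OF f] h by (simp add: metric_conn_def Rlin Rx)
  qed
  moreover have "D' n = 0"
  proof -
    have "D (\<lambda>y. R y (n y)) = D (\<lambda>y. (-1) *s n y)"
      using D unfolding metric_conn_def by (metis (no_types, lifting) Rn vector_sneg_minus1)
    also have "\<dots> = 0"
    proof -
      have "D (\<lambda>y. h y *s f y) = ds h *s f x + h x *s D f" if "DS h" "DV f" for h f
        using D that unfolding metric_conn_def by blast
      from this[OF DS_const DV_n, of "-1"] show ?thesis
        by (simp only: ds_const Dn) simp
    qed
    finally show ?thesis
      by (simp add: D'_def Rlin)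
  qed
  \<comment> \<open>The two reflections cancel in \<open>A'\<close>, which is \<open>A\<close>
    again; the sign in \<open>\<nu>'\<close> comes from \<open>R x (n x) = - n x\<close>.\<close>
  moreover define \<nu>' A' where "\<nu>' = - R x \<nu>1" and "A' = (\<lambda>v. R x (A1 (R x v)))"
  have "mink \<nu>' (n x) = 0"
    by (simp add: \<nu>'_def mink_simps Rx \<nu>1n)
  moreover have A1: "skew_map A1" "A1 (n x) = 0" and F1: "\<And>e. e \<in> F \<Longrightarrow> A1 (R x e) = 0 \<and> mink \<nu>1 (R x e) = 0"
    using II(1) by (auto simp: gauge_data_def)
  note A1_lin = gauge_dataD(4-6)[OF II(1)]
  have "A1 (- v) = - A1 v" for v
    using A1_lin(2)[of "-1" v] by simp
  then have "A' (n x) = 0"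
    by (simp add: A'_def Rx A1 Rlin)
  moreover have "skew_map A'"
    unfolding skew_map_def A'_def by (simp add: A1_lin Rlin Rx)
  moreover have "A' e = 0 \<and> mink \<nu>' e = 0" if "e \<in> F" for e
    using F1[OF that] by (simp add: A'_def \<nu>'_def mink_simps Rx Rlin)
  moreover have "mink (D' f) h = 0" if f: "DV f" "\<forall>y\<in>W. f y \<in> R y ` E y" and h: "h \<in> R x ` E x" for f h
  proof -
    have "\<forall>y\<in>W. R y (f y) \<in> E y"
      using f(2) RR by fastforce
    moreover have "R x h \<in> E x"
      using h Rx by fastforce
    ultimately have "mink (D (\<lambda>y. R y (f y))) (R x h) = 0"
      using g DVR[OF f(1)] unfolding gauge_data_def by blast
    then show ?thesis
      by (simp add: D'_def Rx)
  qed
  ultimately have "gauge_data D' \<nu>' A' (\<lambda>y. R y ` E y) F"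
    unfolding gauge_data_def by blast
  moreover have "nabla D' \<nu>' A' m (\<lambda>y. gauge ((m - m0) / (m + m0)) (u y) (n y) (f y))
      = gauge ((m - m0) / (m + m0)) (u x) (n x) (nabla D \<nu> A m f)" if m: "m\<^sup>2 \<noteq> m0\<^sup>2" and f: "DV f" for m f
  proof -
    have ne: "m0 - m \<noteq> 0" "m0 + m \<noteq> 0"
      using m by (auto simp: power2_eq_square add_eq_0_iff)
    have neg: "(m - m0) / (m + m0) = -1 * ((m0 - m) / (m0 + m))"
      using ne by (simp add: field_simps)
    have gg: "gauge ((m - m0) / (m + m0)) (u y) (n y) v = R y (gauge ((m0 - m) / (m0 + m)) (u y) (n y) v)"
      if "y \<in> W" for y v
      unfolding neg R_def by (rule gauge_gauge[symmetric]) (use hpy[OF that] ne in auto)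
    define h where "h = (\<lambda>y. gauge ((m0 - m) / (m0 + m)) (u y) (n y) (f y))"
    have h: "DV h"
      unfolding h_def by (rule DV_gauge[OF u DV_n f])
    have local: "D f1 = D f2" if "\<And>y. y \<in> W \<Longrightarrow> f1 y = f2 y" for f1 f2
      using D that unfolding metric_conn_def by blast
    have "D' (\<lambda>y. gauge ((m - m0) / (m + m0)) (u y) (n y) (f y)) = R x (D h)"
      unfolding D'_def by (rule arg_cong[where f = "R x"], rule local) (simp add: gg RR h_def)
    moreover have "gauge ((m - m0) / (m + m0)) (u x) (n x) (f x) = R x (h x)"
      unfolding h_def by (rule gg[OF x_in_W])
    moreover have "gauge ((m - m0) / (m + m0)) (u x) (n x) (nabla D \<nu> A m f) = R x (nabla D \<nu>1 A1 m h)"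
      unfolding gg[OF x_in_W] h_def II(2)[OF m f] ..
    moreover have "R x (D h) + m *s (mink (R x (h x)) \<nu>' *s n x - mink (R x (h x)) (n x) *s \<nu>') + m\<^sup>2 *s A' (R x (h x))
      = R x (nabla D \<nu>1 A1 m h)"
      unfolding nabla_def \<nu>'_def A'_def
      by (simp add: Rlin Rx mink_simps) (simp add: Rlin Rx mink_simps vec_eq_iff algebra_simps Rdiff)
    ultimately show ?thesis
      by (simp add: nabla_def)
  qed
  ultimately show ?thesis
    unfolding R_def by blast
qed

end

subsection \<open>The algebraic dressing maps\<close>

lemma span_pair: "v \<in> vec.span {a, b} \<longleftrightarrow> (\<exists>k l. v = k *s a + l *s (b::'a::field^5))"
proof -
  have "v \<in> vec.span {a, b} \<longleftrightarrow> (\<exists>k l. v - k *s a = l *s b)"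
    by (auto simp: vec.span_insert[of a] vec.span_singleton)
  also have "\<dots> \<longleftrightarrow> (\<exists>k l. v = k *s a + l *s b)"
    by (auto simp: algebra_simps)
  finally show ?thesis .
qed

lemma span_single: "v \<in> vec.span {a} \<longleftrightarrow> (\<exists>k. v = k *s (a::'a::field^5))"
  by (auto simp: vec.span_singleton)

lemma span_single_scale: "k *s a \<in> vec.span {a::'a::field^5}"
  by (auto simp: span_single)

lemma subspace_orth: "vec.subspace (orth S)"
  by (auto simp: vec.subspace_def orth_def mink_simps)

lemma subspace_vsum: "vec.subspace A \<Longrightarrow> vec.subspace B \<Longrightarrow> vec.subspace (vsum A B)"
proof -
  assume a: "vec.subspace A" "vec.subspace B"
  have "vsum A B = {x + y |x y. x \<in> A \<and> y \<in> B}"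
    by (simp add: vsum_def)
  then show ?thesis
    using vec.subspace_sums[OF a] by simp
qed

lemma orth_span: "orth (vec.span S) = orth S"
proof
  show "orth (vec.span S) \<subseteq> orth S"
    by (auto simp: orth_def intro: vec.span_base)
  show "orth S \<subseteq> orth (vec.span S)"
  proof
    fix v assume v: "v \<in> orth S"
    have "mink v w = 0" if "w \<in> vec.span S" for w
      using that by (induct rule: vec.span_induct_alt) (use v in \<open>auto simp: orth_def mink_simps\<close>)
    then show "v \<in> orth (vec.span S)"
      by (simp add: orth_def)
  qed
qed

lemma proj_along_eq:
  assumes A: "vec.subspace A" and B: "vec.subspace B" and AB: "A \<inter> B \<subseteq> {0}" and a: "a \<in> A" "v - a \<in> B"
  shows "proj_along A B v = a"
  unfolding proj_along_def
proof (rule the_equality)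
  fix b assume b: "b \<in> A \<and> v - b \<in> B"
  have "b - a \<in> A"
    using A a b by (simp add: vec.subspace_diff)
  moreover have "b - a = (v - a) - (v - b)"
    by simp
  then have "b - a \<in> B"
    using B a b by (metis vec.subspace_diff)
  ultimately show "b = a"
    using AB by auto
qed (use a in simp)

text \<open>The involution \<open>rho\<close> at a point where the central sphere is the orthogonal
  complement of the unit vector \<open>n\<close>.\<close>

definition refl_n :: "complex^5 \<Rightarrow> complex^5 \<Rightarrow> complex^5" where
  "refl_n n v = v - (2 * mink v n) *s n"

lemma refl_n_hyp: "hyp_pair u n \<Longrightarrow> refl_n n (u + n) = u - n"
  by (simp add: refl_n_def hyp_pair_def mink_simps vec_eq_iff)

lemma image_span_single:
  fixes f :: "'a::field^5 \<Rightarrow> 'a^5"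
  assumes "\<And>k v. f (k *s v) = k *s f v"
  shows "f ` vec.span {a} = vec.span {f a}"
proof
  show "f ` vec.span {a} \<subseteq> vec.span {f a}"
    by (auto simp: span_single[of _ a] assms span_single_scale)
  show "vec.span {f a} \<subseteq> f ` vec.span {a}"
  proof
    fix v assume "v \<in> vec.span {f a}"
    then obtain k where "v = f (k *s a)"
      by (auto simp: span_single assms)
    then show "v \<in> f ` vec.span {a}"
      using span_single_scale by blast
  qed
qed

lemma refl_n_span: "hyp_pair u n \<Longrightarrow> refl_n n ` vec.span {u + n} = vec.span {u - n}"
proof -
  assume h: "hyp_pair u n"
  have "refl_n n ` vec.span {u + n} = vec.span {refl_n n (u + n)}"
    by (rule image_span_single) (simp add: refl_n_def mink_simps vec_eq_iff algebra_simps)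
  then show ?thesis
    by (simp only: refl_n_hyp[OF h])
qed

lemma vsum_spans: "vsum (vec.span {a}) (vec.span {b}) = vec.span {a, b::'a::field^5}"
  unfolding vsum_def set_eq_iff mem_Collect_eq span_single span_pair by blast

lemma vsumI: "a \<in> A \<Longrightarrow> b \<in> B \<Longrightarrow> v = a + b \<Longrightarrow> v \<in> vsum A B"
  by (auto simp: vsum_def)

lemma mem_orth: "v \<in> orth S \<longleftrightarrow> (\<forall>w\<in>S. mink v w = 0)"
  by (simp add: orth_def)

text \<open>The vectors u + n and u - n are null with inner product -2, which is where the
  coefficients -1/2 come from.\<close>

lemma hyp_pair_projections:
  assumes h: "hyp_pair u n"
  defines "L \<equiv> vec.span {u + n}"
  shows "pi_L (refl_n n) L v = (- (mink v (u - n)) / 2) *s (u + n)"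
    and "pi_RL (refl_n n) L v = (- (mink v (u + n)) / 2) *s (u - n)"
    and "pi_rest (refl_n n) L v = v - pi_L (refl_n n) L v - pi_RL (refl_n n) L v"
proof -
  have m: "mink u u = -1" "mink n n = 1" "mink u n = 0" "mink n u = 0"
    using h by (auto simp: hyp_pair_def mink_commute)
  define O' where "O' = orth {u + n, u - n}"
  have RL: "refl_n n ` L = vec.span {u - n}"
    unfolding L_def by (rule refl_n_span[OF h])
  have O: "orth (vsum L (vec.span {u - n})) = O'"
    by (simp add: L_def vsum_spans orth_span O'_def)
  have sub: "vec.subspace O'"
    unfolding O'_def by (rule subspace_orth)
  let ?a = "(- (mink v (u - n)) / 2) *s (u + n)" and ?b = "(- (mink v (u + n)) / 2) *s (u - n)"
  have rest: "v - ?a - ?b \<in> O'"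
    by (auto simp: O'_def mem_orth mink_simps m field_simps)
  have dd: "p = q + (p - q)" "p - r = q + (p - q - r)" "p - (p - q - r) = q + r" for p q r :: "complex^5"
    by simp_all
  have oO: "mink w (u + n) = 0" "mink w (u - n) = 0" if "w \<in> O'" for w
    using that by (auto simp: O'_def mem_orth)
  show 1: "pi_L (refl_n n) L v = ?a"
    unfolding pi_L_def RL O
  proof (rule proj_along_eq)
    show "L \<inter> vsum (vec.span {u - n}) O' \<subseteq> {0}"
    proof
      fix w assume w: "w \<in> L \<inter> vsum (vec.span {u - n}) O'"
      then obtain k l o' where k: "w = k *s (u + n)" "w = l *s (u - n) + o'" "o' \<in> O'"
        unfolding L_def vsum_def span_single Int_iff mem_Collect_eq by metis
      have "mink w (u - n) = 0"
        unfolding k(2) using oO(2)[OF k(3)] by (simp add: mink_simps m)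
      then have "k = 0"
        unfolding k(1) by (simp add: mink_simps m)
      then show "w \<in> {0}"
        by (simp add: k(1))
    qed
    show "v - ?a \<in> vsum (vec.span {u - n}) O'"
      by (rule vsumI[OF span_single_scale rest dd(1)])
  qed (simp_all only: L_def span_single_scale sub subspace_vsum vec.subspace_span)
  show 2: "pi_RL (refl_n n) L v = ?b"
    unfolding pi_RL_def RL O
  proof (rule proj_along_eq)
    show "vec.span {u - n} \<inter> vsum L O' \<subseteq> {0}"
    proof
      fix w assume w: "w \<in> vec.span {u - n} \<inter> vsum L O'"
      then obtain k l o' where k: "w = k *s (u - n)" "w = l *s (u + n) + o'" "o' \<in> O'"
        unfolding L_def vsum_def span_single Int_iff mem_Collect_eq by metis
      have "mink w (u + n) = 0"
        unfolding k(2) using oO(1)[OF k(3)] by (simp add: mink_simps m)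
      then have "k = 0"
        unfolding k(1) by (simp add: mink_simps m)
      then show "w \<in> {0}"
        by (simp add: k(1))
    qed
    show "v - ?b \<in> vsum L O'"
      unfolding L_def by (rule vsumI[OF span_single_scale rest dd(2)])
  qed (simp_all only: L_def span_single_scale sub subspace_vsum vec.subspace_span)
  show "pi_rest (refl_n n) L v = v - pi_L (refl_n n) L v - pi_RL (refl_n n) L v"
    unfolding pi_rest_def RL O 1 2
  proof (rule proj_along_eq)
    show "O' \<inter> vsum L (vec.span {u - n}) \<subseteq> {0}"
    proof
      fix w assume w: "w \<in> O' \<inter> vsum L (vec.span {u - n})"
      then obtain k l where k: "w = k *s (u + n) + l *s (u - n)"
        unfolding L_def vsum_def span_single Int_iff mem_Collect_eq by metis
      have "mink w (u + n) = 0" "mink w (u - n) = 0"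
        using oO w by auto
      then have "l = 0" "k = 0"
        unfolding k by (simp_all add: mink_simps m)
      then show "w \<in> {0}"
        by (simp add: k)
    qed
    show "v - (v - ?a - ?b) \<in> vsum L (vec.span {u - n})"
      unfolding L_def by (rule vsumI[OF span_single_scale span_single_scale dd(3)])
  qed (simp_all only: L_def rest sub subspace_vsum vec.subspace_span)
qed

lemma gauge_by_projections:
  assumes h: "hyp_pair u n"
  shows "gauge \<kappa> u n v = \<kappa> *s pi_L (refl_n n) (vec.span {u + n}) v + pi_rest (refl_n n) (vec.span {u + n}) v
    + inverse \<kappa> *s pi_RL (refl_n n) (vec.span {u + n}) v"
proof -
  \<comment> \<open>With \<open>inverse \<kappa>\<close> replaced by a variable the identity is
    linear in it, and no case distinction at \<open>\<kappa> = 0\<close> arises.\<close>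
  define i where "i = inverse \<kappa>"
  show ?thesis
    unfolding hyp_pair_projections[OF h] gauge_def rot_def mink_simps i_def[symmetric]
    by (simp add: vec_eq_iff field_simps)
qed

lemma p_gauge_eq: "hyp_pair u n \<Longrightarrow> p_gauge (refl_n n) a (vec.span {u + n}) \<zeta> = gauge ((a - \<zeta>) / (a + \<zeta>)) u n"
  by (rule ext) (simp only: p_gauge_def gauge_by_projections inverse_divide)

lemma q_gauge_eq: "hyp_pair u n \<Longrightarrow> q_gauge (refl_n n) a (vec.span {u + n}) \<zeta> = gauge ((\<zeta> - a) / (\<zeta> + a)) u n"
  by (rule ext) (simp only: q_gauge_def gauge_by_projections inverse_divide)

lemma p_gauge_infinity_eq: "hyp_pair u n \<Longrightarrow> p_gauge_infinity (refl_n n) (vec.span {u + n}) = gauge (-1) u n"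
  by (rule ext) (simp add: p_gauge_infinity_def gauge_by_projections[of _ _ "-1"])

text \<open>If l were orthogonal to n, the reflection would fix it, and being null it would lie in
  the forbidden intersection. Scaling l to have product 1 with n then splits it as u + n.\<close>

lemma admissible_line:
  assumes n: "mink n n = 1" and l: "mink l l = 0" and a: "admissible (refl_n n) (vec.span {l})" "l \<noteq> 0"
  shows "mink l n \<noteq> 0" "hyp_pair (inverse (mink l n) *s l - n) n"
    "vec.span {inverse (mink l n) *s l - n + n} = vec.span {l}"
proof -
  show nz: "mink l n \<noteq> 0"
  proof
    assume "mink l n = 0"
    then have "l \<in> refl_n n ` vec.span {l} \<inter> orth (vec.span {l})"
      unfolding orth_span using l by (auto simp: mem_orth refl_n_def vec.span_base intro!: image_eqI[of _ _ l])
    then show False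
      using a unfolding admissible_def by blast
  qed
  show "hyp_pair (inverse (mink l n) *s l - n) n"
    using nz n l by (simp add: hyp_pair_def mink_simps mink_commute[of n l])
  show "vec.span {inverse (mink l n) *s l - n + n} = vec.span {l}"
    using vec.span_image_scale[of "{l}" "\<lambda>_. inverse (mink l n)"] nz by simp
qed

section \<open>Complex conjugation and real vectors\<close>

lemma conjv_conjv [simp]: "conjv (conjv v) = v"
  by (simp add: conjv_def vec_eq_iff)

lemma conjv_add: "conjv (v + w) = conjv v + conjv w"
  and conjv_diff: "conjv (v - w) = conjv v - conjv w"
  and conjv_scale: "conjv (k *s v) = cnj k *s conjv v"
  by (simp_all add: conjv_def vec_eq_iff)

lemma mink_conjv: "mink (conjv v) (conjv w) = cnj (mink v w)"
  by (simp add: conjv_def mink_def)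

lemma conjv_cplx [simp]: "conjv (cplx v) = cplx v"
  by (simp add: conjv_def cplx_def vec_eq_iff)

lemma mink_cplx: "mink (cplx v) (cplx w) = of_real (mink v w)"
  by (simp add: mink_def cplx_def)

lemma conjv_fixed: "conjv v = v \<Longrightarrow> \<exists>w. v = cplx w"
  by (rule exI[of _ "\<chi> i. Re (v $ i)"]) (auto simp: conjv_def cplx_def vec_eq_iff complex_eq_iff)

lemma conjv_span_single: "conjv ` vec.span {l} = vec.span {conjv l}"
proof
  show "conjv ` vec.span {l} \<subseteq> vec.span {conjv l}"
    unfolding span_single image_subset_iff by (auto simp: span_single conjv_scale)
  show "vec.span {conjv l} \<subseteq> conjv ` vec.span {l}"
  proof
    fix v assume "v \<in> vec.span {conjv l}"
    then obtain k where "v = k *s conjv l"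
      by (auto simp: span_single)
    then have "v = conjv (cnj k *s l)"
      by (simp add: conjv_scale)
    then show "v \<in> conjv ` vec.span {l}"
      using span_single_scale by blast
  qed
qed

text \<open>The prescribed products make \<open>n, s, a, b, t\<close> linearly independent, hence a
  basis of the five-dimensional space. The second claim says that the isotropic plane of
  \<open>s\<close> and \<open>a\<close> is its own orthogonal complement inside that of
  \<open>n\<close>; later memberships in null planes are proved through it.\<close>

lemma null_frame_orth:
  assumes h: "mink s s = 0" "mink s a = 0" "mink s b = 0" "mink a a = 0" "mink b b = 0"
    "mink a b = k" "k \<noteq> 0" "mink s t = - k" 
    and n: "mink n n = 1" "mink s n = 0" "mink a n = 0" "mink b n = 0" "mink t n = (0::'a::field)"
  shows "vec.span {s, a, b, t} = orth {n}"
    and "\<And>v. mink v n = 0 \<Longrightarrow> mink v s = 0 \<Longrightarrow> mink v a = 0 \<Longrightarrow> v \<in> vec.span {s, a}"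
proof -
  have c: "mink a s = 0" "mink b s = 0" "mink b a = k" "mink t s = - k" "mink n s = 0" "mink n a = 0" "mink n b = 0" "mink n t = 0"
    using h n by (simp_all add: mink_commute)
  define comb where "comb = (\<lambda>x y z w r. x *s n + (y *s s + (z *s a + (w *s b + r *s t))))"
  have zero: "x = 0 \<and> y = 0 \<and> z = 0 \<and> w = 0 \<and> r = 0" if e: "comb x y z w r = 0" for x y z w r
  proof -
    \<comment> \<open>Tested against \<open>n, s, b, a, t\<close> in this order, the equation yields
      one coefficient after the other; the products of \<open>t\<close> with \<open>a\<close>,
      \<open>b\<close> and itself stay free.\<close>
    have x: "x = 0"
      using arg_cong[OF e, of "\<lambda>v. mink v n"] by (simp add: comb_def mink_simps h n c)
    have r: "r = 0"
      using arg_cong[OF e, of "\<lambda>v. mink v s"] h(7) by (simp add: comb_def mink_simps h n c)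
    have z: "z = 0"
      using arg_cong[OF e, of "\<lambda>v. mink v b"] h(7) by (simp add: comb_def mink_simps h n c r)
    have w: "w = 0"
      using arg_cong[OF e, of "\<lambda>v. mink v a"] h(7) by (simp add: comb_def mink_simps h n c r)
    have "y = 0"
      using arg_cong[OF e, of "\<lambda>v. mink v t"] h(7) by (simp add: comb_def mink_simps h n c r w z x)
    then show ?thesis
      using x r z w by simp
  qed
  define f where "f = (\<lambda>c::'a^5. comb (c$1) (c$2) (c$3) (c$4) (c$5))"
  have lin: "Vector_Spaces.linear (*s) (*s) f"
    unfolding f_def comb_def by unfold_locales (simp_all add: vec_eq_iff algebra_simps)
  have "inj f"
    unfolding vec.linear_inj_iff_eq_0[OF lin]
  proof (intro allI impI)
    fix c assume "f c = 0"
    then have "c$1 = 0 \<and> c$2 = 0 \<and> c$3 = 0 \<and> c$4 = 0 \<and> c$5 = 0"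
      unfolding f_def by (rule zero)
    then have "c $ i = 0" for i
      using exhaust_5[of i] by auto
    then show "c = 0"
      by (simp add: vec_eq_iff)
  qed
  then have "surj f"
    by (rule vec.linear_inj_imp_surj[OF lin])
  then have UN: "\<exists>x y z w r. v = comb x y z w r" for v
  proof -
    obtain c where "v = f c"
      using \<open>surj f\<close> by (rule surjE)
    then show ?thesis
      unfolding f_def by blast
  qed
  show "vec.span {s, a, b, t} = orth {n}"
  proof
    show "vec.span {s, a, b, t} \<subseteq> orth {n}"
      by (rule vec.span_minimal) (auto simp: subspace_orth mem_orth n)
    show "orth {n} \<subseteq> vec.span {s, a, b, t}"
    proof
      fix v assume v': "v \<in> orth {n}"
      obtain x y z w r where v: "v = comb x y z w r"
        using UN by blast
      have "x = 0"
        using v' by (simp add: mem_orth v comb_def mink_simps h n c)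
      then show "v \<in> vec.span {s, a, b, t}"
        unfolding v comb_def by (simp, intro vec.span_add vec.span_scale vec.span_base) simp_all
    qed
  qed
  have "v \<in> vec.span {s, a}" if "mink v n = 0" "mink v s = 0" "mink v a = 0" for v
  proof -
    obtain x y z w r where v: "v = comb x y z w r"
      using UN by blast
    have "x = 0"
      using that(1) by (simp add: v comb_def mink_simps h n c)
    moreover have r: "r = 0"
      using that(2) h(7) by (simp add: v comb_def mink_simps h n c)
    moreover have "w = 0"
      using that(3) h(7) by (simp add: v comb_def mink_simps h n c r)
    ultimately have "v = y *s s + z *s a"
      by (simp add: v comb_def)
    then show ?thesis
      unfolding span_pair by blast
  qed
  then show "\<And>v. mink v n = 0 \<Longrightarrow> mink v s = 0 \<Longrightarrow> mink v a = 0 \<Longrightarrow> v \<in> vec.span {s, a}"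
    by blast
qed

subsection \<open>Calculus in the plane\<close>

lemma has_derivative_d_xy:
  assumes "(f has_derivative f') (at w)"
  shows "d_x f w = f' 1" "d_y f w = f' \<i>" "f' h = Re h *\<^sub>R d_x f w + Im h *\<^sub>R d_y f w"
proof -
  have f': "f' = frechet_derivative f (at w)"
    by (rule frechet_derivative_at[OF assms])
  show x: "d_x f w = f' 1" and y: "d_y f w = f' \<i>"
    by (simp_all add: d_x_def d_y_def f')
  interpret bounded_linear f'
    using assms by (rule has_derivative_bounded_linear)
  have "h = Re h *\<^sub>R 1 + Im h *\<^sub>R \<i>"
    by (simp add: complex_eq_iff)
  then show "f' h = Re h *\<^sub>R d_x f w + Im h *\<^sub>R d_y f w"
    using add[of "Re h *\<^sub>R 1" "Im h *\<^sub>R \<i>"] by (simp add: scaleR x y)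
qed

lemma differentiable_has_derivative_d_xy:
  assumes "f differentiable (at w)"
  shows "(f has_derivative (\<lambda>h. Re h *\<^sub>R d_x f w + Im h *\<^sub>R d_y f w)) (at w)"
proof -
  obtain f' where f': "(f has_derivative f') (at w)"
    using assms by (auto simp: differentiable_def)
  then show ?thesis
    by (rule has_derivative_eq_rhs) (rule ext, rule has_derivative_d_xy(3)[OF f'])
qed

lemma d_xy_cong:
  assumes "open U" "w \<in> U" "\<And>z. z \<in> U \<Longrightarrow> f z = g z"
  shows "d_x f w = d_x g w" "d_y f w = d_y g w" "f differentiable (at w) \<longleftrightarrow> g differentiable (at w)"
proof -
  have *: "(f has_derivative f') (at w) \<longleftrightarrow> (g has_derivative f') (at w)" for f'
    using has_derivative_transform_within_open[of f f' w UNIV U g]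
      has_derivative_transform_within_open[of g f' w UNIV U f] assms by auto
  show "d_x f w = d_x g w" "d_y f w = d_y g w" "f differentiable (at w) \<longleftrightarrow> g differentiable (at w)"
    by (simp_all add: d_x_def d_y_def frechet_derivative_def differentiable_def *)
qed

lemma Ck_on_cong:
  assumes "open U" "\<And>z. z \<in> U \<Longrightarrow> f z = g z"
  shows "Ck_on k U f \<longleftrightarrow> Ck_on k U g"
  using assms(2)
proof (induct k arbitrary: f g)
  case 0
  then show ?case
    by (simp cong: continuous_on_cong)
next
  case (Suc k)
  have "f differentiable_on U \<longleftrightarrow> g differentiable_on U"
    using d_xy_cong(3)[OF assms(1) _ Suc(2)] at_within_open[OF _ assms(1)]
    by (simp add: differentiable_on_def)
  moreover have "Ck_on k U (d_x f) \<longleftrightarrow> Ck_on k U (d_x g)" "Ck_on k U (d_y f) \<longleftrightarrow> Ck_on k U (d_y g)"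
    using d_xy_cong(1,2)[OF assms(1) _ Suc(2)] by (auto intro!: Suc(1))
  ultimately show ?case
    by simp
qed

lemma Ck_on_Suc_D: "Ck_on (Suc k) U f \<Longrightarrow> Ck_on k U f"
proof (induct k arbitrary: f)
  case 0
  then show ?case
    by (simp add: differentiable_imp_continuous_on)
next
  case (Suc k)
  have "f differentiable_on U" "Ck_on (Suc k) U (d_x f)" "Ck_on (Suc k) U (d_y f)"
    using Suc(2) by (simp_all only: Ck_on.simps(2))
  then show ?case
    unfolding Ck_on.simps(2)[of k U f] using Suc(1) by blast
qed

lemma Ck_on_subset:
  assumes "Ck_on k U f" "V \<subseteq> U"
  shows "Ck_on k V f"
  using assms(1)
proof (induct k arbitrary: f)
  case 0
  then show ?case
    using assms(2) by (auto intro: continuous_on_subset)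
next
  case (Suc k)
  then show ?case
    using assms(2) by (auto intro: differentiable_on_subset)
qed

text \<open>This allows smoothness to be checked near each point through whichever chart of the
  atlas covers it.\<close>

lemma Ck_on_local:
  assumes "\<And>w. w \<in> U \<Longrightarrow> \<exists>V. open V \<and> w \<in> V \<and> Ck_on k V f"
  shows "Ck_on k U f"
  using assms
proof (induct k arbitrary: f)
  case 0
  then show ?case
  proof -
    have "isCont f w" if w: "w \<in> U" for w
    proof -
      obtain V where V: "open V" "w \<in> V" "continuous_on V f"
        using 0[OF w] by auto
      then show ?thesis
        by (simp add: continuous_on_eq_continuous_at)
    qed
    then show ?thesis
      by (simp add: continuous_at_imp_continuous_on)
  qed
next
  case (Suc k)
  have "f differentiable (at w)" if w: "w \<in> U" for w
  proof -
    obtain V where V: "open V" "w \<in> V" "f differentiable_on V"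
      using Suc(2)[OF w] by auto
    then show ?thesis
      using at_within_open[OF V(2,1)] by (auto simp: differentiable_on_def)
  qed
  then have "f differentiable_on U"
    by (simp add: differentiable_on_def differentiable_at_withinI)
  moreover have "Ck_on k U (d_x f)" "Ck_on k U (d_y f)"
    by (rule Suc(1), use Suc(2) in fastforce)+
  ultimately show ?case
    by simp
qed

lemma Ck_on_imp_has_derivative:
  assumes "open U" "Ck_on (Suc k) U f" "w \<in> U"
  shows "(f has_derivative (\<lambda>h. Re h *\<^sub>R d_x f w + Im h *\<^sub>R d_y f w)) (at w)"
  by (rule differentiable_has_derivative_d_xy)
     (use assms at_within_open[OF assms(3,1)] in \<open>auto simp: differentiable_on_def\<close>)

text \<open>The derivative may be any expression, so product and chain rules can be inserted as they
  are and the induction sees only their values at 1 and \<i>.\<close>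

lemma Ck_on_SucI:
  assumes U: "open U" and d: "\<And>w. w \<in> U \<Longrightarrow> (f has_derivative f' w) (at w)"
    and "Ck_on k U (\<lambda>w. f' w 1)" "Ck_on k U (\<lambda>w. f' w \<i>)"
  shows "Ck_on (Suc k) U f"
proof -
  have "f differentiable_on U"
    using d by (auto simp: differentiable_on_def differentiable_def intro: has_derivative_at_withinI)
  moreover have "Ck_on k U (d_x f) \<longleftrightarrow> Ck_on k U (\<lambda>w. f' w 1)" "Ck_on k U (d_y f) \<longleftrightarrow> Ck_on k U (\<lambda>w. f' w \<i>)"
    using has_derivative_d_xy(1,2)[OF d] by (auto intro!: Ck_on_cong[OF U])
  ultimately show ?thesis
    using assms by simp
qed

lemma Ck_on_add: "open U \<Longrightarrow> Ck_on k U f \<Longrightarrow> Ck_on k U g \<Longrightarrow> Ck_on k U (\<lambda>w. f w + g w)"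
proof (induct k arbitrary: f g)
  case 0
  then show ?case
    by (simp add: continuous_on_add)
next
  case (Suc k)
  show ?case
    by (rule Ck_on_SucI[OF Suc(2) has_derivative_add[OF Ck_on_imp_has_derivative[OF Suc(2,3)] Ck_on_imp_has_derivative[OF Suc(2,4)]]])
       (use Suc in simp_all)
qed

lemma Ck_on_bilinear:
  assumes b: "bounded_bilinear b" and U: "open U"
  shows "Ck_on k U f \<Longrightarrow> Ck_on k U g \<Longrightarrow> Ck_on k U (\<lambda>w. b (f w) (g w))"
proof (induct k arbitrary: f g)
  case 0
  then show ?case
    by (simp add: bounded_bilinear.continuous_on[OF b])
next
  case (Suc k)
  have fg: "Ck_on k U f" "Ck_on k U g"
    using Suc(2,3) by (blast intro: Ck_on_Suc_D)+
  show ?case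
    by (rule Ck_on_SucI[OF U bounded_bilinear.FDERIV[OF b Ck_on_imp_has_derivative[OF U Suc(2)] Ck_on_imp_has_derivative[OF U Suc(3)]]])
       (use Suc fg in \<open>simp_all add: Ck_on_add[OF U]\<close>)
qed

lemma Ck_on_linear:
  assumes b: "bounded_linear b" and U: "open U"
  shows "Ck_on k U f \<Longrightarrow> Ck_on k U (\<lambda>w. b (f w))"
proof (induct k arbitrary: f)
  case 0
  then show ?case
    by (simp add: bounded_linear.continuous_on[OF b])
next
  case (Suc k)
  show ?case
    by (rule Ck_on_SucI[OF U bounded_linear.has_derivative[OF b Ck_on_imp_has_derivative[OF U Suc(2)]]])
       (use Suc in simp_all)
qed

lemma Ck_on_compose:
  fixes \<tau> :: "complex \<Rightarrow> complex"
  assumes U: "open U" and V: "open V" and UV: "\<tau> ` U \<subseteq> V"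
  shows "Ck_on k U \<tau> \<Longrightarrow> Ck_on k V f \<Longrightarrow> Ck_on k U (\<lambda>w. f (\<tau> w))"
proof (induct k arbitrary: f)
  case 0
  then show ?case
    using UV by (auto intro: continuous_on_compose2)
next
  case (Suc k)
  have t: "Ck_on k U \<tau>" "Ck_on k U (d_x \<tau>)" "Ck_on k U (d_y \<tau>)"
    using Suc(2) Ck_on_Suc_D[OF Suc(2)] by auto
  have f: "Ck_on k U (\<lambda>w. d_x f (\<tau> w))" "Ck_on k U (\<lambda>w. d_y f (\<tau> w))"
    using Suc t by auto
  have "(f has_derivative (\<lambda>h. Re h *\<^sub>R d_x f (\<tau> w) + Im h *\<^sub>R d_y f (\<tau> w))) (at (\<tau> w))" if "w \<in> U" for w
    by (rule Ck_on_imp_has_derivative[OF V Suc(3)]) (use that UV in auto)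
  note d = has_derivative_compose[OF Ck_on_imp_has_derivative[OF U Suc(2)] this]
  show ?case
    by (rule Ck_on_SucI[OF U d])
       (simp_all add: Ck_on_add[OF U] Ck_on_bilinear[OF bounded_bilinear_scaleR U] t f
          Ck_on_linear[OF bounded_linear_Re U] Ck_on_linear[OF bounded_linear_Im U])
qed

text \<open>The mean value theorem is applied twice: along \<open>a\<close> to the difference of
  \<open>f\<close> in direction \<open>b\<close>, then along \<open>b\<close> to the derivative in
  direction \<open>a\<close>. The directions are general because the lemma is used with 1, \<i> in
  both orders.\<close>

lemma mixed_difference_mean_value:
  fixes f :: "complex \<Rightarrow> real"
  assumes r: "h > 0" "\<And>s t. 0 \<le> s \<Longrightarrow> s \<le> h \<Longrightarrow> 0 \<le> t \<Longrightarrow> t \<le> h \<Longrightarrow> of_real s * a + of_real t * b + w \<in> B"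
    and f: "\<And>z. z \<in> B \<Longrightarrow> (f has_derivative f' z) (at z)"
    and fa: "\<And>z. z \<in> B \<Longrightarrow> ((\<lambda>z. f' z a) has_derivative f'' z) (at z)"
  shows "\<exists>s t. 0 < s \<and> s < h \<and> 0 < t \<and> t < h \<and>
    f (of_real h * a + of_real h * b + w) - f (of_real h * a + w) - f (of_real h * b + w) + f w
      = h * h * f'' (of_real s * a + of_real t * b + w) b"
proof -
  \<comment> \<open>The factor \<open>of_real 0\<close> gives both terms the same form, so that one
    derivative rule serves for each.\<close>
  define \<phi> where "\<phi> = (\<lambda>s. f (of_real s * a + of_real h * b + w) - f (of_real s * a + of_real 0 * b + w))"
  have lin: "((\<lambda>s. of_real s * a + c) has_derivative (\<lambda>s. of_real s * a)) (at s)" for s and c :: complex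
    by (auto intro!: derivative_eq_intros)
  have lin2: "((\<lambda>t. c + of_real t * b + w) has_derivative (\<lambda>t. of_real t * b)) (at t)" for t and c :: complex
    by (auto intro!: derivative_eq_intros)
  have f1: "((\<lambda>s. f (of_real s * a + of_real t * b + w)) has_derivative (\<lambda>x. f' (of_real s * a + of_real t * b + w) (of_real x * a))) (at s)"
    if "0 \<le> s" "s \<le> h" "0 \<le> t" "t \<le> h" for s t
    using has_derivative_compose[OF lin[of "of_real t * b + w" s] f[OF r(2)[OF that], unfolded add.assoc]] by (simp add: add.assoc)
  have f'r: "f' z (of_real x * c) = x * f' z c" if "z \<in> B" for z x c
    using has_derivative_bounded_linear[OF f[OF that]] linear_scale[of "f' z" x c] by (simp add: bounded_linear.linear scaleR_conv_of_real)
  have f''r: "f'' z (of_real x * c) = x * f'' z c" if "z \<in> B" for z x c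
    using has_derivative_bounded_linear[OF fa[OF that]] linear_scale[of "f'' z" x c] by (simp add: bounded_linear.linear scaleR_conv_of_real)
  have d\<phi>: "(\<phi> has_real_derivative f' (of_real s * a + of_real h * b + w) a - f' (of_real s * a + of_real 0 * b + w) a) (at s)"
    if "0 \<le> s" "s \<le> h" for s
    unfolding has_field_derivative_def \<phi>_def
  proof (rule has_derivative_eq_rhs[OF has_derivative_diff[OF f1 f1]], goal_cases)
    case 9
    have "0 \<le> h" "h \<le> h" "0 \<le> (0::real)"
      using r(1) by auto
    then show ?case
      unfolding fun_eq_iff f'r[OF r(2)[OF that \<open>0 \<le> h\<close> \<open>h \<le> h\<close>]] f'r[OF r(2)[OF that \<open>0 \<le> (0::real)\<close> \<open>0 \<le> h\<close>]]
      by - (intro allI, rule trans[OF right_diff_distrib[symmetric] mult.commute])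
  qed (use that r(1) in auto)
  obtain s where s: "0 < s" "s < h" "\<phi> h - \<phi> 0 = (h - 0) * (f' (of_real s * a + of_real h * b + w) a - f' (of_real s * a + of_real 0 * b + w) a)"
    using MVT2[of 0 h \<phi>, OF r(1) d\<phi>] by auto
  have dt: "((\<lambda>t. f' (of_real s * a + of_real t * b + w) a) has_real_derivative f'' (of_real s * a + of_real t * b + w) b) (at t)"
    if "0 \<le> t" "t \<le> h" for t
    unfolding has_field_derivative_def
  proof (rule has_derivative_eq_rhs[OF has_derivative_compose[OF lin2 fa]])
    have B: "of_real s * a + of_real t * b + w \<in> B"
      using that s by (intro r(2)) auto
    then show "of_real s * a + of_real t * b + w \<in> B" .
    show "(\<lambda>x. f'' (of_real s * a + of_real t * b + w) (of_real x * b)) = (*) (f'' (of_real s * a + of_real t * b + w) b)"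
      unfolding fun_eq_iff f''r[OF B] by (simp only: mult.commute simp_thms)
  qed
  obtain t where t: "0 < t" "t < h" "f' (of_real s * a + of_real h * b + w) a - f' (of_real s * a + of_real 0 * b + w) a
      = (h - 0) * f'' (of_real s * a + of_real t * b + w) b"
    using MVT2[OF r(1) dt] by auto
  show ?thesis
  proof (rule exI[of _ s], rule exI[of _ t], intro conjI)
    have "\<phi> h - \<phi> 0 = h * h * f'' (of_real s * a + of_real t * b + w) b"
      unfolding s(3) t(3) by simp
    then show "f (of_real h * a + of_real h * b + w) - f (of_real h * a + w) - f (of_real h * b + w) + f w
      = h * h * f'' (of_real s * a + of_real t * b + w) b"
      by (simp add: \<phi>_def)
  qed (use s t in auto)
qed

text \<open>The second difference over a square is symmetric in the two directions. So the two mixed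
  derivatives agree when taken at two suitable points of the square, and continuity carries this to
  the corner.\<close>

lemma mixed_partials_real:
  fixes f :: "complex \<Rightarrow> real"
  assumes U: "open U" "w \<in> U" and f: "Ck_on 2 U f"
  shows "d_x (d_y f) w = d_y (d_x f) w"
proof (rule ccontr)
  assume ne: "d_x (d_y f) w \<noteq> d_y (d_x f) w"
  have f1: "Ck_on (Suc 1) U f" "Ck_on (Suc 0) U (d_x f)" "Ck_on (Suc 0) U (d_y f)"
    using f by (simp_all add: numeral_2_eq_2)
  \<comment> \<open>Half the gap: two errors smaller than \<open>e\<close> cannot bridge it.\<close>
  define e where "e = \<bar>d_x (d_y f) w - d_y (d_x f) w\<bar> / 2"
  have "e > 0"
    using ne by (simp add: e_def)
  have "isCont (d_x (d_y f)) w" "isCont (d_y (d_x f)) w"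
    using f1 U by (auto simp: continuous_on_eq_continuous_at)
  then have "\<forall>\<^sub>F z in at w. dist (d_x (d_y f) z) (d_x (d_y f) w) < e" "\<forall>\<^sub>F z in at w. dist (d_y (d_x f) z) (d_y (d_x f) w) < e"
    using \<open>e > 0\<close> by (auto simp: isCont_def tendsto_iff)
  then have "\<forall>\<^sub>F z in at w. dist (d_x (d_y f) z) (d_x (d_y f) w) < e \<and> dist (d_y (d_x f) z) (d_y (d_x f) w) < e \<and> z \<in> U"
    using U by (auto simp: eventually_conj_iff eventually_at_in_open')
  then obtain d where d: "d > 0" "\<And>z. z \<noteq> w \<Longrightarrow> dist z w < d \<Longrightarrow>
      dist (d_x (d_y f) z) (d_x (d_y f) w) < e \<and> dist (d_y (d_x f) z) (d_y (d_x f) w) < e \<and> z \<in> U"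
    unfolding eventually_at by auto
  \<comment> \<open>A point of the square has distance at most 2h from \<open>w\<close>, which must
    stay below \<open>d\<close>.\<close>
  define h where "h = d / 3"
  have h: "h > 0"
    using d by (simp add: h_def)
  have near: "dist (of_real s * 1 + of_real t * \<i> + w) w < d" if "0 \<le> s" "s \<le> h" "0 \<le> t" "t \<le> h" for s t
  proof -
    have "norm (of_real s + of_real t * \<i>) \<le> s + t"
      by (rule order_trans[OF norm_triangle_ineq]) (use that in \<open>simp add: norm_mult\<close>)
    also have "\<dots> < d"
      using that d(1) by (simp add: h_def)
    finally show ?thesis
      by (simp add: dist_norm)
  qed
  have nearU: "of_real s * 1 + of_real t * \<i> + w \<in> U" if "0 \<le> s" "s \<le> h" "0 \<le> t" "t \<le> h" for s t
    using d(2)[OF _ near[OF that]] U(2) by metis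
  have D: "(f has_derivative (\<lambda>h. Re h *\<^sub>R d_x f z + Im h *\<^sub>R d_y f z)) (at z)" if "z \<in> U" for z
    by (rule Ck_on_imp_has_derivative[OF U(1) f1(1) that])
  have Dx: "((\<lambda>z. Re 1 *\<^sub>R d_x f z + Im 1 *\<^sub>R d_y f z) has_derivative (\<lambda>h. Re h *\<^sub>R d_x (d_x f) z + Im h *\<^sub>R d_y (d_x f) z)) (at z)" if "z \<in> U" for z
    using Ck_on_imp_has_derivative[OF U(1) f1(2) that] by simp
  have Dy: "((\<lambda>z. Re \<i> *\<^sub>R d_x f z + Im \<i> *\<^sub>R d_y f z) has_derivative (\<lambda>h. Re h *\<^sub>R d_x (d_y f) z + Im h *\<^sub>R d_y (d_y f) z)) (at z)" if "z \<in> U" for z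
    using Ck_on_imp_has_derivative[OF U(1) f1(3) that] by simp
  obtain s t where st: "0 < s" "s < h" "0 < t" "t < h"
     "f (of_real h * 1 + of_real h * \<i> + w) - f (of_real h * 1 + w) - f (of_real h * \<i> + w) + f w
      = h * h * d_y (d_x f) (of_real s * 1 + of_real t * \<i> + w)"
    using mixed_difference_mean_value[where f = f and a = 1 and b = \<i>, OF h nearU D Dx] by auto
  have nearU': "of_real s * \<i> + of_real t * 1 + w \<in> U" if "0 \<le> s" "s \<le> h" "0 \<le> t" "t \<le> h" for s t
    using nearU[of t s] that by (simp add: add.commute)
  obtain s' t' where st': "0 < s'" "s' < h" "0 < t'" "t' < h"
     "f (of_real h * \<i> + of_real h * 1 + w) - f (of_real h * \<i> + w) - f (of_real h * 1 + w) + f w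
      = h * h * d_x (d_y f) (of_real s' * \<i> + of_real t' * 1 + w)"
    using mixed_difference_mean_value[where f = f and a = \<i> and b = 1, OF h nearU' D Dy] by auto
  have "h * h * d_y (d_x f) (of_real s * 1 + of_real t * \<i> + w) = h * h * d_x (d_y f) (of_real t' * 1 + of_real s' * \<i> + w)"
    using st(5) st'(5)[unfolded add.commute[of "of_real _ * \<i>" "of_real _ * 1"]] by linarith
  then have eq: "d_y (d_x f) (of_real s * 1 + of_real t * \<i> + w) = d_x (d_y f) (of_real t' * 1 + of_real s' * \<i> + w)"
    using h by simp
  \<comment> \<open>The estimates hold on a punctured neighbourhood, so the intermediate points have
    to differ from \<open>w\<close>.\<close>
  have ne': "of_real s * 1 + of_real t * \<i> + w \<noteq> w" if "s > 0" for s t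
    using that by (auto simp: complex_eq_iff)
  let ?P = "d_x (d_y f) (of_real t' * 1 + of_real s' * \<i> + w)"
  have "dist ?P (d_y (d_x f) w) < e"
    using d(2)[OF ne'[OF st(1)] near, of t] st unfolding eq[symmetric] by simp
  moreover have "dist ?P (d_x (d_y f) w) < e"
    using d(2)[OF ne'[OF st'(3)] near] st' by simp
  moreover have "dist (d_x (d_y f) w) (d_y (d_x f) w) \<le> dist ?P (d_x (d_y f) w) + dist ?P (d_y (d_x f) w)"
    by (rule dist_triangle3)
  moreover have "dist (d_x (d_y f) w) (d_y (d_x f) w) = 2 * e"
    by (simp add: e_def dist_real_def)
  ultimately show False
    by simp
qed

lemma d_xy_linear:
  assumes "bounded_linear b" "f differentiable (at w)"
  shows "d_x (\<lambda>w. b (f w)) w = b (d_x f w)" "d_y (\<lambda>w. b (f w)) w = b (d_y f w)"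
    "(\<lambda>w. b (f w)) differentiable (at w)"
proof -
  note d = bounded_linear.has_derivative[OF assms(1) differentiable_has_derivative_d_xy[OF assms(2)]]
  show "d_x (\<lambda>w. b (f w)) w = b (d_x f w)" "d_y (\<lambda>w. b (f w)) w = b (d_y f w)"
    using has_derivative_d_xy(1,2)[OF d] by simp_all
  show "(\<lambda>w. b (f w)) differentiable (at w)"
    using d by (auto simp: differentiable_def)
qed

lemma d_xy_bilinear:
  assumes "bounded_bilinear b" "f differentiable (at w)" "g differentiable (at w)"
  shows "d_x (\<lambda>w. b (f w) (g w)) w = b (f w) (d_x g w) + b (d_x f w) (g w)"
    "d_y (\<lambda>w. b (f w) (g w)) w = b (f w) (d_y g w) + b (d_y f w) (g w)"
    "(\<lambda>w. b (f w) (g w)) differentiable (at w)"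
proof -
  note d = bounded_bilinear.FDERIV[OF assms(1) differentiable_has_derivative_d_xy[OF assms(2)]
    differentiable_has_derivative_d_xy[OF assms(3)]]
  show "d_x (\<lambda>w. b (f w) (g w)) w = b (f w) (d_x g w) + b (d_x f w) (g w)"
    "d_y (\<lambda>w. b (f w) (g w)) w = b (f w) (d_y g w) + b (d_y f w) (g w)"
    using has_derivative_d_xy(1,2)[OF d] by simp_all
  show "(\<lambda>w. b (f w) (g w)) differentiable (at w)"
    using d by (auto simp: differentiable_def)
qed

lemma d_xy_add:
  assumes "f differentiable (at w)" "g differentiable (at w)"
  shows "d_x (\<lambda>w. f w + g w) w = d_x f w + d_x g w" "d_y (\<lambda>w. f w + g w) w = d_y f w + d_y g w"
    "(\<lambda>w. f w + g w) differentiable (at w)"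
proof -
  note d = has_derivative_add[OF differentiable_has_derivative_d_xy[OF assms(1)]
    differentiable_has_derivative_d_xy[OF assms(2)]]
  show "d_x (\<lambda>w. f w + g w) w = d_x f w + d_x g w" "d_y (\<lambda>w. f w + g w) w = d_y f w + d_y g w"
    using has_derivative_d_xy(1,2)[OF d] by simp_all
  show "(\<lambda>w. f w + g w) differentiable (at w)"
    using d by (auto simp: differentiable_def)
qed

lemma d_xy_compose:
  fixes \<tau> :: "complex \<Rightarrow> complex"
  assumes "\<tau> differentiable (at w)" "f differentiable (at (\<tau> w))"
  shows "d_x (\<lambda>w. f (\<tau> w)) w = Re (d_x \<tau> w) *\<^sub>R d_x f (\<tau> w) + Im (d_x \<tau> w) *\<^sub>R d_y f (\<tau> w)"
    "d_y (\<lambda>w. f (\<tau> w)) w = Re (d_y \<tau> w) *\<^sub>R d_x f (\<tau> w) + Im (d_y \<tau> w) *\<^sub>R d_y f (\<tau> w)"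
    "(\<lambda>w. f (\<tau> w)) differentiable (at w)"
proof -
  note d = has_derivative_compose[OF differentiable_has_derivative_d_xy[OF assms(1)]
    differentiable_has_derivative_d_xy[OF assms(2)]]
  show "d_x (\<lambda>w. f (\<tau> w)) w = Re (d_x \<tau> w) *\<^sub>R d_x f (\<tau> w) + Im (d_x \<tau> w) *\<^sub>R d_y f (\<tau> w)"
    "d_y (\<lambda>w. f (\<tau> w)) w = Re (d_y \<tau> w) *\<^sub>R d_x f (\<tau> w) + Im (d_y \<tau> w) *\<^sub>R d_y f (\<tau> w)"
    using has_derivative_d_xy(1,2)[OF d] by simp_all
  show "(\<lambda>w. f (\<tau> w)) differentiable (at w)"
    using d by (auto simp: differentiable_def)
qed

lemma mixed_partials:
  fixes f :: "complex \<Rightarrow> 'b::euclidean_space"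
  assumes U: "open U" "w \<in> U" and f: "Ck_on 2 U f"
  shows "d_x (d_y f) w = d_y (d_x f) w"
proof (rule euclidean_eqI)
  fix b :: 'b
  let ?b = "\<lambda>v. v \<bullet> b"
  have bl: "bounded_linear ?b"
    by (rule bounded_linear_inner_left)
  have f1: "Ck_on (Suc 1) U f" "Ck_on (Suc 0) U (d_x f)" "Ck_on (Suc 0) U (d_y f)"
    using f by (simp_all add: numeral_2_eq_2)
  have D: "g differentiable (at z)" if "Ck_on (Suc k) U g" "z \<in> U" for g :: "complex \<Rightarrow> 'b" and z k
    using Ck_on_imp_has_derivative[OF U(1) that] by (auto simp: differentiable_def)
  have "d_x (d_y (\<lambda>z. ?b (f z))) w = d_x (\<lambda>z. ?b (d_y f z)) w"
    by (rule d_xy_cong(1)[OF U]) (rule d_xy_linear(2)[OF bl D[OF f1(1)]])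
  also have "\<dots> = ?b (d_x (d_y f) w)"
    by (rule d_xy_linear(1)[OF bl D[OF f1(3) U(2)]])
  finally have 1: "d_x (d_y (\<lambda>z. ?b (f z))) w = ?b (d_x (d_y f) w)" .
  have "d_y (d_x (\<lambda>z. ?b (f z))) w = d_y (\<lambda>z. ?b (d_x f z)) w"
    by (rule d_xy_cong(2)[OF U]) (rule d_xy_linear(1)[OF bl D[OF f1(1)]])
  also have "\<dots> = ?b (d_y (d_x f) w)"
    by (rule d_xy_linear(2)[OF bl D[OF f1(2) U(2)]])
  finally have 2: "d_y (d_x (\<lambda>z. ?b (f z))) w = ?b (d_y (d_x f) w)" .
  show "d_x (d_y f) w \<bullet> b = d_y (d_x f) w \<bullet> b"
    using mixed_partials_real[OF U Ck_on_linear[OF bl U(1) f]] unfolding 1 2 .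
qed

subsection \<open>Derivatives in a chart\<close>

lemma bounded_bilinear_mink_real: "bounded_bilinear (mink :: real^5 \<Rightarrow> real^5 \<Rightarrow> real)"
  unfolding bilinear_conv_bounded_bilinear[symmetric] bilinear_def
  by (auto intro!: linearI simp: mink_def algebra_simps)

lemma bounded_bilinear_mink: "bounded_bilinear (mink :: complex^5 \<Rightarrow> complex^5 \<Rightarrow> complex)"
  unfolding bilinear_conv_bounded_bilinear[symmetric] bilinear_def
  by (auto intro!: linearI simp: mink_def algebra_simps scaleR_conv_of_real[where 'a = complex])

lemma bounded_bilinear_smult: "bounded_bilinear ((*s) :: complex \<Rightarrow> complex^5 \<Rightarrow> complex^5)"
  unfolding bilinear_conv_bounded_bilinear[symmetric] bilinear_def
  by (auto intro!: linearI simp: vec_eq_iff algebra_simps scaleR_conv_of_real[where 'a = complex])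

lemma bounded_linear_smult: "bounded_linear ((*s) k :: complex^5 \<Rightarrow> complex^5)"
  by (rule bounded_bilinear.bounded_linear_right[OF bounded_bilinear_smult])

lemma bounded_linear_cplx: "bounded_linear cplx"
  unfolding linear_conv_bounded_linear[symmetric]
  by (auto intro!: linearI simp: vec_eq_iff cplx_def scaleR_conv_of_real[where 'a = complex])

lemma bounded_linear_conjv: "bounded_linear conjv"
  unfolding linear_conv_bounded_linear[symmetric]
  by (auto intro!: linearI simp: vec_eq_iff conjv_def)

lemma in_coord_at: "is_chart c \<Longrightarrow> x \<in> fst c \<Longrightarrow> in_coord c f (snd c x) = f x"
  unfolding is_chart_def homeomorphism_def in_coord_def by simp

lemma open_chart_image:
  assumes "is_chart c" "open W"
  shows "open (snd c ` (fst c \<inter> W))"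
proof -
  have h: "homeomorphism (fst c) (snd c ` fst c) (snd c) (inv_into (fst c) (snd c))" and o: "open (snd c ` fst c)"
    using assms(1) by (auto simp: is_chart_def)
  have "snd c ` (fst c \<inter> W) = snd c ` fst c \<inter> inv_into (fst c) (snd c) -` W"
    using h unfolding homeomorphism_def by force
  also have "open \<dots>"
    using h o assms(2) by (intro continuous_open_preimage) (auto simp: homeomorphism_def)
  finally show ?thesis .
qed

abbreviation chart_dx :: "'m chart \<Rightarrow> ('m \<Rightarrow> 'b::real_normed_vector) \<Rightarrow> 'm \<Rightarrow> 'b" where
  "chart_dx c f x \<equiv> d_x (in_coord c f) (snd c x)"

abbreviation chart_dy :: "'m chart \<Rightarrow> ('m \<Rightarrow> 'b::real_normed_vector) \<Rightarrow> 'm \<Rightarrow> 'b" where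
  "chart_dy c f x \<equiv> d_y (in_coord c f) (snd c x)"

definition cdiff :: "'m chart \<Rightarrow> 'm \<Rightarrow> ('m \<Rightarrow> 'b::real_normed_vector) \<Rightarrow> bool" where
  "cdiff c x f \<longleftrightarrow> in_coord c f differentiable (at (snd c x))"

text \<open>\<open>e = - \<i>\<close> gives \<open>\<partial>/\<partial>z\<close> and \<open>e = \<i>\<close> gives \<open>\<partial>/\<partial>zbar\<close>.\<close>

definition wirt :: "complex \<Rightarrow> 'm chart \<Rightarrow> ('m \<Rightarrow> complex^5) \<Rightarrow> 'm \<Rightarrow> complex^5" where
  "wirt e c f x = (1/2) *s (chart_dx c f x + e *s chart_dy c f x)"

definition wirts :: "complex \<Rightarrow> 'm chart \<Rightarrow> ('m \<Rightarrow> complex) \<Rightarrow> 'm \<Rightarrow> complex" where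
  "wirts e c h x = (1/2) * (chart_dx c h x + e * chart_dy c h x)"

lemma dz_wirt: "dz = wirt (-\<i>)" "dzbar = wirt \<i>"
  by (simp_all add: fun_eq_iff dz_def dzbar_def wirt_def vec_eq_iff)

lemma in_coord_apply: "in_coord c (\<lambda>y. F (f y) (g y)) = (\<lambda>w. F (in_coord c f w) (in_coord c g w))"
  "in_coord c (\<lambda>y. G (f y)) = (\<lambda>w. G (in_coord c f w))" "in_coord c (\<lambda>y. k) = (\<lambda>w. k)"
  by (simp_all add: in_coord_def fun_eq_iff)

lemma chart_cong:
  assumes c: "is_chart c" and W: "open W" "x \<in> W" "x \<in> fst c" and fg: "\<And>y. y \<in> W \<Longrightarrow> y \<in> fst c \<Longrightarrow> f y = g y"
  shows "chart_dx c f x = chart_dx c g x"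
    "chart_dy c f x = chart_dy c g x"
    "cdiff c x f \<longleftrightarrow> cdiff c x g"
proof -
  have x: "snd c x \<in> snd c ` (fst c \<inter> W)"
    using W by blast
  have eq: "in_coord c f w = in_coord c g w" if "w \<in> snd c ` (fst c \<inter> W)" for w
    using that fg by (auto simp: in_coord_at[OF c])
  show "chart_dx c f x = chart_dx c g x"
    by (rule d_xy_cong(1)[OF open_chart_image[OF c W(1)] x eq])
  show "chart_dy c f x = chart_dy c g x"
    by (rule d_xy_cong(2)[OF open_chart_image[OF c W(1)] x eq])
  show "cdiff c x f \<longleftrightarrow> cdiff c x g"
    unfolding cdiff_def by (rule d_xy_cong(3)[OF open_chart_image[OF c W(1)] x eq])
qed

lemma wirt_cong:
  assumes "is_chart c" "open W" "x \<in> W" "x \<in> fst c" "\<And>y. y \<in> W \<Longrightarrow> y \<in> fst c \<Longrightarrow> f y = g y"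
  shows "wirt e c f x = wirt e c g x"
  using chart_cong[OF assms] by (simp add: wirt_def)

lemma cdiff_add: "cdiff c x f \<Longrightarrow> cdiff c x g \<Longrightarrow> cdiff c x (\<lambda>y. f y + g y)"
  unfolding cdiff_def in_coord_apply by (rule d_xy_add(3))

lemma cdiff_bilinear:
  "bounded_bilinear b \<Longrightarrow> cdiff c x f \<Longrightarrow> cdiff c x g \<Longrightarrow> cdiff c x (\<lambda>y. b (f y) (g y))"
  unfolding cdiff_def in_coord_apply by (rule d_xy_bilinear(3))

lemma cdiff_linear: "bounded_linear b \<Longrightarrow> cdiff c x f \<Longrightarrow> cdiff c x (\<lambda>y. b (f y))"
  unfolding cdiff_def in_coord_apply by (rule d_xy_linear(3))

lemma cdiff_const: "cdiff c x (\<lambda>y. k)"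
  by (simp add: cdiff_def in_coord_apply)

lemma wirt_add:
  assumes "cdiff c x f" "cdiff c x g"
  shows "wirt e c (\<lambda>y. f y + g y) x = wirt e c f x + wirt e c g x"
  unfolding wirt_def in_coord_apply(1) d_xy_add[OF assms[unfolded cdiff_def]] by (simp add: vec_eq_iff algebra_simps)

lemma wirt_scale:
  assumes c: "is_chart c" "x \<in> fst c" and fh: "cdiff c x h" "cdiff c x f"
  shows "wirt e c (\<lambda>y. h y *s f y) x = wirts e c h x *s f x + h x *s wirt e c f x"
  unfolding wirt_def wirts_def in_coord_apply d_xy_bilinear[OF bounded_bilinear_smult fh[unfolded cdiff_def]] in_coord_at[OF c]
  by (simp add: vec_eq_iff algebra_simps)

lemma wirts_mink:
  assumes c: "is_chart c" "x \<in> fst c" and fg: "cdiff c x f" "cdiff c x g"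
  shows "wirts e c (\<lambda>y. mink (f y) (g y)) x = mink (wirt e c f x) (g x) + mink (f x) (wirt e c g x)"
  unfolding wirt_def wirts_def in_coord_apply d_xy_bilinear[OF bounded_bilinear_mink fg[unfolded cdiff_def]] in_coord_at[OF c]
  by (simp add: mink_simps algebra_simps)

lemma wirts_const: "wirts e c (\<lambda>y. k) x = 0"
  by (simp add: wirts_def in_coord_apply d_x_def d_y_def)

lemma wirt_const: "wirt e c (\<lambda>y. k) x = 0"
  by (simp add: wirt_def in_coord_apply d_x_def d_y_def)

lemma chart_derivation:
  assumes c: "is_chart c" and W: "open W" "x \<in> W" "x \<in> fst c"
  shows "derivation_at x W (cdiff c x) (cdiff c x) (\<lambda>h. wirts e c h x)"
proof
  show "wirts e c h x = wirts e c h' x" if "\<And>y. y \<in> W \<Longrightarrow> h y = h' y" for h h'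
    using chart_cong(1,2)[OF c W, of h h'] that by (simp add: wirts_def)
qed (use W in \<open>simp_all add: wirts_const cdiff_const cdiff_add cdiff_bilinear[OF bounded_bilinear_smult]
    cdiff_bilinear[OF bounded_bilinear_mink]\<close>)

lemma chart_metric_conn:
  assumes c: "is_chart c" and W: "open W" "x \<in> W" "x \<in> fst c"
  shows "derivation_at.metric_conn x W (cdiff c x) (cdiff c x) (\<lambda>h. wirts e c h x) (\<lambda>f. wirt e c f x)"
  unfolding derivation_at.metric_conn_def[OF chart_derivation[OF assms]]
proof (intro conjI allI impI)
  show "wirt e c f x = wirt e c g x" if "\<forall>y\<in>W. f y = g y" for f g
    by (rule wirt_cong[OF c W]) (use that in auto)
qed (simp_all add: wirt_add wirt_scale[OF c W(3)] wirts_mink[OF c W(3)])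

lemma wirt_conj:
  assumes "cdiff c x f"
  shows "wirt (cnj e) c (\<lambda>y. conjv (f y)) x = conjv (wirt e c f x)"
  unfolding wirt_def in_coord_apply d_xy_linear[OF bounded_linear_conjv assms[unfolded cdiff_def]]
  by (simp add: conjv_scale conjv_add)

lemma wirt_conj_ii:
  assumes "cdiff c x f"
  shows "wirt (-\<i>) c (\<lambda>y. conjv (f y)) x = conjv (wirt \<i> c f x)" "wirt \<i> c (\<lambda>y. conjv (f y)) x = conjv (wirt (-\<i>) c f x)"
  using wirt_conj[OF assms, of \<i>] wirt_conj[OF assms, of "-\<i>"] by simp_all

section \<open>Smooth functions in a chart\<close>

definition csmooth :: "'m::topological_space chart \<Rightarrow> 'm set \<Rightarrow> ('m \<Rightarrow> 'b::real_normed_vector) \<Rightarrow> bool" where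
  "csmooth c W f \<longleftrightarrow> open W \<and> W \<subseteq> fst c \<and> smooth_on (snd c ` W) (in_coord c f)"

lemma csmooth_cdiff:
  assumes c: "is_chart c" and f: "csmooth c W f" "x \<in> W"
  shows "cdiff c x f"
proof -
  have o: "open (snd c ` W)"
    using open_chart_image[OF c, of W] f by (auto simp: csmooth_def inf.absorb2)
  have "Ck_on (Suc 0) (snd c ` W) (in_coord c f)"
    using f unfolding csmooth_def smooth_on_def by blast
  from Ck_on_imp_has_derivative[OF o this imageI[OF f(2)]] show ?thesis
    by (auto simp: cdiff_def differentiable_def)
qed

lemma csmooth_linear:
  assumes c: "is_chart c" and f: "csmooth c W f" and b: "bounded_linear b"
  shows "csmooth c W (\<lambda>y. b (f y))"
proof -
  have o: "open (snd c ` W)"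
    using open_chart_image[OF c, of W] f by (auto simp: csmooth_def inf.absorb2)
  then show ?thesis
    using f Ck_on_linear[OF b o] by (simp add: csmooth_def smooth_on_def in_coord_apply)
qed

lemma csmooth_wirt:
  assumes c: "is_chart c" and f: "csmooth c W f"
  shows "csmooth c W (wirt e c f)"
proof -
  have o: "open (snd c ` W)" and W: "W \<subseteq> fst c"
    using open_chart_image[OF c, of W] f by (auto simp: csmooth_def inf.absorb2)
  have "Ck_on k (snd c ` W) (in_coord c (wirt e c f))" for k
  proof -
    have "Ck_on (Suc k) (snd c ` W) (in_coord c f)"
      using f unfolding csmooth_def smooth_on_def by blast
    then have "Ck_on k (snd c ` W) (\<lambda>w. (1/2) *s (d_x (in_coord c f) w + e *s d_y (in_coord c f) w))"
      by (intro Ck_on_linear[OF bounded_linear_smult o] Ck_on_add[OF o]) auto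
    also have "?this \<longleftrightarrow> ?thesis"
    proof (rule Ck_on_cong[OF o])
      fix w assume "w \<in> snd c ` W"
      then obtain y where y: "w = snd c y" "y \<in> fst c"
        using W by blast
      show "(1/2) *s (d_x (in_coord c f) w + e *s d_y (in_coord c f) w) = in_coord c (wirt e c f) w"
        unfolding y(1) in_coord_at[OF c y(2)] by (simp add: wirt_def)
    qed
    finally show ?thesis .
  qed
  then show ?thesis
    using f by (simp add: csmooth_def smooth_on_def)
qed

text \<open>As the mixed partials agree, both sides are a quarter of the Laplacian.\<close>

lemma csmooth_mixed:
  assumes c: "is_chart c" and f: "csmooth c W f" "x \<in> W"
  shows "wirt (-\<i>) c (wirt \<i> c f) x = wirt \<i> c (wirt (-\<i>) c f) x"
proof -
  have o: "open (snd c ` W)" and W: "W \<subseteq> fst c" and Ck: "Ck_on k (snd c ` W) (in_coord c f)" for k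
    using open_chart_image[OF c, of W] f by (auto simp: csmooth_def inf.absorb2 smooth_on_def)
  let ?w = "snd c x"
  let ?F = "in_coord c f"
  have w: "?w \<in> snd c ` W"
    using f(2) by blast
  have Ck1: "Ck_on (Suc 0) (snd c ` W) (d_x ?F)" "Ck_on (Suc 0) (snd c ` W) (d_y ?F)"
    using Ck[of "Suc (Suc 0)"] by simp_all
  have dd: "d_x ?F differentiable (at ?w)" "d_y ?F differentiable (at ?w)"
    using Ck_on_imp_has_derivative[OF o Ck1(1) w] Ck_on_imp_has_derivative[OF o Ck1(2) w] by (auto simp: differentiable_def)
  have eq: "in_coord c (wirt e c f) z = (1/2) *s (d_x ?F z + e *s d_y ?F z)" if "z \<in> snd c ` W" for e z
    using that W in_coord_at[OF c, of _ "wirt e c f"] by (auto simp: wirt_def)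
  have d2: "(\<lambda>z. e *s d_y ?F z) differentiable (at ?w)" for e
    by (rule d_xy_linear(3)[OF bounded_linear_smult dd(2)])
  have dx: "d_x (in_coord c (wirt e c f)) ?w = (1/2) *s (d_x (d_x ?F) ?w + e *s d_x (d_y ?F) ?w)" for e
  proof -
    have "d_x (in_coord c (wirt e c f)) ?w = d_x (\<lambda>z. (1/2) *s (d_x ?F z + e *s d_y ?F z)) ?w"
      by (rule d_xy_cong(1)[OF o w eq])
    also have "\<dots> = (1/2) *s (d_x (d_x ?F) ?w + e *s d_x (d_y ?F) ?w)"
      by (simp only: d_xy_linear(1)[OF bounded_linear_smult d_xy_add(3)[OF dd(1) d2]]
        d_xy_add(1)[OF dd(1) d2] d_xy_linear(1)[OF bounded_linear_smult dd(2)])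
    finally show ?thesis .
  qed
  have dy: "d_y (in_coord c (wirt e c f)) ?w = (1/2) *s (d_y (d_x ?F) ?w + e *s d_y (d_y ?F) ?w)" for e
  proof -
    have "d_y (in_coord c (wirt e c f)) ?w = d_y (\<lambda>z. (1/2) *s (d_x ?F z + e *s d_y ?F z)) ?w"
      by (rule d_xy_cong(2)[OF o w eq])
    also have "\<dots> = (1/2) *s (d_y (d_x ?F) ?w + e *s d_y (d_y ?F) ?w)"
      by (simp only: d_xy_linear(2)[OF bounded_linear_smult d_xy_add(3)[OF dd(1) d2]]
        d_xy_add(2)[OF dd(1) d2] d_xy_linear(2)[OF bounded_linear_smult dd(2)])
    finally show ?thesis .
  qed
  show ?thesis
    unfolding wirt_def[of _ c "wirt _ c f"] dx dy mixed_partials[OF o w Ck]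
    by (simp add: vec_eq_iff algebra_simps)
qed

text \<open>Smoothness is defined by the charts of the atlas, whereas a holomorphic chart is merely
  compatible with them; near each point \<open>f\<close> is composed with a transition map.\<close>

lemma smooth_map_chart:
  assumes M: "oriented_surface M" and c: "oriented_chart M c" and W: "open W" "W \<subseteq> pts M" and f: "smooth_map M W f"
  shows "csmooth c (fst c \<inter> W) f"
proof -
  have ch: "is_chart c"
    using c by (simp add: oriented_chart_def)
  have "Ck_on k (snd c ` (fst c \<inter> W)) (in_coord c f)" for k
  proof (rule Ck_on_local)
    fix w assume "w \<in> snd c ` (fst c \<inter> W)"
    then obtain y where y: "w = snd c y" "y \<in> fst c" "y \<in> W"
      by blast
    then obtain c' where c': "c' \<in> M" "y \<in> fst c'"
      using W unfolding pts_def by blast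
    have ch': "is_chart c'" and comp: "compatible c c'"
      using M c c' unfolding oriented_surface_def oriented_chart_def by blast+
    have oc': "open (fst c')"
      using ch' by (simp add: is_chart_def)
    define V where "V = snd c ` (fst c \<inter> (fst c' \<inter> W))"
    have V: "open V"
      unfolding V_def by (rule open_chart_image[OF ch]) (rule open_Int[OF oc' W(1)])
    have V': "open (snd c' ` (fst c' \<inter> W))"
      by (rule open_chart_image[OF ch' W(1)])
    define \<tau> where "\<tau> = in_coord c (snd c')"
    have \<tau>: "\<tau> z \<in> snd c' ` (fst c' \<inter> W) \<and> in_coord c f z = in_coord c' f (\<tau> z)" if "z \<in> V" for z
    proof -
      obtain p where p: "z = snd c p" "p \<in> fst c" "p \<in> fst c'" "p \<in> W"
        using \<open>z \<in> V\<close> unfolding V_def by blast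
      have "\<tau> z = snd c' p"
        unfolding \<tau>_def p(1) by (rule in_coord_at[OF ch p(2)])
      then show ?thesis
        using p by (simp add: in_coord_at[OF ch] in_coord_at[OF ch'])
    qed
    have "Ck_on k (snd c ` (fst c \<inter> fst c')) \<tau>"
      using comp by (simp add: compatible_def \<tau>_def Let_def smooth_on_def)
    then have 1: "Ck_on k V \<tau>"
      by (rule Ck_on_subset) (unfold V_def, blast)
    have 2: "Ck_on k (snd c' ` (fst c' \<inter> W)) (in_coord c' f)"
      using f c'(1) unfolding smooth_map_def smooth_on_def by blast
    have sub: "\<tau> ` V \<subseteq> snd c' ` (fst c' \<inter> W)"
      using \<tau> by blast
    have "Ck_on k V (\<lambda>z. in_coord c' f (\<tau> z))"
      by (rule Ck_on_compose[OF V V' sub 1 2])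
    then have 3: "Ck_on k V (in_coord c f)"
      using Ck_on_cong[OF V, of "in_coord c f" "\<lambda>z. in_coord c' f (\<tau> z)" k] \<tau> by simp
    have "w \<in> V"
      using y c' unfolding V_def by blast
    then show "\<exists>V. open V \<and> w \<in> V \<and> Ck_on k V (in_coord c f)"
      using V 3 by blast
  qed
  then show ?thesis
    using ch W unfolding csmooth_def smooth_on_def is_chart_def by (simp add: open_Int)
qed

subsection \<open>Lifts and holomorphic charts\<close>

text \<open>Subtracting a multiple of \<open>s\<close> changes neither the norm of \<open>v\<close>
  nor the claim, and it can remove the timelike coordinate because that of \<open>s\<close> is
  non-zero. What remains is a sum of squares.\<close>

lemma lorentz_orth_null:
  fixes s v :: "real^5"
  assumes s: "mink s s = 0" "s \<noteq> 0" and v: "mink v s = 0"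
  shows "mink v v \<ge> 0" and "mink v v = 0 \<Longrightarrow> v \<in> vec.span {s}"
proof -
  have s5: "s$5 \<noteq> 0"
  proof
    assume "s$5 = 0"
    then have "s$1 * s$1 + s$2 * s$2 + s$3 * s$3 + s$4 * s$4 = 0"
      using s(1) by (simp add: mink_def)
    moreover have "s$1 * s$1 \<ge> 0" "s$2 * s$2 \<ge> 0" "s$3 * s$3 \<ge> 0" "s$4 * s$4 \<ge> 0"
      by simp_all
    ultimately have "s$1 * s$1 = 0" "s$2 * s$2 = 0" "s$3 * s$3 = 0" "s$4 * s$4 = 0"
      by linarith+
    then have "s $ i = 0" for i
      using exhaust_5[of i] \<open>s$5 = 0\<close> by auto
    then show False
      using s(2) by (simp add: vec_eq_iff)
  qed
  define k where "k = v$5 / s$5"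
  define w where "w = v - k *s s"
  have w5: "w$5 = 0"
    using s5 by (simp add: w_def k_def)
  have "mink w w = mink v v"
    using s(1) v by (simp add: w_def mink_simps mink_commute[of s v])
  then have vv: "mink v v = w$1 * w$1 + w$2 * w$2 + w$3 * w$3 + w$4 * w$4"
    using w5 by (simp add: mink_def)
  have nn: "w$1 * w$1 \<ge> 0" "w$2 * w$2 \<ge> 0" "w$3 * w$3 \<ge> 0" "w$4 * w$4 \<ge> 0"
    by simp_all
  show "mink v v \<ge> 0"
    unfolding vv using nn by linarith
  show "v \<in> vec.span {s}" if "mink v v = 0"
  proof -
    have "w$1 * w$1 = 0" "w$2 * w$2 = 0" "w$3 * w$3 = 0" "w$4 * w$4 = 0"
      using that nn unfolding vv by linarith+
    then have "w $ i = 0" for i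
      using exhaust_5[of i] w5 by auto
    then have "v = k *s s"
      by (simp add: w_def vec_eq_iff)
    then show ?thesis
      by (simp add: span_single_scale)
  qed
qed

lemma lift_onD:
  assumes "lift_on M E W \<sigma>"
  shows "open W" "W \<subseteq> pts M" "smooth_map M W \<sigma>" "\<And>x. x \<in> W \<Longrightarrow> \<sigma> x \<in> E x" "\<And>x. x \<in> W \<Longrightarrow> \<sigma> x \<noteq> 0"
  using assms unfolding lift_on_def section_on_def by blast+

lemma null_line_span:
  assumes "null_line l" "s \<in> l" "s \<noteq> 0"
  shows "l = vec.span {s}" "mink s s = 0"
proof -
  obtain s0 where s0: "s0 \<noteq> 0" "mink s0 s0 = 0" "l = vec.span {s0}"
    using assms(1) by (auto simp: null_line_def)
  then obtain k where k: "s = k *s s0"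
    using assms(2) by (auto simp: span_single)
  with assms(3) have "k \<noteq> 0"
    by auto
  then show "l = vec.span {s}"
    using vec.span_image_scale[of "{s0}" "\<lambda>_. k"] by (simp add: k s0(3))
  show "mink s s = 0"
    by (simp add: k mink_simps s0(2))
qed

section \<open>Changes of chart\<close>

abbreviation (input) chain_rule ::
    "'m chart \<Rightarrow> 'm chart \<Rightarrow> 'm \<Rightarrow> complex \<Rightarrow> complex \<Rightarrow> ('m \<Rightarrow> 'b::real_normed_vector) \<Rightarrow> bool" where
  "chain_rule c c' x p q f \<equiv> cdiff c x f \<and>
     chart_dx c f x = Re p *\<^sub>R chart_dx c' f x + Im p *\<^sub>R chart_dy c' f x \<and>
     chart_dy c f x = Re q *\<^sub>R chart_dx c' f x + Im q *\<^sub>R chart_dy c' f x"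

text \<open>\<open>p\<close> and \<open>q\<close> are the columns of the Jacobian matrix of the
  transition map, read as complex numbers.\<close>

lemma transition_derivatives:
  assumes c: "is_chart c" "is_chart c'" "compatible c c'" and x: "x \<in> fst c" "x \<in> fst c'"
  shows "\<exists>p q. Im (cnj p * q) > 0 \<and> (\<forall>f::'m::topological_space \<Rightarrow> 'b::real_normed_vector. cdiff c' x f \<longrightarrow> chain_rule c c' x p q f)"
proof -
  define \<tau> where "\<tau> = in_coord c (snd c')"
  define V where "V = snd c ` (fst c \<inter> fst c')"
  have V: "open V"
    unfolding V_def by (rule open_chart_image[OF c(1)]) (use c in \<open>simp add: is_chart_def\<close>)
  have w: "snd c x \<in> V"
    using x by (simp add: V_def)
  have \<tau>w: "\<tau> (snd c x) = snd c' x"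
    by (simp add: \<tau>_def in_coord_at[OF c(1) x(1)])
  have "smooth_on V \<tau>" and det: "Im (cnj (d_x \<tau> (snd c x)) * d_y \<tau> (snd c x)) > 0"
    using c(3) w unfolding compatible_def Let_def \<tau>_def V_def by blast+
  then have "Ck_on (Suc 0) V \<tau>"
    unfolding smooth_on_def by blast
  from Ck_on_imp_has_derivative[OF V this w] have \<tau>: "\<tau> differentiable (at (snd c x))"
    by (auto simp: differentiable_def)
  show ?thesis
  proof (rule exI[of _ "d_x \<tau> (snd c x)"], rule exI[of _ "d_y \<tau> (snd c x)"], intro conjI[OF det] allI impI)
    fix f :: "'m \<Rightarrow> 'b"
    assume f: "cdiff c' x f"
    have f': "in_coord c' f differentiable (at (\<tau> (snd c x)))"
      using f by (simp add: cdiff_def \<tau>w)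
    have eq: "in_coord c f z = in_coord c' f (\<tau> z)" if z: "z \<in> V" for z
    proof -
      obtain y where y: "z = snd c y" "y \<in> fst c" "y \<in> fst c'"
        using z unfolding V_def by blast
      have "\<tau> z = snd c' y"
        unfolding \<tau>_def y(1) by (rule in_coord_at[OF c(1) y(2)])
      then show ?thesis
        using y by (simp add: in_coord_at[OF c(1)] in_coord_at[OF c(2)])
    qed
    note co = d_xy_compose[OF \<tau> f']
    have cong: "chart_dx c f x = d_x (\<lambda>z. in_coord c' f (\<tau> z)) (snd c x)"
      "chart_dy c f x = d_y (\<lambda>z. in_coord c' f (\<tau> z)) (snd c x)"
      "in_coord c f differentiable (at (snd c x)) \<longleftrightarrow> (\<lambda>z. in_coord c' f (\<tau> z)) differentiable (at (snd c x))"
      by (rule d_xy_cong[OF V w eq]; assumption)+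
    show "chain_rule c c' x (d_x \<tau> (snd c x)) (d_y \<tau> (snd c x)) f"
      unfolding cdiff_def cong using co by (simp add: \<tau>w)
  qed
qed

text \<open>Compatibility is known only between an oriented chart and the atlas, so the change of
  chart passes through a chart of the atlas and the determinants multiply.\<close>

lemma oriented_charts_transition:
  fixes M :: "'m::{t2_space, second_countable_topology} chart set"
  assumes M: "oriented_surface M" and c: "oriented_chart M c" "oriented_chart M c'" and x: "x \<in> fst c" "x \<in> fst c'"
  shows "\<exists>p q. Im (cnj p * q) > 0 \<and> (\<forall>f::'m \<Rightarrow> 'b::real_normed_vector. cdiff c' x f \<longrightarrow> chain_rule c c' x p q f)"
proof -
  obtain c0 where c0: "c0 \<in> M" "x \<in> fst c0"
    using c(1) x(1) by (auto simp: oriented_chart_def pts_def)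
  have ch: "is_chart c" "is_chart c'" "is_chart c0" "compatible c c0" "compatible c0 c'"
    using M c c0 unfolding oriented_surface_def oriented_chart_def by blast+
  obtain p q where pq: "Im (cnj p * q) > 0" "\<And>f::'m \<Rightarrow> 'b. cdiff c0 x f \<Longrightarrow> chain_rule c c0 x p q f"
    using transition_derivatives[OF ch(1,3,4) x(1) c0(2), where 'b = 'b] by blast
  obtain p' q' where pq': "Im (cnj p' * q') > 0" "\<And>f::'m \<Rightarrow> 'b. cdiff c' x f \<Longrightarrow> chain_rule c0 c' x p' q' f"
    using transition_derivatives[OF ch(3,2,5) c0(2) x(2), where 'b = 'b] by blast
  define P Q where "P = of_real (Re p) * p' + of_real (Im p) * q'" and "Q = of_real (Re q) * p' + of_real (Im q) * q'"
  have "Im (cnj P * Q) = Im (cnj p * q) * Im (cnj p' * q')"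
    by (simp add: P_def Q_def algebra_simps)
  then have det: "Im (cnj P * Q) > 0"
    using pq(1) pq'(1) by simp
  show ?thesis
  proof (rule exI[of _ P], rule exI[of _ Q], intro conjI allI impI)
    show "Im (cnj P * Q) > 0"
      by (rule det)
    fix f :: "'m \<Rightarrow> 'b"
    assume f: "cdiff c' x f"
    have f0: "cdiff c0 x f"
      using pq'(2)[OF f] by blast
    show "cdiff c x f"
      using pq(2)[OF f0] by blast
    show "chart_dx c f x = Re P *\<^sub>R chart_dx c' f x + Im P *\<^sub>R chart_dy c' f x"
      "chart_dy c f x = Re Q *\<^sub>R chart_dx c' f x + Im Q *\<^sub>R chart_dy c' f x"
      using pq(2)[OF f0] pq'(2)[OF f] by (simp_all add: P_def Q_def algebra_simps)
  qed
qed

lemma immersed_lift: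
  assumes X: "immersed_surface M X" and \<sigma>: "lift_on M X W \<sigma>" "x \<in> W"
  shows "X x = vec.span {\<sigma> x}" "mink (\<sigma> x) (\<sigma> x) = 0"
proof -
  have "null_line (X x)"
    using X lift_onD(2)[OF \<sigma>(1)] \<sigma>(2) unfolding immersed_surface_def null_line_bundle_def by blast
  then show "X x = vec.span {\<sigma> x}" "mink (\<sigma> x) (\<sigma> x) = 0"
    using null_line_span lift_onD(4,5)[OF \<sigma>] by blast+
qed

text \<open>The immersion condition speaks of atlas charts; an invertible Jacobian transfers
  it.\<close>

lemma immersed_oriented_chart:
  assumes M: "oriented_surface M" and X: "immersed_surface M X" and c: "oriented_chart M c"
    and \<sigma>: "lift_on M X W \<sigma>" and x: "x \<in> W" "x \<in> fst c"
    and ab: "a *\<^sub>R chart_dx c \<sigma> x + b *\<^sub>R chart_dy c \<sigma> x \<in> X x"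
  shows "a = 0" "b = 0"
proof -
  obtain c0 where c0: "c0 \<in> M" "x \<in> fst c0"
    using c x(2) by (auto simp: oriented_chart_def pts_def)
  have ch: "is_chart c" "is_chart c0" "compatible c c0"
    using M c c0 unfolding oriented_surface_def oriented_chart_def by blast+
  have "oriented_chart M c0"
    using M c0 unfolding oriented_chart_def oriented_surface_def pts_def by blast
  then have "csmooth c0 (fst c0 \<inter> W) \<sigma>"
    using smooth_map_chart[OF M _ lift_onD(1,2,3)[OF \<sigma>]] by blast
  then have d: "cdiff c0 x \<sigma>"
    using csmooth_cdiff[OF ch(2)] x c0 by blast
  obtain p q where pq: "Im (cnj p * q) > 0" 
    "chart_dx c \<sigma> x = Re p *\<^sub>R chart_dx c0 \<sigma> x + Im p *\<^sub>R chart_dy c0 \<sigma> x"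
    "chart_dy c \<sigma> x = Re q *\<^sub>R chart_dx c0 \<sigma> x + Im q *\<^sub>R chart_dy c0 \<sigma> x"
    using transition_derivatives[OF ch x(2) c0(2), where 'b = "real^5"] d by blast
  have "(a * Re p + b * Re q) *\<^sub>R chart_dx c0 \<sigma> x + (a * Im p + b * Im q) *\<^sub>R chart_dy c0 \<sigma> x \<in> X x"
    using ab unfolding pq by (simp add: algebra_simps)
  then have "a * Re p + b * Re q = 0 \<and> a * Im p + b * Im q = 0"
    using X \<sigma> c0 x unfolding immersed_surface_def by blast
  then have e: "a * Re p + b * Re q = 0" "a * Im p + b * Im q = 0"
    by auto
  have ne: "Re p * Im q - Im p * Re q \<noteq> 0"
    using pq(1) by simp
  have "a * (Re p * Im q - Im p * Re q) = 0" "b * (Re p * Im q - Im p * Re q) = 0"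
    using e by algebra+
  then show "a = 0" "b = 0"
    using ne by simp_all
qed

lemma hol_chartD: "hol_chart M X c \<Longrightarrow> oriented_chart M c" "hol_chart M X c \<Longrightarrow> is_chart c"
  by (simp_all add: hol_chart_def oriented_chart_def)

lemma lift_csmooth:
  assumes M: "oriented_surface M" and c: "oriented_chart M c" and \<sigma>: "lift_on M X W \<sigma>"
  shows "csmooth c (fst c \<inter> W) \<sigma>"
  by (rule smooth_map_chart[OF M c lift_onD(1,2,3)[OF \<sigma>]])

lemma lift_csmooth_cplx:
  assumes M: "oriented_surface M" and c: "oriented_chart M c" and \<sigma>: "lift_on M X W \<sigma>"
  shows "csmooth c (fst c \<inter> W) (cplx \<circ> \<sigma>)"
  using csmooth_linear[OF _ lift_csmooth[OF assms] bounded_linear_cplx] c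
  by (simp add: oriented_chart_def o_def)

lemma d_xy_cplx:
  assumes "cdiff c x \<sigma>"
  shows "chart_dx c (cplx \<circ> \<sigma>) x = cplx (chart_dx c \<sigma> x)"
    "chart_dy c (cplx \<circ> \<sigma>) x = cplx (chart_dy c \<sigma> x)"
  using d_xy_linear(1,2)[OF bounded_linear_cplx assms[unfolded cdiff_def]] by (simp_all add: o_def in_coord_apply)

text \<open>The square of the z-derivative has real part (A - B)/4 and imaginary part -C/2, where
  \<open>A\<close>, \<open>B\<close>, \<open>C\<close> are the coefficients of the induced
  metric.\<close>

lemma conformal_iff:
  assumes "cdiff c x \<sigma>"
  shows "mink (dz c (cplx \<circ> \<sigma>) x) (dz c (cplx \<circ> \<sigma>) x) = 0 \<longleftrightarrow>
    (let sx = chart_dx c \<sigma> x; sy = chart_dy c \<sigma> x in mink sx sx = mink sy sy \<and> mink sx sy = 0)"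
proof -
  let ?a = "chart_dx c \<sigma> x" and ?b = "chart_dy c \<sigma> x"
  define A B C where "A = mink ?a ?a" and "B = mink ?b ?b" and "C = mink ?a ?b"
  have "mink (dz c (cplx \<circ> \<sigma>) x) (dz c (cplx \<circ> \<sigma>) x) = of_real ((A - B) / 4) - \<i> * of_real (C / 2)"
    unfolding dz_def d_xy_cplx[OF assms] mink_simps mink_cplx mink_commute[of ?b ?a] A_def B_def C_def
    by (simp add: field_simps)
  also have "(of_real ((A - B) / 4) - \<i> * of_real (C / 2) = 0) = (A = B \<and> C = 0)"
    by (auto simp: complex_eq_iff)
  finally show ?thesis
    unfolding Let_def A_def B_def C_def .
qed

text \<open>The derivatives are orthogonal to the null vector \<open>\<sigma> x\<close>, where the
  form is semidefinite. A null derivative would be a multiple of \<open>\<sigma> x\<close>, contrary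
  to the immersion.\<close>

lemma immersed_metric_positive:
  assumes M: "oriented_surface M" and X: "immersed_surface M X" and c: "oriented_chart M c"
    and \<sigma>: "lift_on M X W \<sigma>" and x: "x \<in> W" "x \<in> fst c"
  shows "mink (\<sigma> x) (chart_dx c \<sigma> x) = 0" "mink (\<sigma> x) (chart_dy c \<sigma> x) = 0"
    "mink (chart_dx c \<sigma> x) (chart_dx c \<sigma> x) > 0"
    "mink (chart_dy c \<sigma> x) (chart_dy c \<sigma> x) > 0"
proof -
  have ch: "is_chart c"
    using c by (simp add: oriented_chart_def)
  have d: "in_coord c \<sigma> differentiable (at (snd c x))"
    using csmooth_cdiff[OF ch lift_csmooth[OF M c \<sigma>], of x] x by (simp add: cdiff_def)
  have z: "d_x (in_coord c (\<lambda>y. mink (\<sigma> y) (\<sigma> y))) (snd c x) = chart_dx c (\<lambda>y. 0::real) x"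
     "d_y (in_coord c (\<lambda>y. mink (\<sigma> y) (\<sigma> y))) (snd c x) = chart_dy c (\<lambda>y. 0::real) x"
    by (rule chart_cong[OF ch lift_onD(1)[OF \<sigma>] x], rule immersed_lift(2)[OF X \<sigma>], assumption)+
  let ?a = "chart_dx c \<sigma> x" and ?b = "chart_dy c \<sigma> x"
  show a: "mink (\<sigma> x) ?a = 0" and b: "mink (\<sigma> x) ?b = 0"
    using z unfolding in_coord_apply d_xy_bilinear[OF bounded_bilinear_mink_real d d]
    by (simp_all add: in_coord_at[OF ch x(2)] d_x_def d_y_def mink_commute[of _ "\<sigma> x"])
  have span: "X x = vec.span {\<sigma> x}" and null: "mink (\<sigma> x) (\<sigma> x) = 0"
    using immersed_lift[OF X \<sigma> x(1)] by auto
  note lo = lorentz_orth_null[OF null lift_onD(5)[OF \<sigma> x(1)]]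
  note im = immersed_oriented_chart[OF M X c \<sigma> x]
  show "mink ?a ?a > 0"
  proof -
    have "mink ?a ?a \<noteq> 0"
    proof
      assume "mink ?a ?a = 0"
      then have "1 *\<^sub>R ?a + 0 *\<^sub>R ?b \<in> X x"
        using lo(2)[of ?a] a span by (simp add: mink_commute)
      from im(1)[OF this] show False
        by simp
    qed
    then show ?thesis
      using lo(1)[of ?a] a by (simp add: mink_commute)
  qed
  show "mink ?b ?b > 0"
  proof -
    have "mink ?b ?b \<noteq> 0"
    proof
      assume "mink ?b ?b = 0"
      then have "0 *\<^sub>R ?a + 1 *\<^sub>R ?b \<in> X x"
        using lo(2)[of ?b] b span by (simp add: mink_commute)
      from im(2)[OF this] show False
        by simp
    qed
    then show ?thesis
      using lo(1)[of ?b] b by (simp add: mink_commute)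
  qed
qed

text \<open>Conformality in both charts makes the Jacobian columns \<open>p\<close> and
  \<open>q\<close> orthogonal and of equal length; with positive determinant this forces
  \<open>q = \<i> * p\<close>, the Cauchy-Riemann equations.\<close>

lemma hol_charts_transition:
  fixes M :: "'m::{t2_space, second_countable_topology} chart set"
  assumes M: "oriented_surface M" and X: "immersed_surface M X" and c: "hol_chart M X c" "hol_chart M X c'"
    and x: "x \<in> fst c" "x \<in> fst c'"
  shows "\<exists>p. p \<noteq> 0 \<and> (\<forall>f. cdiff c' x f \<longrightarrow> cdiff c x f \<and> dz c f x = p *s dz c' f x \<and> dzbar c f x = cnj p *s dzbar c' f x)"
proof -
  note oc = hol_chartD(1)[OF c(1)] hol_chartD(1)[OF c(2)]
  have xM: "x \<in> pts M"
    using oc(1) x by (auto simp: oriented_chart_def)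
  then obtain W \<sigma> where \<sigma>: "x \<in> W" "lift_on M X W \<sigma>"
    using X unfolding immersed_surface_def null_line_bundle_def by blast
  have d: "cdiff c' x (cplx \<circ> \<sigma>)" "cdiff c' x \<sigma>"
    using csmooth_cdiff[OF hol_chartD(2)[OF c(2)] lift_csmooth_cplx[OF M oc(2) \<sigma>(2)]]
      csmooth_cdiff[OF hol_chartD(2)[OF c(2)] lift_csmooth[OF M oc(2) \<sigma>(2)]] \<sigma>(1) x by blast+
  have d': "cdiff c x \<sigma>"
    using csmooth_cdiff[OF hol_chartD(2)[OF c(1)] lift_csmooth[OF M oc(1) \<sigma>(2)]] \<sigma>(1) x by blast
  obtain p q where pq: "Im (cnj p * q) > 0" "\<And>f::'m \<Rightarrow> complex^5. cdiff c' x f \<Longrightarrow> chain_rule c c' x p q f"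
    using oriented_charts_transition[OF M oc x, where 'b = "complex^5"] by blast
  let ?a = "chart_dx c \<sigma> x" and ?b = "chart_dy c \<sigma> x"
  let ?a' = "chart_dx c' \<sigma> x" and ?b' = "chart_dy c' \<sigma> x"
  have ab: "cplx ?a = Re p *\<^sub>R cplx ?a' + Im p *\<^sub>R cplx ?b'" "cplx ?b = Re q *\<^sub>R cplx ?a' + Im q *\<^sub>R cplx ?b'"
    using pq(2)[OF d(1)] unfolding d_xy_cplx[OF d(2)] d_xy_cplx[OF d'] by auto
  have scale: "r *\<^sub>R v = of_real r *s v" for r and v :: "complex^5"
    by (simp add: vec_eq_iff scaleR_conv_of_real[where 'a = complex])
  have m: "of_real (mink ?a ?a) = (of_real (mink ?b ?b) :: complex)" "of_real (mink ?a ?b) = (0 :: complex)"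
     and m': "mink ?a' ?a' = mink ?b' ?b'" "mink ?a' ?b' = 0"
    using c \<sigma> x unfolding hol_chart_def Let_def by (metis IntI of_real_0)+
  define E where "E = mink ?b' ?b'"
  have E: "E > 0"
    unfolding E_def by (rule immersed_metric_positive(4)[OF M X oc(2) \<sigma>(2,1) x(2)])
  have "(of_real (Re p))\<^sup>2 * of_real E + (of_real (Im p))\<^sup>2 * of_real E = (of_real (Re q))\<^sup>2 * of_real E + (of_real (Im q))\<^sup>2 * (of_real E :: complex)"
    "of_real (Re p) * of_real (Re q) * of_real E + of_real (Im p) * of_real (Im q) * of_real E = (0 :: complex)"
    using m unfolding mink_cplx[symmetric] ab scale mink_simps unfolding mink_cplx m' mink_commute[of ?b' ?a'] E_def[symmetric]
    by (simp_all add: power2_eq_square algebra_simps)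
  then have "of_real (((Re p)\<^sup>2 + (Im p)\<^sup>2) * E) = (of_real (((Re q)\<^sup>2 + (Im q)\<^sup>2) * E) :: complex)"
    "of_real ((Re p * Re q + Im p * Im q) * E) = (0 :: complex)"
    by (simp_all add: algebra_simps)
  then have pq': "(Re p)\<^sup>2 + (Im p)\<^sup>2 = (Re q)\<^sup>2 + (Im q)\<^sup>2" "Re p * Re q + Im p * Im q = 0"
    using E unfolding of_real_eq_iff of_real_eq_0_iff by auto
  have "q = \<i> * p"
  proof -
    \<comment> \<open>Lagrange's identity: the squares of determinant and scalar product add up to
      the product of the squared lengths.\<close>
    have "(Re p * Im q - Im p * Re q)\<^sup>2 = ((Re p)\<^sup>2 + (Im p)\<^sup>2)\<^sup>2"
      using pq' by algebra
    then have "Re p * Im q - Im p * Re q = (Re p)\<^sup>2 + (Im p)\<^sup>2"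
      using pq(1) by (simp add: power2_eq_iff_nonneg)
    then have "(Re q + Im p)\<^sup>2 + (Im q - Re p)\<^sup>2 = 0"
      using pq'(1) by algebra
    then show ?thesis
      by (simp add: sum_power2_eq_zero_iff complex_eq_iff)
  qed
  have p0: "p \<noteq> 0"
    using pq(1) by auto
  show ?thesis
  proof (intro exI[of _ p] conjI p0 allI impI)
    fix f :: "'m \<Rightarrow> complex^5"
    assume f: "cdiff c' x f"
    show "cdiff c x f"
      using pq(2)[OF f] by blast
    define R I where "R = complex_of_real (Re p)" and "I = complex_of_real (Im p)"
    have p: "p = R + \<i> * I" "cnj p = R - \<i> * I" "of_real (Re q) = - I" "of_real (Im q) = R"
      by (simp_all add: R_def I_def complex_eq_iff \<open>q = \<i> * p\<close>)
    have dx: "chart_dx c f x = R *s chart_dx c' f x + I *s chart_dy c' f x"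
      and dy: "chart_dy c f x = (- I) *s chart_dx c' f x + R *s chart_dy c' f x"
      using pq(2)[OF f] unfolding scale p(3,4) by (simp_all add: R_def I_def)
    show "dz c f x = p *s dz c' f x" "dzbar c f x = cnj p *s dzbar c' f x"
      unfolding dz_def dzbar_def dx dy p(2) by (simp_all add: vec_eq_iff p(1) field_simps)
  qed
qed

subsection \<open>The central sphere congruence\<close>

text \<open>The product rule for a locally constant inner product; it moves derivatives from one
  factor to the other throughout.\<close>

lemma mink_wirt_orth:
  assumes c: "is_chart c" and W: "open W" "x \<in> W" "x \<in> fst c" and f: "cdiff c x f" and g: "cdiff c x g"
    and fg: "\<And>y. y \<in> W \<Longrightarrow> y \<in> fst c \<Longrightarrow> mink (f y) (g y) = k"
  shows "mink (wirt e c f x) (g x) + mink (f x) (wirt e c g x) = 0"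
proof -
  have "wirts e c (\<lambda>y. mink (f y) (g y)) x = wirts e c (\<lambda>y. k) x"
    using chart_cong(1,2)[OF c W, of "\<lambda>y. mink (f y) (g y)" "\<lambda>y. k"] fg by (simp add: wirts_def)
  then show ?thesis
    unfolding wirts_mink[OF c W(3) f g] wirts_const .
qed

locale surface_chart =
  fixes M :: "'m::{t2_space, second_countable_topology} chart set"
    and X :: "'m \<Rightarrow> (real^5) set" and c :: "'m chart" and V :: "'m set" and \<sigma> :: "'m \<Rightarrow> real^5"
  assumes surf: "oriented_surface M" and imm: "immersed_surface M X" and hol: "hol_chart M X c"
    and lift: "lift_on M X V \<sigma>"
begin

definition U where "U = fst c \<inter> V"
definition s where "s = cplx \<circ> \<sigma>"
definition s' where "s' e = wirt e c s"

lemma ori: "oriented_chart M c" and cha: "is_chart c"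
  using hol_chartD[OF hol] by auto

lemma U: "x \<in> U \<Longrightarrow> x \<in> fst c" "x \<in> U \<Longrightarrow> x \<in> V" "open U" "U \<subseteq> pts M"
  using lift_onD(1,2)[OF lift] cha by (auto simp: U_def is_chart_def)

lemma csmooth_s: "csmooth c U s"
  unfolding s_def U_def by (rule lift_csmooth_cplx[OF surf ori lift])

lemma csmooth_s': "csmooth c U (s' e)"
  unfolding s'_def by (rule csmooth_wirt[OF cha csmooth_s])

lemma cdiff_s: "x \<in> U \<Longrightarrow> cdiff c x s" "x \<in> U \<Longrightarrow> cdiff c x (s' e)"
  using csmooth_cdiff[OF cha] csmooth_s csmooth_s' by blast+

lemma orth_deriv:
  assumes x: "x \<in> U" and f: "cdiff c x f" and g: "cdiff c x g" and fg: "\<And>y. y \<in> U \<Longrightarrow> mink (f y) (g y) = k"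
  shows "mink (wirt e c f x) (g x) + mink (f x) (wirt e c g x) = 0"
  by (rule mink_wirt_orth[OF cha U(3) x U(1)[OF x] f g, of k]) (use fg in blast)

lemma s_real: "conjv (s x) = s x"
  by (simp add: s_def)

lemma s'_conj: "x \<in> U \<Longrightarrow> conjv (s' (-\<i>) x) = s' \<i> x"
  using wirt_conj_ii(2)[OF cdiff_s(1), of x] by (simp add: s'_def s_real)

lemma s'_conj': "x \<in> U \<Longrightarrow> conjv (s' \<i> x) = s' (-\<i>) x"
  using s'_conj[of x] by (metis conjv_conjv)

lemma ss: "x \<in> U \<Longrightarrow> mink (s x) (s x) = 0"
  using immersed_lift(2)[OF imm lift] U(2) by (simp add: s_def mink_cplx)

lemma ss': "x \<in> U \<Longrightarrow> mink (s x) (s' e x) = 0"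
  using orth_deriv[OF _ cdiff_s(1) cdiff_s(1) ss, of x e] by (simp add: s'_def mink_commute[of "wirt e c s x"])

lemma s's'_z: "x \<in> U \<Longrightarrow> mink (s' (-\<i>) x) (s' (-\<i>) x) = 0"
proof -
  assume x: "x \<in> U"
  have "cdiff c x \<sigma>"
    using csmooth_cdiff[OF cha lift_csmooth[OF surf ori lift], of x] x by (simp add: U_def)
  then have "mink (dz c (cplx \<circ> \<sigma>) x) (dz c (cplx \<circ> \<sigma>) x) = 0"
    using hol lift U(1,2)[OF x] unfolding conformal_iff[OF \<open>cdiff c x \<sigma>\<close>] hol_chart_def by blast
  then show ?thesis
    by (simp add: s'_def s_def dz_wirt)
qed

lemma s's': "x \<in> U \<Longrightarrow> e \<in> {\<i>, -\<i>} \<Longrightarrow> mink (s' e x) (s' e x) = 0"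
  using s's'_z[of x] mink_conjv[of "s' (-\<i>) x" "s' (-\<i>) x"] by (auto simp: s'_conj)

lemma s'_s': "x \<in> U \<Longrightarrow> mink (s' (-\<i>) x) (s' \<i> x) \<noteq> 0"
proof -
  assume x: "x \<in> U"
  note xx = U(2)[OF x] U(1)[OF x]
  have d: "cdiff c x \<sigma>"
    using csmooth_cdiff[OF cha lift_csmooth[OF surf ori lift], of x] x by (simp add: U_def)
  let ?a = "chart_dx c \<sigma> x" and ?b = "chart_dy c \<sigma> x"
  have "mink (s' (-\<i>) x) (s' \<i> x) = of_real ((mink ?a ?a + mink ?b ?b) / 4)"
    unfolding s'_def wirt_def s_def d_xy_cplx[OF d] mink_simps mink_cplx mink_commute[of ?b ?a]
    by (simp add: field_simps)
  moreover have "mink ?a ?a > 0" "mink ?b ?b > 0"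
    using immersed_metric_positive(3,4)[OF surf imm ori lift xx] by auto
  then have "(mink ?a ?a + mink ?b ?b) / 4 \<noteq> 0"
    by simp
  ultimately show ?thesis
    by (simp only: of_real_eq_0_iff) blast
qed

lemma second_order:
  assumes x: "x \<in> U" and e: "e \<in> {\<i>, -\<i>}"
  shows "mink (s x) (wirt e c (s' e) x) = 0" "mink (s' e x) (wirt e c (s' e) x) = 0"
    "mink (s x) (wirt e c (s' (-e)) x) = - mink (s' e x) (s' (-e) x)"
proof -
  show "mink (s x) (wirt e c (s' e) x) = 0"
  proof -
    have "mink (wirt e c s x) (s' e x) + mink (s x) (wirt e c (s' e) x) = 0"
      by (rule orth_deriv[OF x cdiff_s(1)[OF x] cdiff_s(2)[OF x] ss'])
    then show ?thesis
      using s's'[OF x e] by (simp add: s'_def)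
  qed
  show "mink (s' e x) (wirt e c (s' e) x) = 0"
    using orth_deriv[OF x cdiff_s(2)[OF x] cdiff_s(2)[OF x] s's'[OF _ e], of e] by (simp add: mink_commute[of "wirt e c (s' e) x"])
  show "mink (s x) (wirt e c (s' (-e)) x) = - mink (s' e x) (s' (-e) x)"
  proof -
    have "mink (wirt e c s x) (s' (-e) x) + mink (s x) (wirt e c (s' (-e)) x) = 0"
      by (rule orth_deriv[OF x cdiff_s(1)[OF x] cdiff_s(2)[OF x] ss'])
    then show ?thesis
      by (simp add: s'_def[of e] add_eq_0_iff2)
  qed
qed

lemma mixed: "x \<in> U \<Longrightarrow> wirt (-\<i>) c (s' \<i>) x = wirt \<i> c (s' (-\<i>)) x"
  unfolding s'_def by (rule csmooth_mixed[OF cha csmooth_s])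

lemma mixed_real: "x \<in> U \<Longrightarrow> conjv (wirt (-\<i>) c (s' \<i>) x) = wirt (-\<i>) c (s' \<i>) x"
proof -
  assume x: "x \<in> U"
  have "conjv (wirt (-\<i>) c (s' \<i>) x) = wirt \<i> c (\<lambda>y. conjv (s' \<i> y)) x"
    using wirt_conj_ii(2)[OF cdiff_s(2)[OF x]] by simp
  also have "\<dots> = wirt \<i> c (s' (-\<i>)) x"
    by (rule wirt_cong[OF cha U(3) x U(1)[OF x]]) (rule s'_conj')
  finally show ?thesis
    using mixed[OF x] by simp
qed

lemma chart_lift: "x \<in> U \<Longrightarrow> chart_lift_at M X x c s"
  using hol lift U by (auto simp: chart_lift_at_def s_def)

text \<open>The last two claims, maximality of the two isotropic planes, convert orthogonality
  relations into membership.\<close>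

lemma frame_span:
  assumes x: "x \<in> U" and n: "mink n n = 1" "mink (s x) n = 0" "mink (s' (-\<i>) x) n = 0" "mink (s' \<i> x) n = 0"
    "mink (wirt (-\<i>) c (s' \<i>) x) n = 0"
  shows "vec.span {s x, dz c s x, dzbar c s x, dz c (dzbar c s) x} = orth {n}"
    and "\<And>v. mink v n = 0 \<Longrightarrow> mink v (s x) = 0 \<Longrightarrow> mink v (s' (-\<i>) x) = 0 \<Longrightarrow> v \<in> vec.span {s x, s' (-\<i>) x}"
    and "\<And>v. mink v n = 0 \<Longrightarrow> mink v (s x) = 0 \<Longrightarrow> mink v (s' \<i> x) = 0 \<Longrightarrow> v \<in> vec.span {s x, s' \<i> x}"
proof -
  have t: "mink (s x) (wirt (-\<i>) c (s' \<i>) x) = - mink (s' (-\<i>) x) (s' \<i> x)"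
    using second_order(3)[OF x, of "-\<i>"] by simp
  note fr = ss[OF x] ss'[OF x] ss'[OF x] s's'[OF x] s's'[OF x]
  show "vec.span {s x, dz c s x, dzbar c s x, dz c (dzbar c s) x} = orth {n}"
    using null_frame_orth(1)[OF fr refl s'_s'[OF x] t n] by (simp add: dz_wirt s'_def)
  show "v \<in> vec.span {s x, s' (-\<i>) x}" if "mink v n = 0" "mink v (s x) = 0" "mink v (s' (-\<i>) x) = 0" for v
    using null_frame_orth(2)[OF fr refl s'_s'[OF x] t n that] by simp
  show "v \<in> vec.span {s x, s' \<i> x}" if "mink v n = 0" "mink v (s x) = 0" "mink v (s' \<i> x) = 0" for v
    using null_frame_orth(2)[OF fr mink_commute s'_s'[OF x] t n(1,2,4,3,5) that] by simp
qed

text \<open>The unit normal is given as orthogonal to the real points of the sphere, while the z-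
  and zbar-derivatives are not real; these real combinations have the same complex span.\<close>

lemma frame_vectors_real:
  assumes x: "x \<in> U"
  shows "\<exists>w. s x = cplx w" "\<exists>w. s' (-\<i>) x + s' \<i> x = cplx w" "\<exists>w. \<i> *s (s' (-\<i>) x - s' \<i> x) = cplx w"
    "\<exists>w. wirt (-\<i>) c (s' \<i>) x = cplx w"
  by (rule conjv_fixed; simp add: s_real conjv_add conjv_diff conjv_scale s'_conj[OF x] s'_conj'[OF x] mixed_real[OF x] algebra_simps)+

end

text \<open>The sphere is a union over charts and lifts. A vector \<open>n\<close> orthogonal to
  every frame makes each member of the union the same complement, and a holomorphic chart makes the
  union non-empty.\<close>

lemma central_sphere_eq:
  assumes M: "oriented_surface M" and X: "immersed_surface M X" and h: "has_hol_charts M X" and x: "x \<in> pts M"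
    and n: "mink n n = 1" "\<And>c V \<sigma>. surface_chart M X c V \<sigma> \<Longrightarrow> x \<in> fst c \<inter> V \<Longrightarrow>
      mink (cplx (\<sigma> x)) n = 0 \<and> mink (dz c (cplx \<circ> \<sigma>) x) n = 0 \<and> mink (dzbar c (cplx \<circ> \<sigma>) x) n = 0 \<and>
      mink (dz c (dzbar c (cplx \<circ> \<sigma>)) x) n = 0"
  shows "central_sphere M X x = orth {n}"
proof -
  have span: "vec.span {s x, dz c s x, dzbar c s x, dz c (dzbar c s) x} = orth {n}" if cl: "chart_lift_at M X x c s" for c s
  proof -
    obtain V \<sigma> where V: "hol_chart M X c" "x \<in> fst c" "x \<in> V" "lift_on M X V \<sigma>" "s = cplx \<circ> \<sigma>"
      using cl by (auto simp: chart_lift_at_def)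
    interpret surface_chart M X c V \<sigma>
      using M X V by unfold_locales
    have xU: "x \<in> U"
      using V by (simp add: U_def)
    have "s = local.s"
      by (simp add: V(5) s_def)
    then show ?thesis
      using frame_span(1)[OF xU n(1)] n(2)[OF surface_chart_axioms] V(2,3) by (simp add: s_def s'_def dz_wirt)
  qed
  obtain c where c: "hol_chart M X c" "x \<in> fst c"
    using h x by (auto simp: has_hol_charts_def)
  obtain V \<sigma> where V: "x \<in> V" "lift_on M X V \<sigma>"
    using X x unfolding immersed_surface_def null_line_bundle_def by blast
  have "chart_lift_at M X x c (cplx \<circ> \<sigma>)"
    using c V by (auto simp: chart_lift_at_def)
  then show ?thesis
    unfolding central_sphere_def using span by blast
qed

lemma orth_orth_unit:
  assumes "mink n n = (1::'a::field)"
  shows "orth (orth {n}) = vec.span {n}"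
proof
  show "vec.span {n} \<subseteq> orth (orth {n})"
    by (auto simp: span_single mem_orth mink_simps mink_commute)
  show "orth (orth {n}) \<subseteq> vec.span {n}"
  proof
    fix v assume v: "v \<in> orth (orth {n})"
    define w where "w = v - mink v n *s n"
    have wn: "mink w n = 0"
      by (simp add: w_def mink_simps assms)
    have "mink w u = 0" for u
    proof -
      have "u - mink u n *s n \<in> orth {n}"
        by (simp add: mem_orth mink_simps assms)
      then have "mink v (u - mink u n *s n) = 0"
        using v unfolding mem_orth[of v] by blast
      then show ?thesis
        by (simp add: w_def mink_simps mink_commute[of n])
    qed
    then have "w = 0"
      by (rule mink_nondegenerate)
    then show "v \<in> vec.span {n}"
      by (auto simp: span_single w_def)
  qed
qed

lemma proj_orth_unit:
  assumes "mink n n = (1::'a::field)"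
  shows "proj_along (orth {n}) (orth (orth {n})) v = v - mink v n *s n"
    "proj_along (orth (orth {n})) (orth {n}) v = mink v n *s n"
proof -
  have 0: "vec.span {n} \<inter> orth {n} \<subseteq> {0}"
    using assms by (auto simp: span_single mem_orth mink_simps)
  have 1: "v - mink v n *s n \<in> orth {n}"
    by (simp add: mem_orth mink_simps assms)
  show "proj_along (orth {n}) (orth (orth {n})) v = v - mink v n *s n"
    unfolding orth_orth_unit[OF assms]
    by (rule proj_along_eq) (use 0 1 in \<open>auto simp: subspace_orth span_single_scale\<close>)
  show "proj_along (orth (orth {n})) (orth {n}) v = mink v n *s n"
    unfolding orth_orth_unit[OF assms]
    by (rule proj_along_eq) (use 0 1 in \<open>auto simp: subspace_orth span_single_scale\<close>)
qed

section \<open>The given surface and its unit normal\<close>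

locale normal_surface =
  fixes M :: "'m::{t2_space, second_countable_topology} chart set"
    and \<Lambda> :: "'m \<Rightarrow> (real^5) set" and v_inf :: "real^5" and N :: "'m \<Rightarrow> real^5"
  assumes surf: "oriented_surface M" and imm: "immersed_surface M \<Lambda>" and hol: "has_hol_charts M \<Lambda>"
    and unit: "unit_normal M \<Lambda> v_inf N"
begin

definition n where "n = cplx \<circ> N"

lemma nn: "x \<in> pts M \<Longrightarrow> mink (n x) (n x) = 1"
  using unit by (simp add: unit_normal_def n_def mink_cplx)

lemma n_real: "conjv (n x) = n x"
  by (simp add: n_def)

lemma cdiff_n:
  assumes c: "oriented_chart M c" and x: "x \<in> fst c"
  shows "cdiff c x n"
proof -
  have "open (pts M)"
    using surf by (auto simp: pts_def oriented_surface_def is_chart_def)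
  then have "csmooth c (fst c \<inter> pts M) N"
    using unit by (intro smooth_map_chart[OF surf c]) (auto simp: unit_normal_def)
  then have "cdiff c x N"
    using c x by (intro csmooth_cdiff[of c "fst c \<inter> pts M"]) (auto simp: oriented_chart_def)
  then show ?thesis
    unfolding n_def o_def by (rule cdiff_linear[OF bounded_linear_cplx])
qed

lemma n_orth:
  assumes "surface_chart M \<Lambda> c V \<sigma>" and x: "x \<in> fst c \<inter> V"
  shows "mink (cplx (\<sigma> x)) (n x) = 0 \<and> mink (dz c (cplx \<circ> \<sigma>) x) (n x) = 0 \<and> mink (dzbar c (cplx \<circ> \<sigma>) x) (n x) = 0 \<and>
      mink (dz c (dzbar c (cplx \<circ> \<sigma>)) x) (n x) = 0"
proof -
  interpret sc: surface_chart M \<Lambda> c V \<sigma>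
    by fact
  have xU: "x \<in> sc.U"
    using x by (simp add: sc.U_def)
  then have xM: "x \<in> pts M"
    using sc.U(4) by blast
  let ?S = "vec.span {sc.s x, sc.s' (-\<i>) x, sc.s' \<i> x, wirt (-\<i>) c (sc.s' \<i>) x}"
  have S: "?S \<subseteq> central_sphere M \<Lambda> x"
    unfolding central_sphere_def dz_wirt sc.s'_def by (rule Union_upper) (use sc.chart_lift[OF xU] in blast)
  have N: "mink (cplx w) (n x) = 0" if "cplx w \<in> ?S" for w
  proof -
    have "w \<in> real_central_sphere M \<Lambda> x"
      using that S by (auto simp: real_central_sphere_def real_points_def)
    then have "mink (N x) w = 0"
      using unit xM unfolding unit_normal_def mem_orth by blast
    then show ?thesis
      by (simp add: n_def mink_cplx mink_commute)
  qed
  then have N': "mink v (n x) = 0" if "v \<in> ?S" "\<exists>w. v = cplx w" for v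
    using that by blast
  have m: "sc.s x \<in> ?S" "sc.s' (-\<i>) x + sc.s' \<i> x \<in> ?S" "\<i> *s (sc.s' (-\<i>) x - sc.s' \<i> x) \<in> ?S" "wirt (-\<i>) c (sc.s' \<i>) x \<in> ?S"
    by (intro vec.span_add vec.span_diff vec.span_scale vec.span_base; simp)+
  have e: "mink (sc.s x) (n x) = 0" "mink (sc.s' (-\<i>) x + sc.s' \<i> x) (n x) = 0" "mink (\<i> *s (sc.s' (-\<i>) x - sc.s' \<i> x)) (n x) = 0"
    "mink (wirt (-\<i>) c (sc.s' \<i>) x) (n x) = 0"
    using N'[OF m(1)] N'[OF m(2)] N'[OF m(3)] N'[OF m(4)] sc.frame_vectors_real[OF xU] by blast+
  then have "mink (sc.s' (-\<i>) x) (n x) = 0" "mink (sc.s' \<i> x) (n x) = 0"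
    by (simp_all add: mink_simps)
  then show ?thesis
    using e(1,4) by (simp add: dz_wirt sc.s'_def sc.s_def)
qed

lemma central_sphere: "x \<in> pts M \<Longrightarrow> central_sphere M \<Lambda> x = orth {n x}"
  by (rule central_sphere_eq[OF surf imm hol _ nn]; (assumption | rule n_orth))

lemma pi_S: "x \<in> pts M \<Longrightarrow> pi_S M \<Lambda> x v = v - mink v (n x) *s n x"
  and pi_Sperp: "x \<in> pts M \<Longrightarrow> pi_Sperp M \<Lambda> x v = mink v (n x) *s n x"
  by (simp_all add: pi_S_def pi_Sperp_def central_sphere proj_orth_unit nn)

lemma rho: "x \<in> pts M \<Longrightarrow> rho M \<Lambda> x = refl_n (n x)"
  by (rule ext) (simp add: rho_def pi_S pi_Sperp refl_n_def vec_eq_iff)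

lemma real_central_sphere: "x \<in> pts M \<Longrightarrow> real_central_sphere M \<Lambda> x = orth {N x}"
  by (auto simp: real_central_sphere_def real_points_def central_sphere mem_orth n_def mink_cplx)

lemma NN: "x \<in> pts M \<Longrightarrow> mink (N x) (N x) = 1"
  using unit by (simp add: unit_normal_def)

text \<open>Comparing the two expressions for the normal part of \<open>v_inf\<close> shows that the
  chosen sign of \<open>N\<close> turns the square root into the product with
  \<open>N\<close>.\<close>

lemma v_inf_parts:
  assumes x: "x \<in> pts M"
  shows "vT M \<Lambda> v_inf x = v_inf - mink v_inf (N x) *s N x" "mean_curvature M \<Lambda> v_inf x = mink v_inf (N x)"
proof -
  show "vT M \<Lambda> v_inf x = v_inf - mink v_inf (N x) *s N x"
    by (simp add: vT_def real_central_sphere[OF x] proj_orth_unit[OF NN[OF x]])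
  have "vperp M \<Lambda> v_inf x = mink v_inf (N x) *s N x"
    by (simp add: vperp_def real_central_sphere[OF x] proj_orth_unit[OF NN[OF x]])
  moreover have "vperp M \<Lambda> v_inf x = mean_curvature M \<Lambda> v_inf x *\<^sub>R N x"
    using unit x by (simp add: unit_normal_def)
  ultimately have "mink v_inf (N x) *s N x = mean_curvature M \<Lambda> v_inf x *s N x"
    by (metis scalar_mult_eq_scaleR)
  then have "mink (mink v_inf (N x) *s N x) (N x) = mink (mean_curvature M \<Lambda> v_inf x *s N x) (N x)"
    by (rule arg_cong)
  then show "mean_curvature M \<Lambda> v_inf x = mink v_inf (N x)"
    by (simp add: mink_simps NN[OF x])
qed

end

subsection \<open>The associated family of connections\<close>

lemma skew_wedge: "skew_map (\<lambda>u. k *s wedge v w u)"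
  unfolding skew_map_def wedge_def
  by (simp add: mink_simps vec_eq_iff mink_commute[of v] mink_commute[of w] algebra_simps)

context derivation_at
begin

lemma metric_connD:
  assumes "metric_conn D"
  shows "(\<And>y. y \<in> W \<Longrightarrow> f y = g y) \<Longrightarrow> D f = D g"
    "DV f \<Longrightarrow> DV g \<Longrightarrow> D (\<lambda>y. f y + g y) = D f + D g"
    "DS h \<Longrightarrow> DV f \<Longrightarrow> D (\<lambda>y. h y *s f y) = ds h *s f x + h x *s D f"
    "DV f \<Longrightarrow> DV g \<Longrightarrow> ds (\<lambda>y. mink (f y) (g y)) = mink (D f) (g x) + mink (f x) (D g)"
  using assms unfolding metric_conn_def by blast+

text \<open>Needed for the constant term of the family, which is \<open>d\<close> minus two skew
  terms.\<close>

lemma metric_conn_diff_skew: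
  assumes D: "metric_conn D" and K: "skew_map K"
  shows "metric_conn (\<lambda>f. D f - K (f x))"
proof -
  have K': "K (v + w) = K v + K w" "K (k *s v) = k *s K v" "mink (K v) w = - mink v (K w)" for v w k
    using K unfolding skew_map_def by blast+
  show ?thesis
    unfolding metric_conn_def
  proof (intro conjI allI impI)
    fix f g :: "'m \<Rightarrow> complex^5" and h
    {
      assume "\<forall>y\<in>W. f y = g y"
      then show "D f - K (f x) = D g - K (g x)"
        using metric_connD(1)[OF D, of f g] x_in_W by simp
    }
    assume f: "DV f"
    {
      assume g: "DV g"
      show "D (\<lambda>y. f y + g y) - K (f x + g x) = D f - K (f x) + (D g - K (g x))"
        by (simp add: metric_connD(2)[OF D f g] K')
      show "ds (\<lambda>y. mink (f y) (g y)) = mink (D f - K (f x)) (g x) + mink (f x) (D g - K (g x))"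
        by (simp add: metric_connD(4)[OF D f g] K' mink_simps)
    }
    assume h: "DS h"
    show "D (\<lambda>y. h y *s f y) - K (h x *s f x) = ds h *s f x + h x *s (D f - K (f x))"
      by (simp add: metric_connD(3)[OF D h f] K' vec_eq_iff algebra_simps)
  qed
qed

end

context normal_bundle
begin

lemma nabla_scale:
  assumes g: "gauge_data D \<nu> A E F" and "DS h" "DV f"
  shows "nabla D \<nu> A m (\<lambda>y. h y *s f y) = ds h *s f x + h x *s nabla D \<nu> A m f"
  unfolding nabla_def metric_connD(3)[OF gauge_dataD(1)[OF g] assms(2,3)] gauge_dataD(5)[OF g] mink_simps
  by (simp add: vec_eq_iff algebra_simps)

text \<open>At \<open>x\<close> both m-dependent terms annihilate \<open>f\<close>, so the value is
  the same for every \<open>m\<close>. Used at \<open>m = 1\<close>, it identifies an actual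
  derivative with \<open>D f\<close>.\<close>

lemma nabla_normal:
  assumes g: "gauge_data D \<nu> A E F" and f: "DV f" "\<And>y. y \<in> W \<Longrightarrow> mink (f y) (n y) = 0" and F: "f x \<in> F"
  shows "nabla D \<nu> A m f = D f" "mink (nabla D \<nu> A m f) (n x) = 0"
proof -
  have fx: "mink (f x) (n x) = 0" "mink (f x) \<nu> = 0" "A (f x) = 0"
    using f(2)[OF x_in_W] gauge_dataD(9,10)[OF g F] by (simp_all add: mink_commute)
  show 1: "nabla D \<nu> A m f = D f"
    by (simp add: nabla_def fx)
  have "ds (\<lambda>y. mink (f y) (n y)) = ds (\<lambda>_. 0)"
    by (rule ds_cong) (rule f(2))
  then show "mink (nabla D \<nu> A m f) (n x) = 0"
    unfolding 1 by (simp add: metric_connD(4)[OF gauge_dataD(1)[OF g] f(1) DV_n] gauge_dataD(2)[OF g] mink_simps ds_const)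
qed

end

section \<open>The family of a CMC surface in a chart\<close>

locale cmc_chart = normal_surface M \<Lambda> v_inf N
  for M :: "'m::{t2_space, second_countable_topology} chart set"
    and \<Lambda> :: "'m \<Rightarrow> (real^5) set" and v_inf :: "real^5" and N :: "'m \<Rightarrow> real^5" +
  fixes c :: "'m chart" and V W :: "'m set" and \<sigma> :: "'m \<Rightarrow> real^5" and t :: real
  assumes hol_c: "hol_chart M \<Lambda> c" and lift_V: "lift_on M \<Lambda> V \<sigma>" and W: "open W" "W \<subseteq> fst c \<inter> V"
begin

sublocale sc: surface_chart M \<Lambda> c V \<sigma>
  using surf imm hol_c lift_V by unfold_locales

lemma W_mem: "x \<in> W \<Longrightarrow> x \<in> sc.U" "x \<in> W \<Longrightarrow> x \<in> fst c" "x \<in> W \<Longrightarrow> x \<in> pts M"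
  using W sc.U(4) by (auto simp: sc.U_def)

lemma cdiff_nW: "x \<in> W \<Longrightarrow> cdiff c x n"
  by (rule cdiff_n[OF sc.ori W_mem(2)])

lemma bundle_at: "x \<in> W \<Longrightarrow> normal_bundle x W (cdiff c x) (cdiff c x) (\<lambda>h. wirts e c h x) n"
  unfolding normal_bundle_def normal_bundle_axioms_def
  using chart_derivation[OF sc.cha W(1) _ W_mem(2)] cdiff_nW by blast

text \<open>The (1,0)-plane for \<open>e = - \<i>\<close> and the (0,1)-plane for
  \<open>e = \<i>\<close>, in the fixed chart and lift.\<close>

abbreviation "null_plane e y \<equiv> vec.span {sc.s y, sc.s' e y}"

definition H where "H x = complex_of_real (mean_curvature M \<Lambda> v_inf x)"
definition sI where "sI x = cplx (sigma_inf \<Lambda> v_inf x)"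
text \<open>The sign is forced: the form \<open>N_form\<close> must send \<open>n\<close> to its
  derivative.\<close>

definition \<nu> where "\<nu> e x = - wirt e c n x"
text \<open>The coefficient of \<open>q_inf\<close>: the Hodge star multiplies the dz-part by -\<i>
  and the dzbar-part by \<i>, in both cases by \<open>e\<close>.\<close>

definition A where "A e x u = ((H x + e * of_real t) / 2) *s wedge (sI x) (wirt e c n x) u"
text \<open>Subtracting \<open>A\<close> absorbs the -1 in the coefficients of \<open>q\<close>, so
  that the family becomes a plain quadratic polynomial in \<open>m\<close>. The factor
  \<open>1 *s\<close> gives the term the shape of \<open>skew_wedge\<close>.\<close>

definition D0 where "D0 e x f = wirt e c f x - 1 *s wedge (\<nu> e x) (n x) (f x) - A e x (f x)"

lemma sI: "x \<in> W \<Longrightarrow> \<exists>k. sI x = k *s sc.s x"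
proof -
  assume x: "x \<in> W"
  define s where "s = (SOME s. s \<in> \<Lambda> x \<and> s \<noteq> 0)"
  have "\<sigma> x \<in> \<Lambda> x \<and> \<sigma> x \<noteq> 0"
    using lift_onD(4,5)[OF lift_V, of x] x W(2) by blast
  then have "s \<in> \<Lambda> x \<and> s \<noteq> 0"
    unfolding s_def by (rule someI)
  moreover have "\<Lambda> x = vec.span {\<sigma> x}"
    by (rule immersed_lift(1)[OF imm lift_V]) (use x W(2) in blast)
  ultimately obtain k where k: "s = k *s \<sigma> x"
    by (metis span_single)
  have "sI x = of_real (- 1 / mink s v_inf * k) *s sc.s x"
    unfolding sI_def sigma_inf_def Let_def s_def[symmetric] sc.s_def k by (simp add: vec_eq_iff cplx_def)
  then show ?thesis
    by blast
qed

lemma n_frame: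
  assumes x: "x \<in> W"
  shows "mink (sc.s x) (n x) = 0" "e \<in> {\<i>, -\<i>} \<Longrightarrow> mink (sc.s' e x) (n x) = 0" "mink (wirt (-\<i>) c (sc.s' \<i>) x) (n x) = 0"
  using n_orth[OF sc.surface_chart_axioms, of x] W_mem(1)[OF x] 
  by (auto simp: dz_wirt sc.s'_def sc.s_def sc.U_def)

lemma nn': "x \<in> W \<Longrightarrow> mink (wirt e c n x) (n x) = 0"
  using mink_wirt_orth[OF sc.cha W(1) _ W_mem(2) cdiff_nW cdiff_nW, of x 1 e] nn[OF W_mem(3)]
  by (simp add: mink_commute[of "n x" "wirt e c n x"])

text \<open>The vectors s, its e-derivative and the mixed second derivative all lie in the central
  sphere, so differentiating their orthogonality to \<open>n\<close> costs nothing. This makes the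
  plane of the opposite type the right choice of \<open>F\<close>.\<close>

lemma n'_frame:
  assumes x: "x \<in> W" and e: "e \<in> {\<i>, -\<i>}"
  shows "mink (wirt e c n x) (sc.s x) = 0" "mink (wirt e c n x) (sc.s' (-e) x) = 0"
proof -
  have U: "y \<in> sc.U" if "y \<in> W" for y
    using that W_mem(1) by blast
  have "mink (wirt e c sc.s x) (n x) + mink (sc.s x) (wirt e c n x) = 0"
    by (rule mink_wirt_orth[OF sc.cha W(1) x W_mem(2)[OF x] sc.cdiff_s(1)[OF U[OF x]] cdiff_nW[OF x], where k = 0]) (rule n_frame(1))
  then show "mink (wirt e c n x) (sc.s x) = 0"
    using n_frame(2)[OF x e] by (simp add: sc.s'_def mink_commute)
  have "mink (wirt e c (sc.s' (-e)) x) (n x) + mink (sc.s' (-e) x) (wirt e c n x) = 0"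
    by (rule mink_wirt_orth[OF sc.cha W(1) x W_mem(2)[OF x] sc.cdiff_s(2)[OF U[OF x]] cdiff_nW[OF x], where k = 0]) (use n_frame(2) e in auto)
  moreover have "mink (wirt e c (sc.s' (-e)) x) (n x) = 0"
    using e n_frame(3)[OF x] sc.mixed[OF U[OF x]] by auto
  ultimately show "mink (wirt e c n x) (sc.s' (-e) x) = 0"
    by (simp add: mink_commute)
qed

text \<open>\<open>A\<close> and \<open>\<nu>\<close> vanish on the opposite plane because the two
  vectors that form \<open>A\<close> are orthogonal to it. For \<open>E\<close>, differentiate the
  isotropy relations: the e-derivatives of s and of its e-derivative are orthogonal to the plane
  spanned by these two.\<close>

lemma gauge_data_initial:
  assumes x: "x \<in> W" and e: "e \<in> {\<i>, -\<i>}"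
  shows "normal_bundle.gauge_data x W (cdiff c x) (cdiff c x) (\<lambda>h. wirts e c h x) n (D0 e x) (\<nu> e x) (A e x)
    (\<lambda>y. null_plane e y) (null_plane (-e) x)"
proof -
  interpret normal_bundle x W "cdiff c x" "cdiff c x" "\<lambda>h. wirts e c h x" n
    by (rule bundle_at[OF x])
  have m: "mink (n x) (n x) = 1" "mink (wirt e c n x) (n x) = 0" "mink (n x) (wirt e c n x) = 0"
    using nn[OF W_mem(3)[OF x]] nn'[OF x] by (simp_all add: mink_commute)
  obtain k where k: "sI x = k *s sc.s x"
    using sI[OF x] by blast
  have An: "A e x (n x) = 0"
    using n_frame(1)[OF x] m by (simp add: A_def wedge_def k mink_simps mink_commute[of "n x" "sc.s x"])
  define K where "K = (\<lambda>u. 1 *s wedge (\<nu> e x) (n x) u)"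
  have K: "skew_map K"
    unfolding K_def by (rule skew_wedge)
  have A: "skew_map (A e x)"
    unfolding A_def[abs_def] by (rule skew_wedge)
  have "metric_conn (\<lambda>f. wirt e c f x - K (f x) - A e x (f x))"
    by (rule metric_conn_diff_skew[OF metric_conn_diff_skew[OF chart_metric_conn[OF sc.cha W(1) x W_mem(2)[OF x]] K] A])
  then have "metric_conn (D0 e x)"
    unfolding D0_def[abs_def] K_def .
  moreover have "D0 e x n = 0"
    unfolding D0_def An by (simp add: wedge_def \<nu>_def m mink_simps vec_eq_iff)
  moreover have "mink (\<nu> e x) (n x) = 0"
    by (simp add: \<nu>_def mink_simps m)
  moreover note A
  moreover have "A e x b = 0 \<and> mink (\<nu> e x) b = 0" if "b \<in> null_plane (-e) x" for b
  proof -
    obtain p q where b: "b = p *s sc.s x + q *s sc.s' (-e) x"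
      using \<open>b \<in> _\<close> by (auto simp: span_pair)
    have "mink (wirt e c n x) b = 0" "mink b (sI x) = 0"
      using n'_frame[OF x e] sc.ss[OF W_mem(1)[OF x]] sc.ss'[OF W_mem(1)[OF x]]
      by (simp_all add: b k mink_simps mink_commute[of "sc.s' (-e) x" "sc.s x"])
    then show ?thesis
      by (simp add: A_def wedge_def \<nu>_def mink_simps mink_commute[of b "wirt e c n x"])
  qed
  moreover have "mink (D0 e x f) g = 0" if f: "cdiff c x f" "\<forall>y\<in>W. f y \<in> null_plane e y"
    and g: "g \<in> null_plane e x" for f g
  proof -
    note xU = W_mem(1)[OF x]
    obtain p q where gg: "g = p *s sc.s x + q *s sc.s' e x"
      using g by (auto simp: span_pair)
    have fy: "mink (f y) (sc.s y) = 0" "mink (f y) (sc.s' e y) = 0" "mink (f y) (n y) = 0" if y: "y \<in> W" for y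
    proof -
      obtain p q where fy: "f y = p *s sc.s y + q *s sc.s' e y"
        using f(2) y by (auto simp: span_pair)
      show "mink (f y) (sc.s y) = 0" "mink (f y) (sc.s' e y) = 0" "mink (f y) (n y) = 0"
        using sc.ss[OF W_mem(1)[OF y]] sc.ss'[OF W_mem(1)[OF y], of e] sc.s's'[OF W_mem(1)[OF y] e] n_frame(1)[OF y] n_frame(2)[OF y e]
        by (simp_all add: fy mink_simps mink_commute[of "sc.s' e y" "sc.s y"])
    qed
    obtain p' q' where fx: "f x = p' *s sc.s x + q' *s sc.s' e x"
      using f(2) x by (auto simp: span_pair)
    have so: "mink (f x) (wirt e c sc.s x) = 0" "mink (f x) (wirt e c (sc.s' e) x) = 0"
      using sc.second_order(1,2)[OF xU e] sc.s's'[OF xU e] sc.ss'[OF xU, of e] by (simp_all add: fx mink_simps sc.s'_def)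
    have "mink (wirt e c f x) (sc.s x) + mink (f x) (wirt e c sc.s x) = 0"
      by (rule mink_wirt_orth[OF sc.cha W(1) x W_mem(2)[OF x] f(1) sc.cdiff_s(1)[OF xU], where k = 0]) (rule fy(1))
    moreover have "mink (wirt e c f x) (sc.s' e x) + mink (f x) (wirt e c (sc.s' e) x) = 0"
      by (rule mink_wirt_orth[OF sc.cha W(1) x W_mem(2)[OF x] f(1) sc.cdiff_s(2)[OF xU], where k = 0]) (rule fy(2))
    ultimately have 1: "mink (wirt e c f x) g = 0"
      by (simp add: gg mink_simps so)
    have 2: "mink (n x) g = 0" "mink (f x) (sI x) = 0" "mink (sI x) g = 0"
      using n_frame(1)[OF x] n_frame(2)[OF x e] fy(1)[OF x] sc.ss[OF xU] sc.ss'[OF xU]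
      by (simp_all add: gg k mink_simps mink_commute[of "n x" "sc.s x"] mink_commute[of "n x" "sc.s' e x"])
    show ?thesis
      unfolding D0_def A_def wedge_def by (simp add: mink_simps 1 2 fy(3)[OF x])
  qed
  ultimately show ?thesis
    unfolding gauge_data_def using An by blast
qed

abbreviation "nabla0 e x \<equiv> normal_bundle.nabla x n (D0 e x) (\<nu> e x) (A e x)"

lemma nabla_initial:
  "nabla0 e x m f
    = wirt e c f x - wedge (\<nu> e x) (n x) (f x) + m *s wedge (\<nu> e x) (n x) (f x) + (m\<^sup>2 - 1) *s A e x (f x)" if "x \<in> W"
proof -
  interpret normal_bundle x W "cdiff c x" "cdiff c x" "\<lambda>h. wirts e c h x" n
    by (rule bundle_at[OF that])
  show ?thesis
    unfolding nabla_def D0_def wedge_def by (simp add: vec_eq_iff algebra_simps)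
qed

lemma nabla_one: "x \<in> W \<Longrightarrow> nabla0 e x 1 f = wirt e c f x"
  by (simp add: nabla_initial)

lemma D_formula:
  assumes x: "x \<in> W" and f: "cdiff c x f"
  shows "pi_S M \<Lambda> x (wirt e c (\<lambda>y. pi_S M \<Lambda> y (f y)) x) + pi_Sperp M \<Lambda> x (wirt e c (\<lambda>y. pi_Sperp M \<Lambda> y (f y)) x)
    = wirt e c f x - wedge (\<nu> e x) (n x) (f x)"
proof -
  note xM = W_mem(3)[OF x]
  have cd: "cdiff c x (\<lambda>y. mink (f y) (n y))"
    by (rule cdiff_bilinear[OF bounded_bilinear_mink f cdiff_nW[OF x]])
  have 1: "wirt e c (\<lambda>y. pi_S M \<Lambda> y (f y)) x = wirt e c (\<lambda>y. f y + (- 1) *s (mink (f y) (n y) *s n y)) x"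
    by (rule wirt_cong[OF sc.cha W(1) x W_mem(2)[OF x]]) (simp add: pi_S W_mem(3))
  have 2: "wirt e c (\<lambda>y. pi_Sperp M \<Lambda> y (f y)) x = wirt e c (\<lambda>y. mink (f y) (n y) *s n y) x"
    by (rule wirt_cong[OF sc.cha W(1) x W_mem(2)[OF x]]) (simp add: pi_Sperp W_mem(3))
  have cd3: "cdiff c x (\<lambda>y. mink (f y) (n y) *s n y)"
    by (rule cdiff_bilinear[OF bounded_bilinear_smult cd cdiff_nW[OF x]])
  note conn = wirt_scale[OF sc.cha W_mem(2)[OF x]] wirts_mink[OF sc.cha W_mem(2)[OF x]]
  have 3: "wirt e c (\<lambda>y. mink (f y) (n y) *s n y) x = (mink (wirt e c f x) (n x) + mink (f x) (wirt e c n x)) *s n x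
      + mink (f x) (n x) *s wirt e c n x"
    unfolding conn(1)[OF cd cdiff_nW[OF x]] conn(2)[OF f cdiff_nW[OF x]] ..
  have 4: "wirt e c (\<lambda>y. f y + (- 1) *s (mink (f y) (n y) *s n y)) x = wirt e c f x + (-1) *s wirt e c (\<lambda>y. mink (f y) (n y) *s n y) x"
    unfolding wirt_add[OF f cdiff_bilinear[OF bounded_bilinear_smult cdiff_const cd3]]
      conn(1)[OF cdiff_const cd3] wirts_const by simp
  show ?thesis
    unfolding 1 2 4 3 pi_S[OF xM] pi_Sperp[OF xM] wedge_def \<nu>_def mink_simps nn[OF xM] nn'[OF x]
    by (simp add: vec_eq_iff algebra_simps)
qed

lemma N_formula:
  assumes x: "x \<in> W"
  shows "N_form M \<Lambda> c x = (wedge (\<nu> (-\<i>) x) (n x), wedge (\<nu> \<i> x) (n x))"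
  unfolding N_form_def D_z_def D_zbar_def dz_wirt D_formula[OF x cdiff_const] by (simp add: wirt_const)

lemma q_formula:
  assumes x: "x \<in> W"
  shows "q_inf M \<Lambda> v_inf N t c x = (A (-\<i>) x, A \<i> x)"
  unfolding q_inf_def eta_inf_def hodge_def A_def[abs_def] H_def sI_def Let_def dz_wirt n_def[symmetric]
  by (simp add: fun_eq_iff vec_eq_iff algebra_simps)

lemma dlq_formula:
  assumes x: "x \<in> W" and f: "cdiff c x f"
  shows "dlq_z M \<Lambda> (q_inf M \<Lambda> v_inf N t) \<zeta> c f x = nabla0 (-\<i>) x (inverse \<zeta>) f"
    "dlq_zbar M \<Lambda> (q_inf M \<Lambda> v_inf N t) \<zeta> c f x = nabla0 \<i> x \<zeta> f"
  unfolding dlq_z_def dlq_zbar_def D_z_def D_zbar_def dz_wirt D_formula[OF x f] N_formula[OF x] q_formula[OF x] nabla_initial[OF x]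
  by simp_all

lemma conjv_wedge: "conjv (wedge v w u) = wedge (conjv v) (conjv w) (conjv u)"
  by (simp add: wedge_def conjv_diff conjv_scale mink_conjv[symmetric])

text \<open>Conjugation exchanges d/dz and d/dzbar and sends \<open>m\<close> to its conjugate.
  Since \<open>m\<close> is 1/\<lambda> for one direction and \<lambda> for the other, it sends
  \<lambda> to the reciprocal of its conjugate.\<close>

lemma nabla_conj:
  assumes x: "x \<in> W" and f: "cdiff c x f" and e: "e \<in> {\<i>, -\<i>}"
  shows "conjv (nabla0 e x m f)
    = nabla0 (-e) x (cnj m) (\<lambda>y. conjv (f y))"
proof -
  have ce: "cnj e = - e"
    using e by auto
  have n': "conjv (wirt e c n x) = wirt (-e) c n x"
    using wirt_conj[OF cdiff_nW[OF x], of e] by (simp add: n_real ce)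
  have \<nu>': "conjv (\<nu> e x) = \<nu> (-e) x"
    using n' conjv_scale[of "-1"] by (simp add: \<nu>_def)
  have A': "conjv (A e x u) = A (-e) x (conjv u)" for u
    by (simp add: A_def conjv_scale conjv_wedge n' H_def sI_def ce)
  show ?thesis
    unfolding nabla_initial[OF x] conjv_add conjv_diff conjv_scale conjv_wedge \<nu>' n_real A' 
    using wirt_conj[OF f, of e] by (simp add: ce)
qed

end

subsection \<open>The two dressing steps\<close>

lemma cdiff_inverse:
  fixes h :: "'m::topological_space \<Rightarrow> complex"
  assumes "is_chart c" "x \<in> fst c" "cdiff c x h" "h x \<noteq> 0"
  shows "cdiff c x (\<lambda>y. inverse (h y))"
  using assms unfolding cdiff_def in_coord_apply(2) by (simp add: in_coord_at)

context normal_bundle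
begin

text \<open>By the Leibniz rule, rescaling a section of a parallel line only changes the factor
  \<open>k\<close>.\<close>

lemma parallel_normal_section:
  assumes g: "gauge_data D \<nu> A E F" and l: "DV l" and h: "DS (\<lambda>y. inverse (mink (l y) (n y)))"
    and nz: "mink (l x) (n x) \<noteq> 0" and par: "nabla D \<nu> A m l = k *s l x"
    and hyp: "\<And>y. y \<in> W \<Longrightarrow> hyp_pair (inverse (mink (l y) (n y)) *s l y - n y) (n y)"
  shows "parallel_normal D \<nu> A m (\<lambda>y. inverse (mink (l y) (n y)) *s l y - n y)"
proof -
  define k' where "k' = ds (\<lambda>y. inverse (mink (l y) (n y))) * mink (l x) (n x) + k"
  have "nabla D \<nu> A m (\<lambda>y. inverse (mink (l y) (n y)) *s l y) = k' *s (inverse (mink (l x) (n x)) *s l x)"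
    unfolding nabla_scale[OF g h l] par k'_def using nz by (simp add: vec_eq_iff algebra_simps)
  then show ?thesis
    unfolding parallel_normal_def using DV_diff[OF DV_scale[OF h l] DV_n] hyp by auto
qed

end

text \<open>Orthogonality at \<open>\<zeta> = a\<close> makes the gauged section a Laurent polynomial in \<open>\<zeta>\<close> again.\<close>

lemma gauge_p_section:
  assumes h: "hyp_pair u n" and e: "mink e n = 0" and a: "a \<noteq> 0" "\<zeta> \<noteq> 0" "a\<^sup>2 \<noteq> \<zeta>\<^sup>2"
    and perp: "mink ((h1 / a) *s n + e + (a * h2) *s n) (u + n) = 0"
  shows "gauge ((a - \<zeta>) / (a + \<zeta>)) u n ((h1 / \<zeta>) *s n + e + (\<zeta> * h2) *s n)
     = (h1 / \<zeta>) *s n + (e - (2 * h1 / a) *s u) - (\<zeta> * h2) *s n"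
proof -
  have m: "mink u u = -1" "mink n n = 1" "mink u n = 0" "mink n u = 0"
    using h by (auto simp: hyp_pair_def mink_commute)
  \<comment> \<open>Orthogonality at \<open>a\<close> fixes the component of \<open>e\<close> along
    \<open>u\<close>; this is the value that cancels the poles below.\<close>
  have eu: "mink e u = - (h1 / a + a * h2)"
    using perp by (simp add: mink_simps m e add_eq_0_iff2 algebra_simps)
  have ne: "a - \<zeta> \<noteq> 0" "a + \<zeta> \<noteq> 0"
    using a(3) by (auto simp: power2_eq_square add_eq_0_iff)
  define \<kappa> where "\<kappa> = (a - \<zeta>) / (a + \<zeta>)"
  define c s where "c = (\<kappa> + inverse \<kappa>) / 2" and "s = (\<kappa> - inverse \<kappa>) / 2"
  define d where "d = (a - \<zeta>) * (a + \<zeta>)"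
  have d: "d \<noteq> 0" "d = a\<^sup>2 - \<zeta>\<^sup>2"
    using ne by (simp add: d_def, simp add: d_def power2_eq_square algebra_simps)
  have k: "\<kappa> = (a - \<zeta>)\<^sup>2 / d" "inverse \<kappa> = (a + \<zeta>)\<^sup>2 / d"
    using ne by (simp_all add: \<kappa>_def power2_eq_square d_def)
  have cs: "c = (a\<^sup>2 + \<zeta>\<^sup>2) / d" "s = - 2 * a * \<zeta> / d"
    unfolding c_def s_def k(2) unfolding k(1) using d(1)
    by (simp_all add: divide_simps) (simp_all add: power2_eq_square algebra_simps)
  \<comment> \<open>The two coefficients of the rotated vector, along n here and along u next: the
    denominator \<open>d\<close> drops out of both, and the second does not depend on
    \<open>\<zeta>\<close>.\<close>
  have 1: "c * (h1 / \<zeta> + \<zeta> * h2) + s * (h1 / a + a * h2) = h1 / \<zeta> - \<zeta> * h2"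
    unfolding cs using a(1,2) d(1) by (simp add: divide_simps) (simp add: d(2) power2_eq_square algebra_simps)
  have 2: "- (h1 / a + a * h2) * (1 - c) + s * (h1 / \<zeta> + \<zeta> * h2) = - (2 * h1 / a)"
    unfolding cs using a(1,2) d(1) by (simp add: divide_simps) (simp add: d(2) power2_eq_square algebra_simps)
  have "gauge \<kappa> u n ((h1 / \<zeta>) *s n + e + (\<zeta> * h2) *s n) =
      e + (- (h1 / a + a * h2) * (1 - c) + s * (h1 / \<zeta> + \<zeta> * h2)) *s u
        + (c * (h1 / \<zeta> + \<zeta> * h2) + s * (h1 / a + a * h2)) *s n"
    unfolding gauge_def c_def[symmetric] s_def[symmetric] rot_def mink_simps m e eu
    by (simp add: vec_eq_iff algebra_simps add_divide_distrib diff_divide_distrib)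
  then show ?thesis
    unfolding 1 2 \<kappa>_def by (simp add: vec_eq_iff algebra_simps)
qed

text \<open>This gauge is the one of \<open>gauge_p_section\<close> followed by the reflection,
  which sends \<open>n\<close> to its negative. So the coefficient of 1/\<zeta> changes sign here
  and that of \<zeta> does not; the two gauges together reverse both.\<close>

lemma gauge_q_section:
  assumes h: "hyp_pair u n" and e: "mink e n = 0" and a: "a \<noteq> 0" "\<zeta> \<noteq> 0" "a\<^sup>2 \<noteq> \<zeta>\<^sup>2"
    and perp: "mink ((h1 / a) *s n + e + (a * h2) *s n) (u + n) = 0"
  shows "gauge ((\<zeta> - a) / (\<zeta> + a)) u n ((h1 / \<zeta>) *s n + e + (\<zeta> * h2) *s n)
     = (- h1 / \<zeta>) *s n + gauge (-1) u n (e - (2 * h1 / a) *s u) + (\<zeta> * h2) *s n"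
proof -
  have ne: "a - \<zeta> \<noteq> 0" "a + \<zeta> \<noteq> 0"
    using a(3) by (auto simp: power2_eq_square add_eq_0_iff)
  have "(\<zeta> - a) / (\<zeta> + a) = -1 * ((a - \<zeta>) / (a + \<zeta>))"
    using ne by (simp add: field_simps)
  then have "gauge ((\<zeta> - a) / (\<zeta> + a)) u n v = gauge (-1) u n (gauge ((a - \<zeta>) / (a + \<zeta>)) u n v)" for v
    using gauge_gauge[OF h, of "-1" "(a - \<zeta>) / (a + \<zeta>)" v] ne by (simp add: add.commute[of \<zeta> a])
  moreover have "gauge (-1) u n (p *s n + E - k *s n) = (- p) *s n + gauge (-1) u n E + k *s n" for p k E
  proof -
    have "p *s n + E - k *s n = p *s n + (E + (- k) *s n)"
      by (simp add: vec_eq_iff)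
    then show ?thesis
      by (simp only: gauge_add gauge_scale gauge_minus_one_normal[OF h]) (simp add: vec_eq_iff)
  qed
  ultimately show ?thesis
    by (simp only: gauge_p_section[OF assms] minus_divide_left)
qed

section \<open>The two dressing maps in a chart\<close>

locale baecklund_chart = cmc_chart M \<Lambda> v_inf N c V W \<sigma> t
  for M :: "'m::{t2_space, second_countable_topology} chart set"
    and \<Lambda> :: "'m \<Rightarrow> (real^5) set" and v_inf :: "real^5" and N :: "'m \<Rightarrow> real^5"
    and c :: "'m chart" and V W :: "'m set" and \<sigma> :: "'m \<Rightarrow> real^5" and t :: real +
  fixes \<alpha> :: complex and L :: "'m \<Rightarrow> (complex^5) set" and Wl :: "'m set" and l :: "'m \<Rightarrow> complex^5"
  assumes par: "baecklund_parameters M \<Lambda> (q_inf M \<Lambda> v_inf N t) \<alpha> L"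
    and perp: "\<And>x. x \<in> pts M \<Longrightarrow> L x \<subseteq> orth {p_inf M \<Lambda> v_inf N t \<alpha> x}"
    and lift_l: "lift_on M L Wl l" and W_l: "W \<subseteq> Wl"
begin

definition b where "b = inverse (cnj \<alpha>)"
text \<open>The gauge parameters of the first step, with pole \<open>b\<close>, at \<zeta> =
  \<open>\<alpha>\<close> and at \<zeta> = 1 (\<open>\<kappa>1\<close>); \<open>\<kappa>2\<close>
  belongs to the second step, with pole \<open>\<alpha>\<close>, at \<zeta> = 1.\<close>

definition \<kappa>a where "\<kappa>a = (\<alpha> - b) / (\<alpha> + b)"
definition \<kappa>1 where "\<kappa>1 = (1 - b) / (1 + b)"
definition \<kappa>2 where "\<kappa>2 = (\<alpha> - 1) / (\<alpha> + 1)"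
definition u where "u y = inverse (mink (l y) (n y)) *s l y - n y"
definition w where "w y = conjv (u y)"
definition lt where "lt y = gauge \<kappa>a (w y) (n y) (l y)"
definition ut where "ut y = inverse (mink (lt y) (n y)) *s lt y - n y"
definition T where "T y v = gauge \<kappa>2 (ut y) (n y) (gauge \<kappa>1 (w y) (n y) v)"

lemma params: "\<alpha> \<noteq> 0" "b \<noteq> 0" "cnj \<alpha> = inverse b" "\<alpha>\<^sup>2 \<noteq> 1" "b\<^sup>2 \<noteq> 1" "\<alpha>\<^sup>2 \<noteq> b\<^sup>2" "\<kappa>a \<noteq> 0" "\<kappa>1 \<noteq> 0" "\<kappa>2 \<noteq> 0"
proof -
  show a0: "\<alpha> \<noteq> 0"
    using par by (simp add: baecklund_parameters_def)
  have na: "norm \<alpha> \<noteq> 1"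
    using par by (simp add: baecklund_parameters_def)
  show "b \<noteq> 0"
    using a0 by (simp add: b_def)
  show "cnj \<alpha> = inverse b"
    by (simp add: b_def)
  have nb: "norm b = inverse (norm \<alpha>)"
    by (simp add: b_def norm_inverse)
  have nb1: "norm b \<noteq> 1"
    using na nb by simp
  \<comment> \<open>Equal squares have equal moduli, so all the exclusions reduce to the norms of
    \<open>\<alpha>\<close>, its inverse and 1.\<close>
  have sq: "norm z \<noteq> norm v \<Longrightarrow> z\<^sup>2 \<noteq> v\<^sup>2" for z v :: complex
    by (metis norm_minus_cancel power2_eq_iff)
  show a2: "\<alpha>\<^sup>2 \<noteq> 1" and b2: "b\<^sup>2 \<noteq> 1"
    using sq[of \<alpha> 1] sq[of b 1] na nb1 by simp_all
  have "norm \<alpha> \<noteq> norm b"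
  proof
    assume "norm \<alpha> = norm b"
    then have "norm \<alpha> * norm \<alpha> = 1"
      using nb a0 by (metis norm_eq_zero right_inverse)
    then show False
      using na by (metis abs_norm_cancel abs_square_eq_1 power2_eq_square)
  qed
  then show ab: "\<alpha>\<^sup>2 \<noteq> b\<^sup>2"
    by (rule sq)
  show "\<kappa>a \<noteq> 0" "\<kappa>1 \<noteq> 0" "\<kappa>2 \<noteq> 0"
  proof -
    have "b \<noteq> -1" "\<alpha> \<noteq> -1" "\<alpha> \<noteq> - b" "b \<noteq> 1" "\<alpha> \<noteq> 1" "\<alpha> \<noteq> b"
      using ab a2 b2 by (metis power2_minus one_power2)+
    then show "\<kappa>a \<noteq> 0" "\<kappa>1 \<noteq> 0" "\<kappa>2 \<noteq> 0"
      by (simp_all add: \<kappa>a_def \<kappa>1_def \<kappa>2_def eq_neg_iff_add_eq_0 add.commute[of 1])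
  qed
qed

text \<open>In the direction d/dz the parameter is 1/\<lambda>, so the poles \<open>b\<close> and
  \<open>\<alpha>\<close> appear as \<open>cnj \<alpha>\<close> and \<open>inverse \<alpha>\<close>;
  these are the same numbers in that form.\<close>

lemma kappa_alt: "\<kappa>1 = (cnj \<alpha> - 1) / (cnj \<alpha> + 1)" "\<kappa>a = (cnj \<alpha> - inverse \<alpha>) / (cnj \<alpha> + inverse \<alpha>)"
  "\<kappa>2 = (1 - inverse \<alpha>) / (1 + inverse \<alpha>)" 
proof -
  have e: "inverse b - 1 = (1 - b) * inverse b" "inverse b + 1 = (1 + b) * inverse b"
    "inverse b - inverse \<alpha> = (\<alpha> - b) * (inverse \<alpha> * inverse b)"
    "inverse b + inverse \<alpha> = (\<alpha> + b) * (inverse \<alpha> * inverse b)"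
    "1 - inverse \<alpha> = (\<alpha> - 1) * inverse \<alpha>" "1 + inverse \<alpha> = (\<alpha> + 1) * inverse \<alpha>"
    using params(1,2) by (simp_all add: field_simps)
  have nz: "inverse \<alpha> * inverse b \<noteq> 0" "inverse b \<noteq> 0" "inverse \<alpha> \<noteq> 0"
    using params(1,2) by simp_all
  show "\<kappa>1 = (cnj \<alpha> - 1) / (cnj \<alpha> + 1)"
    unfolding params(3) \<kappa>1_def e by (rule nonzero_mult_divide_mult_cancel_right[OF nz(2), symmetric])
  show "\<kappa>a = (cnj \<alpha> - inverse \<alpha>) / (cnj \<alpha> + inverse \<alpha>)"
    unfolding params(3) \<kappa>a_def e by (rule nonzero_mult_divide_mult_cancel_right[OF nz(1), symmetric])
  show "\<kappa>2 = (1 - inverse \<alpha>) / (1 + inverse \<alpha>)"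
    unfolding \<kappa>2_def e by (rule nonzero_mult_divide_mult_cancel_right[OF nz(3), symmetric])
qed

lemma l_facts:
  assumes y: "y \<in> W"
  shows "L y = vec.span {l y}" "mink (l y) (l y) = 0" "l y \<noteq> 0"
proof -
  have "null_line (L y)"
    using par W_mem(3)[OF y] by (simp add: baecklund_parameters_def null_line_bundle_def)
  then show "L y = vec.span {l y}" "mink (l y) (l y) = 0" "l y \<noteq> 0"
    using null_line_span lift_onD(4,5)[OF lift_l, of y] W_l y by blast+
qed

lemma adm:
  assumes y: "y \<in> W"
  shows "admissible (refl_n (n y)) (L y)" "admissible (refl_n (n y)) (L_tilde (refl_n (n y)) \<alpha> (L y))"
  using par W_mem(3)[OF y] unfolding baecklund_parameters_def rho[OF W_mem(3)[OF y], symmetric] by blast+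

lemma u_facts:
  assumes y: "y \<in> W"
  shows "mink (l y) (n y) \<noteq> 0" "hyp_pair (u y) (n y)" "L y = vec.span {u y + n y}"
  using admissible_line[OF nn[OF W_mem(3)[OF y]] l_facts(2)[OF y] _ l_facts(3)[OF y]] adm(1)[OF y] unfolding l_facts(1)[OF y] u_def by auto

lemma w_facts:
  assumes y: "y \<in> W"
  shows "hyp_pair (w y) (n y)" "conjv ` L y = vec.span {w y + n y}"
proof -
  show "hyp_pair (w y) (n y)"
    using u_facts(2)[OF y] mink_conjv[of "u y" "u y"] mink_conjv[of "u y" "n y"] by (simp add: hyp_pair_def w_def n_real)
  show "conjv ` L y = vec.span {w y + n y}"
    by (simp add: u_facts(3)[OF y] conjv_span_single conjv_add w_def n_real)
qed

lemma L_tilde: "y \<in> W \<Longrightarrow> L_tilde (refl_n (n y)) \<alpha> (L y) = vec.span {lt y}"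
proof -
  assume y: "y \<in> W"
  show ?thesis
    unfolding L_tilde_def b_def[symmetric] w_facts(2)[OF y] q_gauge_eq[OF w_facts(1)[OF y]] \<kappa>a_def[symmetric]
    unfolding l_facts(1)[OF y] lt_def
    by (rule image_span_single) (rule gauge_scale)
qed

lemma ut_facts:
  assumes y: "y \<in> W"
  shows "mink (lt y) (n y) \<noteq> 0" "hyp_pair (ut y) (n y)" "vec.span {lt y} = vec.span {ut y + n y}"
proof -
  have 1: "mink (lt y) (lt y) = 0"
    by (simp add: lt_def gauge_isometry[OF w_facts(1)[OF y] params(7)] l_facts(2)[OF y])
  have "gauge (inverse \<kappa>a) (w y) (n y) (lt y) = l y"
    unfolding lt_def using params(7) by (simp add: gauge_gauge[OF w_facts(1)[OF y]] gauge_one)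
  then have 2: "lt y \<noteq> 0"
    using l_facts(3)[OF y] gauge_scale[of "inverse \<kappa>a" "w y" "n y" 0 0] by auto
  show "mink (lt y) (n y) \<noteq> 0" "hyp_pair (ut y) (n y)" "vec.span {lt y} = vec.span {ut y + n y}"
    using admissible_line[OF nn[OF W_mem(3)[OF y]] 1 _ 2] adm(2)[OF y] unfolding L_tilde[OF y] ut_def by auto
qed

lemma cdiff_l: "x \<in> W \<Longrightarrow> cdiff c x l"
proof -
  assume x: "x \<in> W"
  show ?thesis
    by (rule csmooth_cdiff[OF sc.cha smooth_map_chart[OF surf sc.ori lift_onD(1,2,3)[OF lift_l]]])
       (use x W W_l in blast)
qed

lemma cdiff_diff:
  assumes "cdiff c x f" "cdiff c x g"
  shows "cdiff c x (\<lambda>y. f y - g y)"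
  using cdiff_add[OF assms(1) cdiff_linear[OF bounded_linear_minus[OF bounded_linear_ident] assms(2)]] by simp

lemma cdiff_gauge:
  assumes "x \<in> W" "cdiff c x v" "cdiff c x f"
  shows "cdiff c x (\<lambda>y. gauge \<kappa> (v y) (n y) (f y))"
proof -
  interpret normal_bundle x W "cdiff c x" "cdiff c x" "\<lambda>h. wirts \<i> c h x" n
    by (rule bundle_at[OF assms(1)])
  show ?thesis
    by (rule DV_gauge[OF assms(2) DV_n assms(3)])
qed

lemma cdiff_uw:
  assumes x: "x \<in> W"
  shows "cdiff c x (\<lambda>y. inverse (mink (l y) (n y)))" "cdiff c x u" "cdiff c x w" "cdiff c x lt"
    "cdiff c x (\<lambda>y. inverse (mink (lt y) (n y)))" "cdiff c x ut"
proof -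
  note mn = cdiff_bilinear[OF bounded_bilinear_mink _ cdiff_nW[OF x]]
  show 1: "cdiff c x (\<lambda>y. inverse (mink (l y) (n y)))"
    by (rule cdiff_inverse[OF sc.cha W_mem(2)[OF x] mn[OF cdiff_l[OF x]] u_facts(1)[OF x]])
  show 2: "cdiff c x u"
    unfolding u_def[abs_def] by (rule cdiff_diff[OF cdiff_bilinear[OF bounded_bilinear_smult 1 cdiff_l[OF x]] cdiff_nW[OF x]])
  show 3: "cdiff c x w"
    unfolding w_def[abs_def] by (rule cdiff_linear[OF bounded_linear_conjv 2])
  show 4: "cdiff c x lt"
    unfolding lt_def[abs_def] by (rule cdiff_gauge[OF x 3 cdiff_l[OF x]])
  show 5: "cdiff c x (\<lambda>y. inverse (mink (lt y) (n y)))"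
    by (rule cdiff_inverse[OF sc.cha W_mem(2)[OF x] mn[OF 4] ut_facts(1)[OF x]])
  show "cdiff c x ut"
    unfolding ut_def[abs_def] by (rule cdiff_diff[OF cdiff_bilinear[OF bounded_bilinear_smult 5 4] cdiff_nW[OF x]])
qed

abbreviation "refl_ut y \<equiv> gauge (-1) (ut y) (n y)"
abbreviation "refl_w y \<equiv> gauge (-1) (w y) (n y)"
text \<open>By \<open>r_star_eq\<close>, \<open>plane10\<close> is the image of the (1,0)-plane
  under the dressing at infinity, and \<open>plane01\<close> that of the (0,1)-plane under the
  dressing at 0.\<close>

abbreviation "plane10 y \<equiv> refl_ut y ` null_plane (-\<i>) y"
abbreviation "plane01 y \<equiv> refl_w y ` null_plane \<i> y"
abbreviation "nabla_at x \<equiv> normal_bundle.nabla x n"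
abbreviation "gauge_data_at e x \<equiv> normal_bundle.gauge_data x W (cdiff c x) (cdiff c x) (\<lambda>h. wirts e c h x) n"
abbreviation "parallel_at x \<equiv> normal_bundle.parallel_normal x W (cdiff c x) n"

lemma l_parallel:
  assumes x: "x \<in> W"
  shows "\<exists>k. nabla0 (-\<i>) x (inverse \<alpha>) l = k *s l x"
    "\<exists>k. nabla0 \<i> x \<alpha> l = k *s l x"
proof -
  have "section_on M L Wl l"
    using lift_l by (simp add: lift_on_def)
  then have "dlq_z M \<Lambda> (q_inf M \<Lambda> v_inf N t) \<alpha> c l x \<in> L x" "dlq_zbar M \<Lambda> (q_inf M \<Lambda> v_inf N t) \<alpha> c l x \<in> L x"
    using par hol_c x W W_l unfolding baecklund_parameters_def dlq_parallel_def by blast+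
  then show "\<exists>k. nabla0 (-\<i>) x (inverse \<alpha>) l = k *s l x"
    "\<exists>k. nabla0 \<i> x \<alpha> l = k *s l x"
    unfolding dlq_formula[OF x cdiff_l[OF x]] l_facts(1)[OF x] span_single by blast+
qed

lemma w_section: "w = (\<lambda>y. inverse (mink (conjv (l y)) (n y)) *s conjv (l y) - n y)"
  by (simp add: fun_eq_iff w_def u_def conjv_diff conjv_scale n_real) (metis mink_conjv n_real)

text \<open>The conjugate of parallelism along d/dzbar is parallelism along d/dz, and vice versa;
  both parameters below mean \<lambda> = \<open>b\<close>.\<close>

lemma w_parallel:
  assumes x: "x \<in> W"
  shows "parallel_at x (D0 (-\<i>) x) (\<nu> (-\<i>) x) (A (-\<i>) x) (cnj \<alpha>) w" "parallel_at x (D0 \<i> x) (\<nu> \<i> x) (A \<i> x) b w"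
proof -
  have cl: "cdiff c x (\<lambda>y. conjv (l y))"
    by (rule cdiff_linear[OF bounded_linear_conjv cdiff_l[OF x]])
  have nz: "mink (conjv (l y)) (n y) \<noteq> 0" if "y \<in> W" for y
    using u_facts(1)[OF that] mink_conjv[of "l y" "n y"] by (simp add: n_real)
  have inv: "cdiff c x (\<lambda>y. inverse (mink (conjv (l y)) (n y)))"
    by (rule cdiff_inverse[OF sc.cha W_mem(2)[OF x] cdiff_bilinear[OF bounded_bilinear_mink cl cdiff_nW[OF x]] nz[OF x]])
  have hyp: "hyp_pair (inverse (mink (conjv (l y)) (n y)) *s conjv (l y) - n y) (n y)" if "y \<in> W" for y
    using w_facts(1)[OF that] unfolding w_section .
  obtain k1 where k1: "nabla0 (-\<i>) x (inverse \<alpha>) l = k1 *s l x"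
    using l_parallel(1)[OF x] by blast
  obtain k2 where k2: "nabla0 \<i> x \<alpha> l = k2 *s l x"
    using l_parallel(2)[OF x] by blast
  have 1: "nabla0 (-\<i>) x (cnj \<alpha>) (\<lambda>y. conjv (l y)) = cnj k2 *s conjv (l x)"
    using nabla_conj[OF x cdiff_l[OF x], of \<i> \<alpha>] unfolding k2 by (simp add: conjv_scale)
  have 2: "nabla0 \<i> x b (\<lambda>y. conjv (l y)) = cnj k1 *s conjv (l x)"
    using nabla_conj[OF x cdiff_l[OF x], of "-\<i>" "inverse \<alpha>"] unfolding k1 by (simp add: conjv_scale b_def)
  interpret z: normal_bundle x W "cdiff c x" "cdiff c x" "\<lambda>h. wirts (-\<i>) c h x" n
    by (rule bundle_at[OF x])
  interpret zb: normal_bundle x W "cdiff c x" "cdiff c x" "\<lambda>h. wirts \<i> c h x" n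
    by (rule bundle_at[OF x])
  show "parallel_at x (D0 (-\<i>) x) (\<nu> (-\<i>) x) (A (-\<i>) x) (cnj \<alpha>) w"
    unfolding w_section
    by (rule z.parallel_normal_section[OF gauge_data_initial[OF x] cl inv nz[OF x] 1 hyp]) auto
  show "parallel_at x (D0 \<i> x) (\<nu> \<i> x) (A \<i> x) b w"
    unfolding w_section
    by (rule zb.parallel_normal_section[OF gauge_data_initial[OF x] cl inv nz[OF x] 2 hyp]) auto
qed

text \<open>For d/dz the first gauge is of type II and reflects \<open>F\<close> by
  \<open>w\<close>, the second of type I and reflects \<open>E\<close> by \<open>ut\<close>.\<close>

lemma two_step_z:
  assumes x: "x \<in> W"
  shows "\<exists>D2 \<nu>2 A2. gauge_data_at (-\<i>) x D2 \<nu>2 A2 (\<lambda>y. plane10 y)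
      (plane01 x) \<and>
    (\<forall>f. cdiff c x f \<longrightarrow> nabla_at x D2 \<nu>2 A2 1 (\<lambda>y. T y (f y)) = T x (wirt (-\<i>) c f x))"
proof -
  interpret normal_bundle x W "cdiff c x" "cdiff c x" "\<lambda>h. wirts (-\<i>) c h x" n
    by (rule bundle_at[OF x])
  note g0 = gauge_data_initial[OF x, of "-\<i>", simplified]
  have c0: "cnj \<alpha> \<noteq> 0" "inverse \<alpha> \<noteq> 0"
    using params(1) by auto
  obtain \<nu>1 A1 where g1: "gauge_data (D0 (-\<i>) x) \<nu>1 A1 (\<lambda>y. null_plane (-\<i>) y) (plane01 x)"
    and n1: "\<And>m f. m\<^sup>2 \<noteq> (cnj \<alpha>)\<^sup>2 \<Longrightarrow> cdiff c x f \<Longrightarrow>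
      nabla (D0 (-\<i>) x) \<nu>1 A1 m (\<lambda>y. gauge ((cnj \<alpha> - m) / (cnj \<alpha> + m)) (w y) (n y) (f y))
        = gauge ((cnj \<alpha> - m) / (cnj \<alpha> + m)) (w x) (n x) (nabla (D0 (-\<i>) x) (\<nu> (-\<i>) x) (A (-\<i>) x) m f)"
    using gauge_type_II[OF g0 w_parallel(1)[OF x] c0(1)] by blast
  have m2: "(inverse \<alpha>)\<^sup>2 \<noteq> (cnj \<alpha>)\<^sup>2" "1\<^sup>2 \<noteq> (cnj \<alpha>)\<^sup>2" "1\<^sup>2 \<noteq> (inverse \<alpha>)\<^sup>2"
    using params unfolding params(3) power_inverse by simp_all
  obtain k where k: "nabla (D0 (-\<i>) x) (\<nu> (-\<i>) x) (A (-\<i>) x) (inverse \<alpha>) l = k *s l x"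
    using l_parallel(1)[OF x] by blast
  \<comment> \<open>The first gauge intertwines the families at every parameter off its poles, so
    \<open>lt\<close> inherits from \<open>l\<close> its parallelism at the second pole.\<close>
  have "nabla (D0 (-\<i>) x) \<nu>1 A1 (inverse \<alpha>) lt = k *s lt x"
    using n1[OF m2(1) cdiff_l[OF x]] unfolding kappa_alt(2)[symmetric] lt_def[symmetric] k by (simp add: gauge_scale lt_def[abs_def])
  then have p: "parallel_normal (D0 (-\<i>) x) \<nu>1 A1 (inverse \<alpha>) ut"
    unfolding ut_def[abs_def]
    by (rule parallel_normal_section[OF g1 cdiff_uw(4,5)[OF x] ut_facts(1)[OF x]]) (use ut_facts(2) in \<open>simp add: ut_def\<close>)
  obtain D2 \<nu>2 A2 where g2: "gauge_data D2 \<nu>2 A2 (\<lambda>y. plane10 y) (plane01 x)"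
    and n2: "\<And>m f. m\<^sup>2 \<noteq> (inverse \<alpha>)\<^sup>2 \<Longrightarrow> cdiff c x f \<Longrightarrow>
      nabla D2 \<nu>2 A2 m (\<lambda>y. gauge ((m - inverse \<alpha>) / (m + inverse \<alpha>)) (ut y) (n y) (f y))
      = gauge ((m - inverse \<alpha>) / (m + inverse \<alpha>)) (ut x) (n x) (nabla (D0 (-\<i>) x) \<nu>1 A1 m f)"
    using gauge_type_I[OF g1 p c0(2)] by blast
  have "nabla D2 \<nu>2 A2 1 (\<lambda>y. T y (f y)) = T x (wirt (-\<i>) c f x)" if f: "cdiff c x f" for f
    using n2[OF m2(3) cdiff_gauge[OF x cdiff_uw(3)[OF x] f, of \<kappa>1]] n1[OF m2(2) f]
    unfolding kappa_alt(1,3)[symmetric] nabla_one[OF x] by (simp add: T_def)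
  then show ?thesis
    using g2 by blast
qed

text \<open>The types come in the opposite order, yet \<open>w\<close> and \<open>ut\<close> act on
  the same planes as for d/dz; only the names \<open>E\<close> and \<open>F\<close> are
  exchanged.\<close>

lemma two_step_zbar:
  assumes x: "x \<in> W"
  shows "\<exists>D2 \<nu>2 A2. gauge_data_at \<i> x D2 \<nu>2 A2 (\<lambda>y. plane01 y)
      (plane10 x) \<and>
    (\<forall>f. cdiff c x f \<longrightarrow> nabla_at x D2 \<nu>2 A2 1 (\<lambda>y. T y (f y)) = T x (wirt \<i> c f x))"
proof -
  interpret normal_bundle x W "cdiff c x" "cdiff c x" "\<lambda>h. wirts \<i> c h x" n
    by (rule bundle_at[OF x])
  note g0 = gauge_data_initial[OF x, of "\<i>", simplified]
  obtain D1 \<nu>1 A1 where g1: "gauge_data D1 \<nu>1 A1 (\<lambda>y. plane01 y) (null_plane (-\<i>) x)"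
    and n1: "\<And>m f. m\<^sup>2 \<noteq> b\<^sup>2 \<Longrightarrow> cdiff c x f \<Longrightarrow>
      nabla D1 \<nu>1 A1 m (\<lambda>y. gauge ((m - b) / (m + b)) (w y) (n y) (f y))
      = gauge ((m - b) / (m + b)) (w x) (n x) (nabla (D0 \<i> x) (\<nu> \<i> x) (A \<i> x) m f)"
    using gauge_type_I[OF g0 w_parallel(2)[OF x] params(2)] by blast
  have m2: "\<alpha>\<^sup>2 \<noteq> b\<^sup>2" "1\<^sup>2 \<noteq> b\<^sup>2" "1\<^sup>2 \<noteq> \<alpha>\<^sup>2"
    using params by simp_all
  obtain k where k: "nabla (D0 \<i> x) (\<nu> \<i> x) (A \<i> x) \<alpha> l = k *s l x"
    using l_parallel(2)[OF x] by blast
  have "nabla D1 \<nu>1 A1 \<alpha> lt = k *s lt x"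
    using n1[OF m2(1) cdiff_l[OF x]] unfolding \<kappa>a_def[symmetric] lt_def[symmetric] k by (simp add: gauge_scale lt_def[abs_def])
  then have p: "parallel_normal D1 \<nu>1 A1 \<alpha> ut"
    unfolding ut_def[abs_def]
    by (rule parallel_normal_section[OF g1 cdiff_uw(4,5)[OF x] ut_facts(1)[OF x]]) (use ut_facts(2) in \<open>simp add: ut_def\<close>)
  obtain \<nu>2 A2 where g2: "gauge_data D1 \<nu>2 A2 (\<lambda>y. plane01 y) (plane10 x)"
    and n2: "\<And>m f. m\<^sup>2 \<noteq> \<alpha>\<^sup>2 \<Longrightarrow> cdiff c x f \<Longrightarrow>
      nabla D1 \<nu>2 A2 m (\<lambda>y. gauge ((\<alpha> - m) / (\<alpha> + m)) (ut y) (n y) (f y))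
        = gauge ((\<alpha> - m) / (\<alpha> + m)) (ut x) (n x) (nabla D1 \<nu>1 A1 m f)"
    using gauge_type_II[OF g1 p params(1)] by blast
  have "nabla D1 \<nu>2 A2 1 (\<lambda>y. T y (f y)) = T x (wirt \<i> c f x)" if f: "cdiff c x f" for f
    using n2[OF m2(3) cdiff_gauge[OF x cdiff_uw(3)[OF x] f, of \<kappa>1]] n1[OF m2(2) f]
    unfolding \<kappa>1_def[symmetric] \<kappa>2_def[symmetric] nabla_one[OF x] by (simp add: T_def)
  then show ?thesis
    using g2 by blast
qed

lemma T_isometry: "y \<in> W \<Longrightarrow> mink (T y v) (T y v') = mink v v'"
  by (simp add: T_def gauge_isometry[OF ut_facts(2) params(9)] gauge_isometry[OF w_facts(1) params(8)])

lemma T_surj: "y \<in> W \<Longrightarrow> T y (inv (T y) v) = v"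
proof -
  assume y: "y \<in> W"
  have "T y (gauge (inverse \<kappa>1) (w y) (n y) (gauge (inverse \<kappa>2) (ut y) (n y) v)) = v"
    unfolding T_def using params(8,9) by (simp add: gauge_gauge[OF w_facts(1)[OF y]] gauge_gauge[OF ut_facts(2)[OF y]] gauge_one)
  then have "v \<in> range (T y)"
    by (metis rangeI)
  then show ?thesis
    by (rule f_inv_into_f)
qed

text \<open>At 0 the second factor has parameter 1 and the first -1; at infinity it is the other way
  round.\<close>

lemma r_star_eq:
  assumes y: "y \<in> W"
  shows "r_star (rho M \<Lambda> y) \<alpha> (L y) 1 = T y"
    "r_star (rho M \<Lambda> y) \<alpha> (L y) 0 = refl_w y"
    "r_star_infinity (rho M \<Lambda> y) \<alpha> (L y) = refl_ut y"
proof -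
  note eqs = rho[OF W_mem(3)[OF y]] L_tilde[OF y] ut_facts(3)[OF y] w_facts(2)[OF y] p_gauge_eq[OF ut_facts(2)[OF y]] q_gauge_eq[OF w_facts(1)[OF y]]
    p_gauge_infinity_eq[OF ut_facts(2)[OF y]] b_def[symmetric]
  show "r_star (rho M \<Lambda> y) \<alpha> (L y) 1 = T y"
    unfolding r_star_def eqs \<kappa>1_def[symmetric] \<kappa>2_def[symmetric] by (simp add: fun_eq_iff T_def)
  show "r_star (rho M \<Lambda> y) \<alpha> (L y) 0 = refl_w y"
    unfolding r_star_def eqs using params(1,2) by (simp add: fun_eq_iff gauge_one)
  show "r_star_infinity (rho M \<Lambda> y) \<alpha> (L y) = refl_ut y"
    unfolding r_star_infinity_def eqs by (simp add: fun_eq_iff q_gauge_infinity_def)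
qed

lemma T_v_inf:
  assumes x: "x \<in> W"
  shows "mink (T x (cplx v_inf)) (n x) = - H x"
proof -
  define h1 h2 where "h1 = (H x - \<i> * of_real t) / 2" and "h2 = (H x + \<i> * of_real t) / 2"
  define e where "e = cplx (vT M \<Lambda> v_inf x)"
  note xM = W_mem(3)[OF x]
  have en: "mink e (n x) = 0"
    by (simp add: e_def n_def mink_cplx v_inf_parts[OF xM] mink_simps NN[OF xM])
  \<comment> \<open>\<open>v_inf\<close> is the value of \<open>p_inf\<close> at \<zeta> = 1, since
    \<open>h1\<close> and \<open>h2\<close> add up to \<open>H x\<close>; the factors 1 are kept to
    match that form.\<close>
  have v: "cplx v_inf = (h1 / 1) *s n x + e + (1 * h2) *s n x"
  proof -
    have "h1 + h2 = H x"
      by (simp add: h1_def h2_def field_simps)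
    then have "(h1 / 1) *s n x + e + (1 * h2) *s n x = H x *s n x + e"
      by (simp add: vec_eq_iff algebra_simps flip: distrib_right)
    also have "\<dots> = cplx v_inf"
      by (simp add: H_def e_def n_def v_inf_parts[OF xM] vec_eq_iff cplx_def)
    finally show ?thesis ..
  qed
  have p: "p_inf M \<Lambda> v_inf N t \<zeta> x = (h1 / \<zeta>) *s n x + e + (\<zeta> * h2) *s n x" for \<zeta>
  proof -
    have "inverse \<zeta> * (1 / 2) * (H x - \<i> * of_real t) = h1 / \<zeta>" "\<zeta> * (1 / 2) * (H x + \<i> * of_real t) = \<zeta> * h2"
      by (cases "\<zeta> = 0"; simp add: h1_def h2_def field_simps)+
    then show ?thesis
      unfolding p_inf_def Let_def H_def[symmetric] e_def[symmetric] by (simp only: n_def o_apply)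
  qed
  have pu: "mink (p_inf M \<Lambda> v_inf N t \<alpha> x) (u x + n x) = 0"
  proof -
    have "u x + n x \<in> L x"
      unfolding u_facts(3)[OF x] by (rule vec.span_base) simp
    then show ?thesis
      using perp[OF xM] by (auto simp: mem_orth mink_commute)
  qed
  have pl: "mink (p_inf M \<Lambda> v_inf N t \<alpha> x) (l x) = 0"
    using perp[OF xM] l_facts(1)[OF x] vec.span_base[of "l x" "{l x}"] by (auto simp: mem_orth mink_commute)
  \<comment> \<open>\<open>h1\<close> and \<open>h2\<close> are conjugate to each other, so
    conjugating \<open>p_inf\<close> inverts and conjugates its parameter. Hence orthogonality to
    \<open>L\<close> at \<open>\<alpha>\<close> gives orthogonality to the conjugate line at
    \<open>b\<close>.\<close>
  have "conjv (p_inf M \<Lambda> v_inf N t \<alpha> x) = p_inf M \<Lambda> v_inf N t b x"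
    unfolding p by (simp add: conjv_add conjv_scale n_real e_def h1_def h2_def H_def b_def field_simps vec_eq_iff)
  then have pw: "mink ((h1 / b) *s n x + e + (b * h2) *s n x) (w x + n x) = 0"
    using mink_conjv[of "p_inf M \<Lambda> v_inf N t \<alpha> x" "u x + n x"] pu unfolding p[symmetric] by (simp add: conjv_add w_def n_real)
  define e1 where "e1 = refl_w x (e - (2 * h1 / b) *s w x)"
  have q: "gauge ((\<zeta> - b) / (\<zeta> + b)) (w x) (n x) (p_inf M \<Lambda> v_inf N t \<zeta> x) = (- h1 / \<zeta>) *s n x + e1 + (\<zeta> * h2) *s n x"
    if "\<zeta> \<noteq> 0" "b\<^sup>2 \<noteq> \<zeta>\<^sup>2" for \<zeta>
    unfolding p e1_def by (rule gauge_q_section[OF w_facts(1)[OF x] en params(2) that pw])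
  have e1n: "mink e1 (n x) = 0"
    unfolding e1_def gauge_minus_one_swap[OF w_facts(1)[OF x]] gauge_minus_one_normal[OF w_facts(1)[OF x]]
    using w_facts(1)[OF x] by (simp add: mink_simps en hyp_pair_def)
  \<comment> \<open>The first gauge is an isometry that carries \<open>l\<close> to
    \<open>lt\<close>, so orthogonality at \<open>\<alpha>\<close> survives and the second gauge can
    use it.\<close>
  have "mink ((- h1 / \<alpha>) *s n x + e1 + (\<alpha> * h2) *s n x) (lt x) = 0"
    unfolding q[OF params(1) params(6)[symmetric], symmetric] lt_def \<kappa>a_def[symmetric]
    by (simp add: gauge_isometry[OF w_facts(1)[OF x] params(7)] pl)
  moreover have "ut x + n x = inverse (mink (lt x) (n x)) *s lt x"
    by (simp add: ut_def)
  ultimately have pt: "mink ((- h1 / \<alpha>) *s n x + e1 + (\<alpha> * h2) *s n x) (ut x + n x) = 0"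
    by (simp only: mink_simps(6) mult_zero_right)
  have 1: "gauge \<kappa>1 (w x) (n x) (cplx v_inf) = (- h1 / 1) *s n x + e1 + (1 * h2) *s n x"
    unfolding v p[symmetric] \<kappa>1_def by (rule q) (use params(5) in auto)
  have "T x (cplx v_inf) = (- h1 / 1) *s n x + (e1 - (2 * (- h1) / \<alpha>) *s ut x) - (1 * h2) *s n x"
    unfolding T_def 1 \<kappa>2_def
    by (rule gauge_p_section[OF ut_facts(2)[OF x] e1n params(1) _ _ pt]) (use params(4) in auto)
  also have "mink \<dots> (n x) = - h1 - h2"
    using ut_facts(2)[OF x] by (simp add: mink_simps e1n hyp_pair_def)
  also have "\<dots> = - H x"
    by (simp add: h1_def h2_def field_simps)
  finally show ?thesis .
qed

end

subsection \<open>Sections of the transform\<close>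

context cmc_chart
begin

text \<open>The factor between two lifts is known point by point only, without smoothness. So
  instead of differentiating it, the relations of the second lift with n, s and the derivative of s
  are differentiated, and maximality of the null plane gives membership.\<close>

lemma lift_derivative_span:
  assumes sc1: "surface_chart M \<Lambda> c1 V1 \<sigma>1" and y: "y \<in> W" "y \<in> fst c1" "y \<in> V1"
  shows "vec.span {cplx (\<sigma>1 y), dz c1 (cplx \<circ> \<sigma>1) y} \<subseteq> null_plane (-\<i>) y"
    and "vec.span {cplx (\<sigma>1 y), dzbar c1 (cplx \<circ> \<sigma>1) y} \<subseteq> null_plane \<i> y"
proof -
  interpret sc1: surface_chart M \<Lambda> c1 V1 \<sigma>1
    by fact
  note yU = W_mem(1)[OF y(1)]
  have y1: "y \<in> sc1.U"
    using y by (simp add: sc1.U_def)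
  have cd: "cdiff c y sc1.s" "cdiff c1 y sc1.s"
  proof -
    have "csmooth c (fst c \<inter> V1) sc1.s"
      unfolding sc1.s_def by (rule lift_csmooth_cplx[OF surf sc.ori sc1.lift])
    then show "cdiff c y sc1.s"
      by (rule csmooth_cdiff[OF sc.cha]) (use y W in blast)
    show "cdiff c1 y sc1.s"
      by (rule sc1.cdiff_s(1)[OF y1])
  qed
  obtain p where p: "p \<noteq> 0" "dz c sc1.s y = p *s dz c1 sc1.s y" "dzbar c sc1.s y = cnj p *s dzbar c1 sc1.s y"
    using hol_charts_transition[OF surf imm hol_c sc1.hol _ y(2)] W_mem(2)[OF y(1)] cd(2) by blast
  have proportional: "\<exists>k. sc1.s z = k *s sc.s z" if z: "z \<in> sc.U \<inter> V1" for z
  proof -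
    have "\<sigma>1 z \<in> \<Lambda> z"
      using lift_onD(4)[OF sc1.lift] z by blast
    then obtain k where "\<sigma>1 z = k *s \<sigma> z"
      using immersed_lift(1)[OF imm lift_V] sc.U(2) z by (auto simp: span_single)
    then have "sc1.s z = of_real k *s sc.s z"
      by (simp add: sc1.s_def sc.s_def cplx_def vec_eq_iff)
    then show ?thesis
      by blast
  qed
  have W': "open (sc.U \<inter> V1)" "y \<in> sc.U \<inter> V1"
    using sc.U(3) lift_onD(1)[OF sc1.lift] yU y by auto
  obtain k where k: "sc1.s y = k *s sc.s y"
    using proportional[OF W'(2)] by blast
  have gen: "wirt e c sc1.s y \<in> null_plane e y" if e: "e \<in> {\<i>, -\<i>}" for e
  proof -
    have "mink (wirt e c sc1.s y) (n y) + mink (sc1.s y) (wirt e c n y) = 0"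
    proof (rule mink_wirt_orth[OF sc.cha open_Int[OF W(1) W'(1)] _ W_mem(2)[OF y(1)] cd(1) cdiff_nW[OF y(1)], where k = 0])
      show "y \<in> W \<inter> (sc.U \<inter> V1)"
        using y(1) W'(2) by blast
      fix z assume "z \<in> W \<inter> (sc.U \<inter> V1)"
      then show "mink (sc1.s z) (n z) = 0"
        using proportional[of z] n_frame(1)[of z] by (auto simp: mink_simps)
    qed
    moreover have "mink (wirt e c sc1.s y) (sc.s y) + mink (sc1.s y) (wirt e c sc.s y) = 0"
    proof (rule mink_wirt_orth[OF sc.cha W' W_mem(2)[OF y(1)] cd(1) sc.cdiff_s(1)[OF yU], where k = 0])
      fix z assume "z \<in> sc.U \<inter> V1"
      then show "mink (sc1.s z) (sc.s z) = 0"
        using proportional[of z] sc.ss[of z] by (auto simp: mink_simps)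
    qed
    moreover have "mink (wirt e c sc1.s y) (sc.s' e y) + mink (sc1.s y) (wirt e c (sc.s' e) y) = 0"
    proof (rule mink_wirt_orth[OF sc.cha W' W_mem(2)[OF y(1)] cd(1) sc.cdiff_s(2)[OF yU], where k = 0])
      fix z assume "z \<in> sc.U \<inter> V1"
      then show "mink (sc1.s z) (sc.s' e z) = 0"
        using proportional[of z] sc.ss'[of z e] by (auto simp: mink_simps)
    qed
    moreover have "mink (sc.s y) (wirt e c sc.s y) = 0"
      using sc.ss'[OF yU, of e] by (simp add: sc.s'_def)
    ultimately have "mink (wirt e c sc1.s y) (n y) = 0" "mink (wirt e c sc1.s y) (sc.s y) = 0" "mink (wirt e c sc1.s y) (sc.s' e y) = 0"
      using n'_frame(1)[OF y(1) e] sc.second_order(1)[OF yU e]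
      by (simp_all add: k mink_simps mink_commute[of "sc.s y" "wirt e c n y"])
    then show ?thesis
      using e sc.frame_span(2,3)[OF yU nn[OF W_mem(3)[OF y(1)]] n_frame(1)[OF y(1)] n_frame(2)[OF y(1)] n_frame(2)[OF y(1)] n_frame(3)[OF y(1)]]
      by auto
  qed
  have s1: "cplx (\<sigma>1 y) \<in> vec.span {sc.s y, v}" for v
    using k vec.span_scale[OF vec.span_base[of "sc.s y" "{sc.s y, v}"], of k] by (simp add: sc1.s_def)
  have "dz c1 sc1.s y = inverse p *s wirt (-\<i>) c sc1.s y" "dzbar c1 sc1.s y = inverse (cnj p) *s wirt \<i> c sc1.s y"
    using p by (simp_all add: dz_wirt)
  then have d1: "dz c1 (cplx \<circ> \<sigma>1) y \<in> null_plane (-\<i>) y" "dzbar c1 (cplx \<circ> \<sigma>1) y \<in> null_plane \<i> y"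
    using gen[of "-\<i>"] gen[of \<i>] vec.span_scale by (simp_all add: sc1.s_def)
  show "vec.span {cplx (\<sigma>1 y), dz c1 (cplx \<circ> \<sigma>1) y} \<subseteq> null_plane (-\<i>) y"
    "vec.span {cplx (\<sigma>1 y), dzbar c1 (cplx \<circ> \<sigma>1) y} \<subseteq> null_plane \<i> y"
    by (rule vec.span_minimal; use s1 d1 in simp)+
qed

lemma Lam_subset:
  assumes y: "y \<in> W"
  shows "Lam10 M \<Lambda> y \<subseteq> null_plane (-\<i>) y" "Lam01 M \<Lambda> y \<subseteq> null_plane \<i> y"
proof -
  have ex: "\<exists>V1 \<sigma>1. surface_chart M \<Lambda> c1 V1 \<sigma>1 \<and> y \<in> fst c1 \<and> y \<in> V1 \<and> s1 = cplx \<circ> \<sigma>1"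
    if "chart_lift_at M \<Lambda> y c1 s1" for c1 s1
    using that surf imm unfolding chart_lift_at_def surface_chart_def by blast
  show "Lam10 M \<Lambda> y \<subseteq> null_plane (-\<i>) y"
    unfolding Lam10_def using ex lift_derivative_span(1)[OF _ y] by fastforce
  show "Lam01 M \<Lambda> y \<subseteq> null_plane \<i> y"
    unfolding Lam01_def using ex lift_derivative_span(2)[OF _ y] by fastforce
qed

lemma frame_isotropic:
  assumes y: "y \<in> W" and e: "e \<in> {\<i>, -\<i>}" and v: "v \<in> null_plane e y" "v' \<in> null_plane e y"
  shows "mink v v' = 0" "mink v (n y) = 0"
proof -
  note yU = W_mem(1)[OF y]
  have "mink (sc.s' e y) (sc.s y) = 0"
    using sc.ss'[OF yU, of e] by (simp add: mink_commute)
  then show "mink v v' = 0" "mink v (n y) = 0"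
    using v sc.ss[OF yU] sc.ss'[OF yU, of e] sc.s's'[OF yU e] n_frame(1)[OF y] n_frame(2)[OF y e]
    by (auto simp: span_pair mink_simps)
qed

lemma frame_maximal:
  assumes y: "y \<in> W" and e: "e \<in> {\<i>, -\<i>}" and v: "mink v (n y) = 0" "mink v (sc.s y) = 0" "mink v (sc.s' e y) = 0"
  shows "v \<in> null_plane e y"
  using e v sc.frame_span(2,3)[OF W_mem(1)[OF y] nn[OF W_mem(3)[OF y]] n_frame(1)[OF y] n_frame(2)[OF y] n_frame(2)[OF y] n_frame(3)[OF y]]
  by auto

lemma reflected_isotropic:
  assumes y: "y \<in> W" and e: "e \<in> {\<i>, -\<i>}" and h: "hyp_pair v (n y)"
    and a: "a \<in> gauge (-1) v (n y) ` null_plane e y" "a' \<in> gauge (-1) v (n y) ` null_plane e y"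
  shows "mink a a' = 0" "mink a (n y) = 0"
proof -
  obtain p p' where p: "a = gauge (-1) v (n y) p" "p \<in> null_plane e y" "a' = gauge (-1) v (n y) p'" "p' \<in> null_plane e y"
    using a by blast
  show "mink a a' = 0"
    unfolding p(1,3) gauge_minus_one_isometry[OF h] by (rule frame_isotropic(1)[OF y e p(2,4)])
  show "mink a (n y) = 0"
    unfolding p(1) gauge_minus_one_swap[OF h] gauge_minus_one_normal[OF h]
    using frame_isotropic(2)[OF y e p(2) p(2)] by (simp add: mink_simps)
qed

text \<open>Transported from \<open>frame_maximal\<close> by an isometric involution that preserves
  the complement of \<open>n\<close>.\<close>

lemma reflected_maximal:
  assumes y: "y \<in> W" and e: "e \<in> {\<i>, -\<i>}" and h: "hyp_pair v (n y)"
    and a: "mink a (n y) = 0" "\<And>g. g \<in> gauge (-1) v (n y) ` null_plane e y \<Longrightarrow> mink a g = 0"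
  shows "a \<in> gauge (-1) v (n y) ` null_plane e y"
proof (rule image_eqI[where x = "gauge (-1) v (n y) a"])
  show "a = gauge (-1) v (n y) (gauge (-1) v (n y) a)"
    by (simp add: gauge_minus_one_invol[OF h])
  have m: "sc.s y \<in> null_plane e y" "sc.s' e y \<in> null_plane e y"
    by (simp_all add: vec.span_base)
  show "gauge (-1) v (n y) a \<in> null_plane e y"
  proof (rule frame_maximal[OF y e])
    show "mink (gauge (-1) v (n y) a) (n y) = 0"
      unfolding gauge_minus_one_swap[OF h] gauge_minus_one_normal[OF h] by (simp add: mink_simps a(1))
    show "mink (gauge (-1) v (n y) a) (sc.s y) = 0" "mink (gauge (-1) v (n y) a) (sc.s' e y) = 0"
      unfolding gauge_minus_one_swap[OF h] by (rule a(2), use m in blast)+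
  qed
qed

end

context baecklund_chart
begin

lemma transform_section:
  assumes y: "y \<in> W" and f: "f \<in> baecklund_transform M \<Lambda> \<alpha> L y"
  shows "T y f \<in> plane10 y"
    "T y f \<in> plane01 y"
proof -
  obtain z where z: "f = inv (T y) z" "z \<in> refl_ut y ` Lam10 M \<Lambda> y" "z \<in> refl_w y ` Lam01 M \<Lambda> y"
    using f unfolding baecklund_transform_def r_star_eq[OF y] by blast
  have "T y f = z"
    unfolding z(1) by (rule T_surj[OF y])
  then show "T y f \<in> plane10 y"
    "T y f \<in> plane01 y"
    using z(2,3) Lam_subset[OF y] by blast+
qed

lemma cdiff_T: "x \<in> W \<Longrightarrow> cdiff c x f \<Longrightarrow> cdiff c x (\<lambda>y. T y (f y))"
  unfolding T_def by (intro cdiff_gauge cdiff_uw) auto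

text \<open>\<open>T f\<close> lies in \<open>F\<close> and is orthogonal to \<open>n\<close>, so
  the gauged family at 1 acts on it as \<open>D2\<close> alone. As \<open>T f\<close> is also a
  section of \<open>E\<close>, its \<open>D2\<close>-derivative is orthogonal to \<open>E\<close>,
  and maximality puts it back into \<open>E\<close>.\<close>

lemma section_derivatives:
  assumes f: "\<And>y. y \<in> W \<Longrightarrow> f y \<in> baecklund_transform M \<Lambda> \<alpha> L y" and fd: "\<And>y. y \<in> W \<Longrightarrow> cdiff c y f" and y: "y \<in> W"
  shows "T y (wirt (-\<i>) c f y) \<in> plane10 y"
    "T y (wirt \<i> c f y) \<in> plane01 y"
proof -
  note Tf = transform_section[OF _ f]
  have Tn: "mink (T z (f z)) (n z) = 0" if z: "z \<in> W" for z
    using reflected_isotropic(2)[OF z _ w_facts(1)[OF z] Tf(2)[OF z z] Tf(2)[OF z z]] by simp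
  note cT = cdiff_T[OF y fd[OF y]]
  have plane: "T y (wirt e c f y) \<in> gauge (-1) (v y) (n y) ` null_plane e y"
    if e: "e \<in> {\<i>, -\<i>}" and v: "hyp_pair (v y) (n y)" and g: "gauge_data_at e y D2 \<nu>2 A2 (\<lambda>y. gauge (-1) (v y) (n y) ` null_plane e y) F"
      and D: "nabla_at y D2 \<nu>2 A2 1 (\<lambda>y. T y (f y)) = T y (wirt e c f y)" and F: "T y (f y) \<in> F"
      and E: "\<And>z. z \<in> W \<Longrightarrow> T z (f z) \<in> gauge (-1) (v z) (n z) ` null_plane e z"
    for e v D2 \<nu>2 A2 F
  proof -
    interpret normal_bundle y W "cdiff c y" "cdiff c y" "\<lambda>h. wirts e c h y" n
      by (rule bundle_at[OF y])
    have nn: "T y (wirt e c f y) = D2 (\<lambda>y. T y (f y))" "mink (T y (wirt e c f y)) (n y) = 0"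
      using nabla_normal[OF g cT Tn F, of 1] unfolding D by simp_all
    show ?thesis
    proof (rule reflected_maximal[OF y e v nn(2)])
      fix h assume h: "h \<in> gauge (-1) (v y) (n y) ` null_plane e y"
      show "mink (T y (wirt e c f y)) h = 0"
        unfolding nn(1) by (rule gauge_dataD(8)[OF g cT _ h]) (rule E)
    qed
  qed
  show "T y (wirt (-\<i>) c f y) \<in> plane10 y"
    using two_step_z[OF y] fd[OF y] plane[OF _ ut_facts(2)[OF y] _ _ Tf(2)[OF y y] Tf(1)] by fastforce
  show "T y (wirt \<i> c f y) \<in> plane01 y"
    using two_step_zbar[OF y] fd[OF y] plane[OF _ w_facts(1)[OF y] _ _ Tf(1)[OF y y] Tf(2)] by fastforce
qed

lemma section_frame:
  assumes f: "\<And>y. y \<in> W \<Longrightarrow> f y \<in> baecklund_transform M \<Lambda> \<alpha> L y" and fd: "\<And>y. y \<in> W \<Longrightarrow> cdiff c y f"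
    and fd': "\<And>y. y \<in> W \<Longrightarrow> cdiff c y (wirt \<i> c f)" and x: "x \<in> W"
  defines "m \<equiv> inv (T x) (n x)"
  shows "mink (wirt (-\<i>) c f x) (wirt (-\<i>) c f x) = 0" "mink (f x) m = 0" "mink (wirt (-\<i>) c f x) m = 0"
    "mink (wirt \<i> c f x) m = 0" "mink (wirt (-\<i>) c (wirt \<i> c f) x) m = 0"
    "mink m m = 1" "mink (cplx v_inf) m = - H x"
proof -
  note sd = section_derivatives[OF f fd]
  have m: "mink v m = mink (T x v) (n x)" for v
    using T_isometry[OF x, of v m] by (simp add: m_def T_surj[OF x])
  have "mink (T x (wirt (-\<i>) c f x)) (T x (wirt (-\<i>) c f x)) = 0"
    by (rule reflected_isotropic(1)[OF x _ ut_facts(2)[OF x] sd(1) sd(1)]) (use x in auto)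
  then show "mink (wirt (-\<i>) c f x) (wirt (-\<i>) c f x) = 0"
    by (simp add: T_isometry[OF x])
  show "mink (f x) m = 0"
    unfolding m by (rule reflected_isotropic(2)[OF x _ w_facts(1)[OF x] transform_section(2)[OF x f] transform_section(2)[OF x f]]) (use x in auto)
  show "mink (wirt (-\<i>) c f x) m = 0"
    unfolding m by (rule reflected_isotropic(2)[OF x _ ut_facts(2)[OF x] sd(1) sd(1)]) (use x in auto)
  have Tn: "mink (T y (wirt \<i> c f y)) (n y) = 0" if "y \<in> W" for y
    by (rule reflected_isotropic(2)[OF that _ w_facts(1)[OF that] sd(2) sd(2)]) (use that in auto)
  then show "mink (wirt \<i> c f x) m = 0"
    unfolding m using x by blast
  \<comment> \<open>The zbar-derivative of \<open>f\<close> is mapped by \<open>T\<close> into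
    \<open>plane01\<close>, which is the \<open>F\<close> of the z-direction;
    \<open>nabla_normal\<close> then applies once more, now to this derivative.\<close>
  show "mink (wirt (-\<i>) c (wirt \<i> c f) x) m = 0"
  proof -
    interpret normal_bundle x W "cdiff c x" "cdiff c x" "\<lambda>h. wirts (-\<i>) c h x" n
      by (rule bundle_at[OF x])
    obtain D2 \<nu>2 A2 where g: "gauge_data D2 \<nu>2 A2 (\<lambda>y. plane10 y)
        (plane01 x)"
      and D: "nabla D2 \<nu>2 A2 1 (\<lambda>y. T y (wirt \<i> c f y)) = T x (wirt (-\<i>) c (wirt \<i> c f) x)"
      using two_step_z[OF x] fd'[OF x] by blast
    show ?thesis
      unfolding m using nabla_normal(2)[OF g cdiff_T[OF x fd'[OF x]] Tn sd(2), of 1] x unfolding D by blast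
  qed
  show "mink m m = 1"
    unfolding m using nn[OF W_mem(3)[OF x]] by (simp add: m_def T_surj[OF x])
  show "mink (cplx v_inf) m = - H x"
    unfolding m by (rule T_v_inf[OF x])
qed

end

text \<open>The alternative, \<open>m\<close> imaginary, would make the real central sphere positive definite, leaving no room
  for the null vector \<open>s\<close>.\<close>

lemma unit_normal_real:
  fixes m :: "complex^5"
  assumes m: "mink m m = 1" "conjv m = k *s m" and s: "mink (s::real^5) s = 0" "s \<noteq> 0" "mink (cplx s) m = 0"
  shows "\<exists>r. m = cplx r \<and> mink r r = 1"
proof -
  have "cnj (mink m m) = k * k * mink m m"
    unfolding mink_conjv[symmetric] m(2) mink_simps by simp
  then have "k * k = 1"
    by (simp add: m(1))
  then have "k = 1 \<or> k = -1"
    by (simp add: square_eq_1_iff)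
  then show ?thesis
  proof
    assume "k = 1"
    then obtain r where r: "m = cplx r"
      using conjv_fixed[of m] m(2) by auto
    then show ?thesis
      using m(1) by (auto simp: mink_cplx)
  next
    assume "k = -1"
    then have "conjv (\<i> *s m) = \<i> *s m"
      using m(2) by (simp add: conjv_scale)
    then obtain r where r: "\<i> *s m = cplx r"
      using conjv_fixed[of "\<i> *s m"] by auto
    have "of_real (mink r r) = (of_real (- 1) :: complex)"
      unfolding mink_cplx[symmetric] r[symmetric] mink_simps m(1) by simp
    then have rr: "mink r r = -1"
      by (simp only: of_real_eq_iff)
    have "complex_of_real (mink r s) = 0"
      unfolding mink_cplx[symmetric] r[symmetric] mink_simps using s(3) by (simp add: mink_commute)
    then have "mink r s = 0"
      by simp
    then have "mink r r \<ge> 0"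
      by (rule lorentz_orth_null(1)[OF s(1,2)])
    then show ?thesis
      using rr by simp
  qed
qed

subsection \<open>The transform of a surface of constant mean curvature\<close>

locale baecklund_surface = normal_surface M \<Lambda> v_inf N
  for M :: "'m::{t2_space, second_countable_topology} chart set"
    and \<Lambda> :: "'m \<Rightarrow> (real^5) set" and v_inf :: "real^5" and N :: "'m \<Rightarrow> real^5" +
  fixes t :: real and \<alpha> :: complex and L :: "'m \<Rightarrow> (complex^5) set"
  assumes par: "baecklund_parameters M \<Lambda> (q_inf M \<Lambda> v_inf N t) \<alpha> L"
    and perp: "\<And>x. x \<in> pts M \<Longrightarrow> L x \<subseteq> orth {p_inf M \<Lambda> v_inf N t \<alpha> x}"
    and imm': "immersed_surface M (real_points (baecklund_transform M \<Lambda> \<alpha> L))"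
begin

definition \<Lambda>' where "\<Lambda>' = real_points (baecklund_transform M \<Lambda> \<alpha> L)"
definition m where "m x = inv (r_star (rho M \<Lambda> x) \<alpha> (L x) 1) (n x)"

lemma transform_frame:
  assumes c: "hol_chart M \<Lambda> c" and \<sigma>': "lift_on M \<Lambda>' V' \<sigma>'" and x: "x \<in> fst c" "x \<in> V'"
  shows "mink (dz c (cplx \<circ> \<sigma>') x) (dz c (cplx \<circ> \<sigma>') x) = 0" "mink (cplx (\<sigma>' x)) (m x) = 0"
    "mink (dz c (cplx \<circ> \<sigma>') x) (m x) = 0" "mink (dzbar c (cplx \<circ> \<sigma>') x) (m x) = 0"
    "mink (dz c (dzbar c (cplx \<circ> \<sigma>')) x) (m x) = 0"
    "mink (m x) (m x) = 1" "mink (cplx v_inf) (m x) = - complex_of_real (mean_curvature M \<Lambda> v_inf x)"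
proof -
  have oc: "oriented_chart M c" and ch: "is_chart c"
    using hol_chartD[OF c] by auto
  have xM: "x \<in> pts M"
    using oc x(1) by (auto simp: oriented_chart_def)
  obtain V \<sigma> where \<sigma>: "x \<in> V" "lift_on M \<Lambda> V \<sigma>"
    using imm xM unfolding immersed_surface_def null_line_bundle_def by blast
  obtain Wl l where l: "x \<in> Wl" "lift_on M L Wl l"
    using par xM unfolding baecklund_parameters_def null_line_bundle_def by blast
  \<comment> \<open>One neighbourhood on which the chart, the lifts of both surfaces and the section
    of \<open>L\<close> are all available.\<close>
  define W where "W = fst c \<inter> V \<inter> Wl \<inter> V'"
  have Wx: "open W" "W \<subseteq> fst c \<inter> V" "W \<subseteq> Wl" "x \<in> W"
    using ch x \<sigma> l lift_onD(1)[OF \<sigma>(2)] lift_onD(1)[OF l(2)] lift_onD(1)[OF \<sigma>'] by (auto simp: W_def is_chart_def)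
  interpret baecklund_chart M \<Lambda> v_inf N c V W \<sigma> t \<alpha> L Wl l
    using par perp c \<sigma>(2) l(2) Wx by unfold_locales
  let ?f = "cplx \<circ> \<sigma>'"
  have f: "?f y \<in> baecklund_transform M \<Lambda> \<alpha> L y" if "y \<in> W" for y
    using lift_onD(4)[OF \<sigma>', of y] that by (simp add: W_def \<Lambda>'_def real_points_def)
  have cs: "csmooth c (fst c \<inter> V') ?f"
    by (rule lift_csmooth_cplx[OF surf oc \<sigma>'])
  have fd: "cdiff c y ?f" "cdiff c y (wirt \<i> c ?f)" if "y \<in> W" for y
    using csmooth_cdiff[OF ch cs, of y] csmooth_cdiff[OF ch csmooth_wirt[OF ch cs], of y] that by (auto simp: W_def)
  have "m x = inv (T x) (n x)"
    by (simp add: m_def r_star_eq[OF Wx(4)])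
  then show "mink (dz c (cplx \<circ> \<sigma>') x) (dz c (cplx \<circ> \<sigma>') x) = 0" "mink (cplx (\<sigma>' x)) (m x) = 0"
    "mink (dz c (cplx \<circ> \<sigma>') x) (m x) = 0" "mink (dzbar c (cplx \<circ> \<sigma>') x) (m x) = 0"
    "mink (dz c (dzbar c (cplx \<circ> \<sigma>')) x) (m x) = 0"
    "mink (m x) (m x) = 1" "mink (cplx v_inf) (m x) = - complex_of_real (mean_curvature M \<Lambda> v_inf x)"
    using section_frame[OF f fd Wx(4)] by (simp_all add: dz_wirt H_def)
qed

lemma imm_\<Lambda>': "immersed_surface M \<Lambda>'"
  using imm' by (simp add: \<Lambda>'_def)

lemma cdiff_lift: "oriented_chart M c \<Longrightarrow> lift_on M X V \<sigma> \<Longrightarrow> x \<in> fst c \<Longrightarrow> x \<in> V \<Longrightarrow> cdiff c x \<sigma>"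
proof -
  assume c: "oriented_chart M c" and \<sigma>: "lift_on M X V \<sigma>" and x: "x \<in> fst c" "x \<in> V"
  show ?thesis
    by (rule csmooth_cdiff[OF _ lift_csmooth[OF surf c \<sigma>]]) (use c x in \<open>auto simp: oriented_chart_def\<close>)
qed

text \<open>For the converse, compare \<open>c\<close> with a chart \<open>c0\<close> holomorphic
  for \<open>\<Lambda>\<close>. Both are holomorphic for the transform, so the transition is complex
  linear at \<open>x\<close> and the conformality of \<open>c0\<close> for \<open>\<Lambda>\<close>
  passes to \<open>c\<close>.\<close>

lemma hol_chart_iff: "hol_chart M \<Lambda>' c \<longleftrightarrow> hol_chart M \<Lambda> c"
proof
  show 1: "hol_chart M \<Lambda>' c" if c: "hol_chart M \<Lambda> c" for c
    unfolding hol_chart_def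
  proof (intro conjI allI impI ballI)
    show oc: "oriented_chart M c"
      by (rule hol_chartD(1)[OF c])
    fix V \<sigma> x assume \<sigma>: "lift_on M \<Lambda>' V \<sigma>" and x: "x \<in> V \<inter> fst c"
    have d: "cdiff c x \<sigma>"
      by (rule cdiff_lift[OF oc \<sigma>]) (use x in auto)
    have "mink (dz c (cplx \<circ> \<sigma>) x) (dz c (cplx \<circ> \<sigma>) x) = 0"
      by (rule transform_frame(1)[OF c \<sigma>]) (use x in auto)
    then show "let sx = chart_dx c \<sigma> x; sy = chart_dy c \<sigma> x in mink sx sx = mink sy sy \<and> mink sx sy = 0"
      unfolding conformal_iff[OF d] .
  qed
  assume c: "hol_chart M \<Lambda>' c"
  show "hol_chart M \<Lambda> c"
    unfolding hol_chart_def
  proof (intro conjI allI impI ballI)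
    show oc: "oriented_chart M c"
      by (rule hol_chartD(1)[OF c])
    fix V \<sigma> x assume \<sigma>: "lift_on M \<Lambda> V \<sigma>" and x: "x \<in> V \<inter> fst c"
    have d: "cdiff c x \<sigma>"
      by (rule cdiff_lift[OF oc \<sigma>]) (use x in auto)
    have "x \<in> pts M"
      using oc x by (auto simp: oriented_chart_def)
    then obtain c0 where c0: "hol_chart M \<Lambda> c0" "x \<in> fst c0"
      using hol by (auto simp: has_hol_charts_def)
    have xs: "x \<in> fst c"
      using x by blast
    have dc: "cdiff c x (cplx \<circ> \<sigma>)"
      unfolding o_def by (rule cdiff_linear[OF bounded_linear_cplx d])
    obtain p where p: "p \<noteq> 0" "dz c0 (cplx \<circ> \<sigma>) x = p *s dz c (cplx \<circ> \<sigma>) x"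
      using hol_charts_transition[OF surf imm_\<Lambda>' 1[OF c0(1)] c c0(2) xs] dc by blast
    have d0: "cdiff c0 x \<sigma>"
      by (rule cdiff_lift[OF hol_chartD(1)[OF c0(1)] \<sigma> c0(2)]) (use x in auto)
    have "mink (dz c0 (cplx \<circ> \<sigma>) x) (dz c0 (cplx \<circ> \<sigma>) x) = 0"
      unfolding conformal_iff[OF d0] using c0 \<sigma> x unfolding hol_chart_def by blast
    then have "mink (dz c (cplx \<circ> \<sigma>) x) (dz c (cplx \<circ> \<sigma>) x) = 0"
      using p by (simp add: mink_simps)
    then show "let sx = chart_dx c \<sigma> x; sy = chart_dy c \<sigma> x in mink sx sx = mink sy sy \<and> mink sx sy = 0"
      unfolding conformal_iff[OF d] .
  qed
qed

lemma has_hol_\<Lambda>': "has_hol_charts M \<Lambda>'"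
  using hol by (simp add: has_hol_charts_def hol_chart_iff)

lemma central_sphere_\<Lambda>':
  assumes x: "x \<in> pts M"
  shows "central_sphere M \<Lambda>' x = orth {m x}" "\<exists>r. m x = cplx r \<and> mink r r = 1"
proof -
  obtain c where c: "hol_chart M \<Lambda> c" "x \<in> fst c"
    using hol x by (auto simp: has_hol_charts_def)
  obtain V \<sigma> where \<sigma>: "x \<in> V" "lift_on M \<Lambda>' V \<sigma>"
    using imm_\<Lambda>' x unfolding immersed_surface_def null_line_bundle_def by blast
  note fr = transform_frame[OF c(1) \<sigma>(2) c(2) \<sigma>(1)]
  show "central_sphere M \<Lambda>' x = orth {m x}"
  proof (rule central_sphere_eq[OF surf imm_\<Lambda>' has_hol_\<Lambda>' x fr(6)])
    fix c V \<sigma> assume sc: "surface_chart M \<Lambda>' c V \<sigma>" and x: "x \<in> fst c \<inter> V"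
    then have "hol_chart M \<Lambda> c" "lift_on M \<Lambda>' V \<sigma>"
      using hol_chart_iff by (auto simp: surface_chart_def)
    from transform_frame(2-5)[OF this, of x] x
    show "mink (cplx (\<sigma> x)) (m x) = 0 \<and> mink (dz c (cplx \<circ> \<sigma>) x) (m x) = 0 \<and> mink (dzbar c (cplx \<circ> \<sigma>) x) (m x) = 0 \<and>
      mink (dz c (dzbar c (cplx \<circ> \<sigma>)) x) (m x) = 0"
      by blast
  qed
  interpret sc: surface_chart M \<Lambda>' c V \<sigma>
    using surf imm_\<Lambda>' c(1) hol_chart_iff \<sigma>(2) by unfold_locales auto
  have xU: "x \<in> sc.U"
    using c \<sigma> by (simp add: sc.U_def)
  have f': "mink (sc.s x) (m x) = 0" "mink (sc.s' (-\<i>) x) (m x) = 0" "mink (sc.s' \<i> x) (m x) = 0" "mink (wirt (-\<i>) c (sc.s' \<i>) x) (m x) = 0"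
    using fr(2-5) by (simp_all add: sc.s_def sc.s'_def dz_wirt)
  have conj: "mink (conjv (m x)) v = 0" if "mink (conjv v) (m x) = 0" for v
    using mink_conjv[of "m x" "conjv v"] that by (simp add: mink_commute)
  \<comment> \<open>The frame of the transform is closed under conjugation, so the conjugate of
    \<open>m x\<close> is orthogonal to it as well and hence proportional to
    \<open>m x\<close>.\<close>
  have "conjv (m x) \<in> orth {sc.s x, sc.s' (-\<i>) x, sc.s' \<i> x, wirt (-\<i>) c (sc.s' \<i>) x}"
    using f' by (auto simp: mem_orth sc.s_real sc.s'_conj[OF xU] sc.s'_conj'[OF xU] sc.mixed_real[OF xU] intro!: conj)
  also have "\<dots> = orth (orth {m x})"
    unfolding sc.frame_span(1)[OF xU fr(6) f', symmetric] orth_span by (simp add: dz_wirt sc.s'_def)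
  finally obtain k where "conjv (m x) = k *s m x"
    unfolding orth_orth_unit[OF fr(6)] span_single by blast
  moreover have "mink (\<sigma> x) (\<sigma> x) = 0" "\<sigma> x \<noteq> 0"
    using immersed_lift(2)[OF imm_\<Lambda>' \<sigma>(2,1)] lift_onD(5)[OF \<sigma>(2,1)] by auto
  ultimately show "\<exists>r. m x = cplx r \<and> mink r r = 1"
    using unit_normal_real[OF fr(6)] fr(2) by blast
qed

text \<open>The product of \<open>v_inf\<close> with the new normal is the negative of the old
  curvature; the absolute value comes from the square root in \<open>mean_curvature\<close>.\<close>

lemma mean_curvature_\<Lambda>':
  assumes x: "x \<in> pts M"
  shows "mean_curvature M \<Lambda>' v_inf x = \<bar>mean_curvature M \<Lambda> v_inf x\<bar>"
proof -
  obtain r where r: "m x = cplx r" "mink r r = 1"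
    using central_sphere_\<Lambda>'(2)[OF x] by blast
  have "real_central_sphere M \<Lambda>' x = orth {r}"
    by (auto simp: real_central_sphere_def real_points_def central_sphere_\<Lambda>'(1)[OF x] mem_orth r(1) mink_cplx)
  then have "vperp M \<Lambda>' v_inf x = mink v_inf r *s r"
    by (simp add: vperp_def proj_orth_unit[OF r(2)])
  then have 1: "mean_curvature M \<Lambda>' v_inf x = \<bar>mink v_inf r\<bar>"
    by (simp add: mean_curvature_def mink_simps r(2))
  obtain c where c: "hol_chart M \<Lambda> c" "x \<in> fst c"
    using hol x by (auto simp: has_hol_charts_def)
  obtain V \<sigma> where \<sigma>: "x \<in> V" "lift_on M \<Lambda>' V \<sigma>"
    using imm_\<Lambda>' x unfolding immersed_surface_def null_line_bundle_def by blast
  have "complex_of_real (mink v_inf r) = of_real (- mean_curvature M \<Lambda> v_inf x)"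
    using transform_frame(7)[OF c(1) \<sigma>(2) c(2) \<sigma>(1)] by (simp add: r(1) mink_cplx)
  then have "mink v_inf r = - mean_curvature M \<Lambda> v_inf x"
    by (simp only: of_real_eq_iff)
  then show ?thesis
    by (simp add: 1)
qed

end

theorem theorem8p37:
  fixes M :: "'m::{t2_space, second_countable_topology} chart set"
    and \<Lambda> :: "'m \<Rightarrow> (real^5) set"
    and v_inf :: "real^5"
    and N :: "'m \<Rightarrow> real^5"
    and t :: real
    and \<alpha> :: complex
    and L :: "'m \<Rightarrow> (complex^5) set"
  assumes "oriented_surface M" "connected (pts M)" "pts M \<noteq> {}"
    and "v_inf \<noteq> 0"
    and "\<not> in_some_2_sphere M \<Lambda>"
    and "\<And>x. x \<in> pts M \<Longrightarrow> \<Lambda> x \<inter> space_form v_inf \<noteq> {}"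
    and "cmc_surface M \<Lambda> v_inf"
    and "unit_normal M \<Lambda> v_inf N"
    and "baecklund_parameters M \<Lambda> (q_inf M \<Lambda> v_inf N t) \<alpha> L"
    and "\<And>x. x \<in> pts M \<Longrightarrow> L x \<subseteq> orth {p_inf M \<Lambda> v_inf N t \<alpha> x}"
    and "immersed_surface M (real_points (baecklund_transform M \<Lambda> \<alpha> L))"
  shows "cmc_surface M (real_points (baecklund_transform M \<Lambda> \<alpha> L)) v_inf"
proof -
  interpret baecklund_surface M \<Lambda> v_inf N t \<alpha> L
    using assms by unfold_locales (auto simp: cmc_surface_def)
  obtain H where "\<And>x. x \<in> pts M \<Longrightarrow> mean_curvature M \<Lambda> v_inf x = H"
    using assms(7) by (auto simp: cmc_surface_def)
  then have "\<forall>x\<in>pts M. mean_curvature M \<Lambda>' v_inf x = \<bar>H\<bar>"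
    by (simp add: mean_curvature_\<Lambda>')
  then show ?thesis
    using imm_\<Lambda>' has_hol_\<Lambda>' unfolding cmc_surface_def \<Lambda>'_def by blast
qed

end
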